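(* Let $1\le p<\infty$. If $\gamma$ is a piecewise $C^1$ curve in $\mathcal O$, then $L_{\mathcal O,p}(\gamma)\ge\ell_p(\gamma)$. If $x,u\cdot x\in\mathcal O$ (with $u\in\mathcal U_{\mathcal M}$), then $d_{\ell,p}(x,u\cdot x)=d_{\mathcal O,p}(x,u\cdot x)$.
   Context: $\mathcal M$ is a von Neumann algebra with a faithful normal tracial state $\tau$; $\|a\|_p=\tau(|a|^p)^{1/p}$; $\mathcal M_{sh}$ is the set of skew-hermitian elements and $\mathcal U_{\mathcal M}$ the unitary group, a Banach-Lie group in the uniform (operator) norm with Lie algebra $\mathcal M_{sh}$. $\mathcal O$ is a smooth homogeneous space of $\mathcal U_{\mathcal M}$: a topological space on which $\mathcal U_{\mathcal M}$ acts continuously and transitively, such that for each $x\in\mathcal O$ the isotropy group $G_x=\{u\in\mathcal U_{\mathcal M}:u\cdot x=x\}$ is a closed submanifold of $\mathcal U_{\mathcal M}$ (uniform topology); $\mathcal O$ carries the resulting manifold structure, for which $\pi_x:\mathcal U_{\mathcal M}\to\mathcal O$, $\pi_x(u)=u\cdot x$, is a smooth submersion. "Smooth" curve means $C^1$ with nonzero derivative; constant curves are also admitted. The quotient metric on $T_y\mathcal O$ ($y\in\mathcal O$) is $\|X\|_{y,p}=\inf\{\|z\|_p:z\in\mathcal M_{sh},(\pi_y)_{*1}(z)=X\}$. For a piecewise $C^1$ curve $\gamma:[0,1]\to\mathcal O$, $L_{\mathcal O,p}(\gamma)=\int_0^1\|\dot\gamma(t)\|_{\gamma(t),p}\,dt$,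 and $d_{\mathcal O,p}(y_0,y_1)$ is the infimum of $L_{\mathcal O,p}(\gamma)$ over piecewise smooth curves $\gamma$ in $\mathcal O$ joining $y_0$ to $y_1$ (a distance when $G_x$ is closed in the $p$-norm, in general a pseudo-distance). For a path $\gamma:[0,1]\to\mathcal O$ (continuous for $d_{\mathcal O,p}$), its rectifiable length is $$\ell_p(\gamma)=\sup_{\{t_i\}}\sum_{i=0}^{n-1}d_{\mathcal O,p}(\gamma(t_i),\gamma(t_{i+1})),$$ the supremum over finite partitions $0=t_0<\dots<t_n=1$ of $[0,1]$; $\gamma$ is rectifiable if $\ell_p(\gamma)<\infty$. $d_{\ell,p}(y_0,y_1)$ is the infimum of $\ell_p(\gamma)$ over the rectifiable paths $\gamma$ joining $y_0$ to $y_1$. *)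

theory Defs
  imports "HOL-Analysis.Analysis" "HOL-Computational_Algebra.Polynomial"
begin

section \<open>Von Neumann algebras with a tracial state\<close>

text \<open>Complex Hilbert spaces; the inner product is linear in its first argument.\<close>

class complex_hilbert = banach +
  fixes scaleC :: "complex \<Rightarrow> 'a \<Rightarrow> 'a"
    and cinner :: "'a \<Rightarrow> 'a \<Rightarrow> complex"
  assumes scaleC_add_right: "scaleC c (x + y) = scaleC c x + scaleC c y"
    and scaleC_add_left: "scaleC (c + d) x = scaleC c x + scaleC d x"
    and scaleC_scaleC: "scaleC c (scaleC d x) = scaleC (c * d) x"
    and scaleC_of_real: "scaleC (of_real r) x = scaleR r x"
    and cinner_commute: "cinner x y = cnj (cinner y x)"
    and cinner_add_left: "cinner (x + y) z = cinner x z + cinner y z"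
    and cinner_scaleC_left: "cinner (scaleC c x) y = c * cinner x y"
    and cinner_self: "cinner x x = of_real ((norm x)\<^sup>2)"

text \<open>The type of bounded operators below consists of the real-linear ones, so
  complex linearity is imposed separately. Its norm is the operator norm.\<close>

definition bounded_ops :: "('h::complex_hilbert \<Rightarrow>\<^sub>L 'h) set" where
  "bounded_ops = {a. \<forall>c x. blinfun_apply a (scaleC c x) = scaleC c (blinfun_apply a x)}"

definition op_scaleC :: "complex \<Rightarrow> ('h::complex_hilbert \<Rightarrow>\<^sub>L 'h) \<Rightarrow> ('h \<Rightarrow>\<^sub>L 'h)" where
  "op_scaleC c a = Blinfun (\<lambda>x. scaleC c (blinfun_apply a x))"

definition is_adjoint :: "('h::complex_hilbert \<Rightarrow>\<^sub>L 'h) \<Rightarrow> ('h \<Rightarrow>\<^sub>L 'h) \<Rightarrow> bool" where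
  "is_adjoint a b \<longleftrightarrow> (\<forall>x y. cinner (blinfun_apply a x) y = cinner x (blinfun_apply b y))"

definition adj :: "('h::complex_hilbert \<Rightarrow>\<^sub>L 'h) \<Rightarrow> ('h \<Rightarrow>\<^sub>L 'h)" where
  "adj a = (THE b. is_adjoint a b)"

definition positive_op :: "('h::complex_hilbert \<Rightarrow>\<^sub>L 'h) \<Rightarrow> bool" where
  "positive_op a \<longleftrightarrow> (\<forall>x. cinner (blinfun_apply a x) x \<in> \<real>\<^sub>\<ge>\<^sub>0)"

definition op_le :: "('h::complex_hilbert \<Rightarrow>\<^sub>L 'h) \<Rightarrow> ('h \<Rightarrow>\<^sub>L 'h) \<Rightarrow> bool" where
  "op_le a b \<longleftrightarrow> positive_op (b - a)"

definition commutant :: "('h::complex_hilbert \<Rightarrow>\<^sub>L 'h) set \<Rightarrow> ('h \<Rightarrow>\<^sub>L 'h) set" where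
  "commutant S = {a \<in> bounded_ops. \<forall>s\<in>S. a o\<^sub>L s = s o\<^sub>L a}"

definition von_neumann_algebra :: "('h::complex_hilbert \<Rightarrow>\<^sub>L 'h) set \<Rightarrow> bool" where
  "von_neumann_algebra M \<longleftrightarrow>
     M \<subseteq> bounded_ops \<and> (\<forall>a\<in>M. \<exists>b\<in>M. is_adjoint a b) \<and> commutant (commutant M) = M"

definition self_adjoint_part :: "('h::complex_hilbert \<Rightarrow>\<^sub>L 'h) set \<Rightarrow> ('h \<Rightarrow>\<^sub>L 'h) set" where
  "self_adjoint_part M = {a \<in> M. is_adjoint a a}"

text \<open>Normality: the trace preserves suprema of upward directed sets of self-adjoint
  elements (equivalently, of bounded increasing nets).\<close>

definition normal_functional ::
  "('h::complex_hilbert \<Rightarrow>\<^sub>L 'h) set \<Rightarrow> (('h \<Rightarrow>\<^sub>L 'h) \<Rightarrow> complex) \<Rightarrow> bool" where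
  "normal_functional M \<tau> \<longleftrightarrow>
     (\<forall>D s. D \<subseteq> self_adjoint_part M \<and> D \<noteq> {} \<and>
        (\<forall>a\<in>D. \<forall>b\<in>D. \<exists>c\<in>D. op_le a c \<and> op_le b c) \<and>
        s \<in> self_adjoint_part M \<and> (\<forall>a\<in>D. op_le a s) \<and>
        (\<forall>t\<in>self_adjoint_part M. (\<forall>a\<in>D. op_le a t) \<longrightarrow> op_le s t)
        \<longrightarrow> Re (\<tau> s) = (SUP a\<in>D. Re (\<tau> a)))"

definition faithful_normal_tracial_state ::
  "('h::complex_hilbert \<Rightarrow>\<^sub>L 'h) set \<Rightarrow> (('h \<Rightarrow>\<^sub>L 'h) \<Rightarrow> complex) \<Rightarrow> bool" where
  "faithful_normal_tracial_state M \<tau> \<longleftrightarrow>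
     (\<forall>a\<in>M. \<forall>b\<in>M. \<tau> (a + b) = \<tau> a + \<tau> b) \<and>
     (\<forall>c. \<forall>a\<in>M. \<tau> (op_scaleC c a) = c * \<tau> a) \<and>
     (\<forall>a\<in>M. positive_op a \<longrightarrow> \<tau> a \<in> \<real>\<^sub>\<ge>\<^sub>0) \<and>
     \<tau> id_blinfun = 1 \<and>
     (\<forall>a\<in>M. \<forall>b\<in>M. \<tau> (a o\<^sub>L b) = \<tau> (b o\<^sub>L a)) \<and>
     (\<forall>a\<in>M. \<tau> (adj a o\<^sub>L a) = 0 \<longrightarrow> a = 0) \<and>
     normal_functional M \<tau>"

subsection \<open>The p-norm\<close>

definition op_poly :: "real poly \<Rightarrow> ('h::complex_hilbert \<Rightarrow>\<^sub>L 'h) \<Rightarrow> ('h \<Rightarrow>\<^sub>L 'h)" where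
  "op_poly q a = (\<Sum>i\<le>degree q. coeff q i *\<^sub>R (((o\<^sub>L) a ^^ i) id_blinfun))"

text \<open>Continuous functional calculus of a positive operator \<open>a\<close>, whose spectrum lies in
  \<open>[0, \<parallel>a\<parallel>]\<close>, for functions continuous on that interval.\<close>

definition cfc :: "(real \<Rightarrow> real) \<Rightarrow> ('h::complex_hilbert \<Rightarrow>\<^sub>L 'h) \<Rightarrow> ('h \<Rightarrow>\<^sub>L 'h)" where
  "cfc f a = (THE b. \<forall>q. uniform_limit {0..norm a} (\<lambda>n t. poly (q n) t) f sequentially
                        \<longrightarrow> (\<lambda>n. op_poly (q n) a) \<longlonglongrightarrow> b)"

definition op_abs :: "('h::complex_hilbert \<Rightarrow>\<^sub>L 'h) \<Rightarrow> ('h \<Rightarrow>\<^sub>L 'h)" where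
  "op_abs a = cfc sqrt (adj a o\<^sub>L a)"

definition pnorm ::
  "(('h::complex_hilbert \<Rightarrow>\<^sub>L 'h) \<Rightarrow> complex) \<Rightarrow> real \<Rightarrow> ('h \<Rightarrow>\<^sub>L 'h) \<Rightarrow> real" where
  "pnorm \<tau> p a = Re (\<tau> (cfc (\<lambda>t. t powr p) (op_abs a))) powr (1 / p)"

section \<open>Banach manifolds\<close>

text \<open>A real multilinear map of \<open>n\<close> arguments is a function on lists of length \<open>n\<close>.\<close>

definition bounded_multilinear_on ::
  "'e::real_normed_vector set \<Rightarrow> nat \<Rightarrow> ('e list \<Rightarrow> 'f::real_normed_vector) \<Rightarrow> bool" where
  "bounded_multilinear_on E n m \<longleftrightarrow>
     (\<forall>us ws v v' c. set us \<subseteq> E \<and> set ws \<subseteq> E \<and> v \<in> E \<and> v' \<in> E \<and> length us + length ws + 1 = n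
        \<longrightarrow> m (us @ (v + v') # ws) = m (us @ v # ws) + m (us @ v' # ws) \<and>
            m (us @ (c *\<^sub>R v) # ws) = c *\<^sub>R m (us @ v # ws)) \<and>
     (\<exists>K. \<forall>vs. set vs \<subseteq> E \<and> length vs = n \<longrightarrow> norm (m vs) \<le> K * prod_list (map norm vs))"

text \<open>\<open>C\<^sup>\<infinity>\<close> maps on a relatively open subset \<open>W\<close> of the closed subspace \<open>E\<close>. For lists \<open>vs\<close> of
  length \<open>n\<close>, \<open>D x vs\<close> is the \<open>n\<close>-th Frechet derivative at \<open>x\<close>; the last clause says
  that \<open>x \<mapsto> D x\<close> on lists of length \<open>n\<close> is Frechet differentiable, in the norm of
  bounded \<open>n\<close>-linear maps on \<open>E\<close>, with derivative given by \<open>D x\<close> on lists of length \<open>n + 1\<close>.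
  (A bounded linear map on \<open>E\<close> need not extend to the ambient space, so the library's
  derivative within a set is not adequate here.)\<close>

definition smooth_on ::
  "'e::real_normed_vector set \<Rightarrow> 'e set \<Rightarrow> ('e \<Rightarrow> 'f::real_normed_vector) \<Rightarrow> bool" where
  "smooth_on E W f \<longleftrightarrow> (\<exists>D :: 'e \<Rightarrow> 'e list \<Rightarrow> 'f.
     (\<forall>x\<in>W. D x [] = f x) \<and>
     (\<forall>x\<in>W. \<forall>n. bounded_multilinear_on E n (D x)) \<and>
     (\<forall>n. \<forall>x\<in>W. \<forall>\<epsilon>>0. \<exists>\<delta>>0. \<forall>y\<in>W. norm (y - x) < \<delta> \<longrightarrow>
        (\<forall>vs. set vs \<subseteq> E \<and> length vs = n \<longrightarrow>
           norm (D y vs - D x vs - D x ((y - x) # vs)) \<le> \<epsilon> * norm (y - x) * prod_list (map norm vs))))"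

definition frechet_deriv_on ::
  "'e::real_normed_vector set \<Rightarrow> ('e \<Rightarrow> 'f::real_normed_vector) \<Rightarrow> ('e \<Rightarrow> 'f) \<Rightarrow> 'e \<Rightarrow> bool" where
  "frechet_deriv_on E f L x \<longleftrightarrow>
     (\<forall>v\<in>E. \<forall>w\<in>E. L (v + w) = L v + L w) \<and> (\<forall>c. \<forall>v\<in>E. L (c *\<^sub>R v) = c *\<^sub>R L v) \<and>
     (\<exists>K. \<forall>v\<in>E. norm (L v) \<le> K * norm v) \<and>
     ((\<lambda>y. (f y - f x - L (y - x)) /\<^sub>R norm (y - x)) \<longlongrightarrow> 0) (at x within E)"

definition split_subspace :: "'e::real_normed_vector set \<Rightarrow> 'e set \<Rightarrow> bool" where
  "split_subspace E F \<longleftrightarrow> subspace F \<and> closed F \<and> F \<subseteq> E \<and>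
     (\<exists>F'. subspace F' \<and> closed F' \<and> F' \<subseteq> E \<and> F \<inter> F' = {0} \<and> (\<forall>v\<in>E. \<exists>a\<in>F. \<exists>b\<in>F'. v = a + b))"

text \<open>The model space is a closed subspace of the Banach space type \<open>'e\<close>.\<close>

record ('x, 'e) bmanifold =
  mtop :: "'x topology"
  model :: "'e set"
  atlas :: "('x set \<times> ('x \<Rightarrow> 'e)) set"

definition is_chart :: "('x, 'e::banach) bmanifold \<Rightarrow> 'x set \<times> ('x \<Rightarrow> 'e) \<Rightarrow> bool" where
  "is_chart N c \<longleftrightarrow> (case c of (V, \<phi>) \<Rightarrow>
     openin (mtop N) V \<and> openin (top_of_set (model N)) (\<phi> ` V) \<and>
     homeomorphic_map (subtopology (mtop N) V) (top_of_set (\<phi> ` V)) \<phi>)"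

definition compatible_charts ::
  "'e::banach set \<Rightarrow> 'x set \<times> ('x \<Rightarrow> 'e) \<Rightarrow> 'x set \<times> ('x \<Rightarrow> 'e) \<Rightarrow> bool" where
  "compatible_charts E c c' \<longleftrightarrow> (case (c, c') of ((V, \<phi>), (W, \<psi>)) \<Rightarrow>
     smooth_on E (\<phi> ` (V \<inter> W)) (\<psi> \<circ> inv_into V \<phi>) \<and>
     smooth_on E (\<psi> ` (V \<inter> W)) (\<phi> \<circ> inv_into W \<psi>))"

definition banach_manifold :: "('x, 'e::banach) bmanifold \<Rightarrow> bool" where
  "banach_manifold N \<longleftrightarrow> subspace (model N) \<and> closed (model N) \<and>
     (\<forall>c\<in>atlas N. is_chart N c) \<and> \<Union>(fst ` atlas N) = topspace (mtop N) \<and>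
     (\<forall>c\<in>atlas N. \<forall>c'\<in>atlas N. compatible_charts (model N) c c')"

definition closed_submanifold :: "('x, 'e::banach) bmanifold \<Rightarrow> 'x set \<Rightarrow> bool" where
  "closed_submanifold N S \<longleftrightarrow> closedin (mtop N) S \<and>
     (\<forall>s\<in>S. \<exists>V \<phi> F. s \<in> V \<and> is_chart N (V, \<phi>) \<and>
        (\<forall>c\<in>atlas N. compatible_charts (model N) (V, \<phi>) c) \<and>
        split_subspace (model N) F \<and> \<phi> ` (V \<inter> S) = \<phi> ` V \<inter> F)"

definition smooth_map ::
  "('x, 'e::banach) bmanifold \<Rightarrow> ('y, 'f::banach) bmanifold \<Rightarrow> ('x \<Rightarrow> 'y) \<Rightarrow> bool" where
  "smooth_map N N' f \<longleftrightarrow> continuous_map (mtop N) (mtop N') f \<and>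
     (\<forall>(V, \<phi>)\<in>atlas N. \<forall>(W, \<psi>)\<in>atlas N'.
        smooth_on (model N) (\<phi> ` {x \<in> V. f x \<in> W}) (\<psi> \<circ> f \<circ> inv_into V \<phi>))"

definition smooth_submersion ::
  "('x, 'e::banach) bmanifold \<Rightarrow> ('y, 'f::banach) bmanifold \<Rightarrow> ('x \<Rightarrow> 'y) \<Rightarrow> bool" where
  "smooth_submersion N N' f \<longleftrightarrow> smooth_map N N' f \<and>
     (\<forall>(V, \<phi>)\<in>atlas N. \<forall>(W, \<psi>)\<in>atlas N'. \<forall>x\<in>V. f x \<in> W \<longrightarrow>
        (\<exists>L. frechet_deriv_on (model N) (\<psi> \<circ> f \<circ> inv_into V \<phi>) L (\<phi> x) \<and>
             L ` model N = model N' \<and> split_subspace (model N) {v \<in> model N. L v = 0}))"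

subsection \<open>Curves\<close>

text \<open>A tangent vector at \<open>y\<close> is the family of its coordinates in the charts of the atlas
  around \<open>y\<close>, extended by \<open>0\<close> to all other charts.\<close>

type_synonym ('x, 'e) tangent_vector = "'x set \<times> ('x \<Rightarrow> 'e) \<Rightarrow> 'e"

definition velocity ::
  "('x, 'e::banach) bmanifold \<Rightarrow> (real \<Rightarrow> 'x) \<Rightarrow> real \<Rightarrow> ('x, 'e) tangent_vector" where
  "velocity N \<gamma> t = (\<lambda>c. if c \<in> atlas N \<and> \<gamma> t \<in> fst c
                          then vector_derivative (snd c \<circ> \<gamma>) (at t) else 0)"

definition C1_curve_on :: "('x, 'e::banach) bmanifold \<Rightarrow> (real \<Rightarrow> 'x) \<Rightarrow> real \<Rightarrow> real \<Rightarrow> bool" where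
  "C1_curve_on N \<gamma> a b \<longleftrightarrow> continuous_map (top_of_set {a..b}) (mtop N) \<gamma> \<and>
     (\<forall>(V, \<phi>)\<in>atlas N.
        (\<forall>t\<in>{a..b}. \<gamma> t \<in> V \<longrightarrow> (\<phi> \<circ> \<gamma>) differentiable (at t within {a..b})) \<and>
        continuous_on {t \<in> {a..b}. \<gamma> t \<in> V}
          (\<lambda>t. vector_derivative (\<phi> \<circ> \<gamma>) (at t within {a..b})))"

definition smooth_curve_on :: "('x, 'e::banach) bmanifold \<Rightarrow> (real \<Rightarrow> 'x) \<Rightarrow> real \<Rightarrow> real \<Rightarrow> bool" where
  "smooth_curve_on N \<gamma> a b \<longleftrightarrow> C1_curve_on N \<gamma> a b \<and>
     ((\<forall>(V, \<phi>)\<in>atlas N. \<forall>t\<in>{a..b}. \<gamma> t \<in> V \<longrightarrow>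
          vector_derivative (\<phi> \<circ> \<gamma>) (at t within {a..b}) \<noteq> 0) \<or>
      (\<forall>s\<in>{a..b}. \<forall>t\<in>{a..b}. \<gamma> s = \<gamma> t))"

definition unit_partition :: "nat \<Rightarrow> (nat \<Rightarrow> real) \<Rightarrow> bool" where
  "unit_partition n t \<longleftrightarrow> t 0 = 0 \<and> t n = 1 \<and> (\<forall>i<n. t i < t (Suc i))"

definition piecewise_C1 :: "('x, 'e::banach) bmanifold \<Rightarrow> (real \<Rightarrow> 'x) \<Rightarrow> bool" where
  "piecewise_C1 N \<gamma> \<longleftrightarrow>
     (\<exists>n t. unit_partition n t \<and> (\<forall>i<n. C1_curve_on N \<gamma> (t i) (t (Suc i))))"

definition piecewise_smooth :: "('x, 'e::banach) bmanifold \<Rightarrow> (real \<Rightarrow> 'x) \<Rightarrow> bool" where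
  "piecewise_smooth N \<gamma> \<longleftrightarrow>
     (\<exists>n t. unit_partition n t \<and> (\<forall>i<n. smooth_curve_on N \<gamma> (t i) (t (Suc i))))"

section \<open>Smooth homogeneous spaces of the unitary group\<close>

definition unitary_group :: "('h::complex_hilbert \<Rightarrow>\<^sub>L 'h) set \<Rightarrow> ('h \<Rightarrow>\<^sub>L 'h) set" where
  "unitary_group M = {u \<in> M. adj u o\<^sub>L u = id_blinfun \<and> u o\<^sub>L adj u = id_blinfun}"

definition skew_hermitian :: "('h::complex_hilbert \<Rightarrow>\<^sub>L 'h) set \<Rightarrow> ('h \<Rightarrow>\<^sub>L 'h) set" where
  "skew_hermitian M = {z \<in> M. adj z = - z}"

definition op_exp :: "('h::complex_hilbert \<Rightarrow>\<^sub>L 'h) \<Rightarrow> ('h \<Rightarrow>\<^sub>L 'h)" where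
  "op_exp a = (\<Sum>n. (1 / fact n) *\<^sub>R (((o\<^sub>L) a ^^ n) id_blinfun))"

text \<open>The Banach-Lie group structure of the unitary group: around each \<open>u\<close> the inverse of the
  exponential parametrisation \<open>z \<mapsto> u exp z\<close> is a chart. The radius \<open>1/2\<close> is less than
  \<open>ln 2\<close>, hence small enough for the parametrisation to be injective.\<close>

definition exp_ball :: "('h::complex_hilbert \<Rightarrow>\<^sub>L 'h) set \<Rightarrow> ('h \<Rightarrow>\<^sub>L 'h) set" where
  "exp_ball M = {z \<in> skew_hermitian M. norm z < 1 / 2}"

definition unitary_manifold ::
  "('h::complex_hilbert \<Rightarrow>\<^sub>L 'h) set \<Rightarrow> ('h \<Rightarrow>\<^sub>L 'h, 'h \<Rightarrow>\<^sub>L 'h) bmanifold" where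
  "unitary_manifold M =
     \<lparr> mtop = top_of_set (unitary_group M),
       model = skew_hermitian M,
       atlas = (\<lambda>u. ((\<lambda>z. u o\<^sub>L op_exp z) ` exp_ball M,
                     inv_into (exp_ball M) (\<lambda>z. u o\<^sub>L op_exp z))) ` unitary_group M \<rparr>"

definition isotropy ::
  "('h::complex_hilbert \<Rightarrow>\<^sub>L 'h) set \<Rightarrow> (('h \<Rightarrow>\<^sub>L 'h) \<Rightarrow> 'x \<Rightarrow> 'x) \<Rightarrow> 'x \<Rightarrow> ('h \<Rightarrow>\<^sub>L 'h) set" where
  "isotropy M act x = {u \<in> unitary_group M. act u x = x}"

definition smooth_homogeneous_space ::
  "('h::complex_hilbert \<Rightarrow>\<^sub>L 'h) set \<Rightarrow> (('h \<Rightarrow>\<^sub>L 'h) \<Rightarrow> 'x \<Rightarrow> 'x) \<Rightarrow> ('x, 'e::banach) bmanifold \<Rightarrow> bool" where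
  "smooth_homogeneous_space M act N \<longleftrightarrow>
     (\<forall>x\<in>topspace (mtop N). act id_blinfun x = x) \<and>
     (\<forall>u\<in>unitary_group M. \<forall>v\<in>unitary_group M. \<forall>x\<in>topspace (mtop N).
        act (u o\<^sub>L v) x = act u (act v x)) \<and>
     continuous_map (prod_topology (top_of_set (unitary_group M)) (mtop N)) (mtop N)
       (\<lambda>(u, x). act u x) \<and>
     (\<forall>x\<in>topspace (mtop N). \<forall>y\<in>topspace (mtop N). \<exists>u\<in>unitary_group M. act u x = y) \<and>
     (\<forall>x\<in>topspace (mtop N). closed_submanifold (unitary_manifold M) (isotropy M act x)) \<and>
     banach_manifold N \<and>
     (\<forall>x\<in>topspace (mtop N). smooth_submersion (unitary_manifold M) N (\<lambda>u. act u x))"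

subsection \<open>The quotient metric and its distances\<close>

text \<open>The differential at \<open>1\<close> of \<open>u \<mapsto> act u y\<close>, on the Lie algebra.\<close>

definition orbit_differential ::
  "(('h::complex_hilbert \<Rightarrow>\<^sub>L 'h) \<Rightarrow> 'x \<Rightarrow> 'x) \<Rightarrow> ('x, 'e::banach) bmanifold \<Rightarrow> 'x \<Rightarrow> ('h \<Rightarrow>\<^sub>L 'h)
     \<Rightarrow> ('x, 'e) tangent_vector" where
  "orbit_differential act N y z = velocity N (\<lambda>s. act (op_exp (s *\<^sub>R z)) y) 0"

definition quotient_norm ::
  "('h::complex_hilbert \<Rightarrow>\<^sub>L 'h) set \<Rightarrow> (('h \<Rightarrow>\<^sub>L 'h) \<Rightarrow> complex) \<Rightarrow> real \<Rightarrow> (('h \<Rightarrow>\<^sub>L 'h) \<Rightarrow> 'x \<Rightarrow> 'x)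
     \<Rightarrow> ('x, 'e::banach) bmanifold \<Rightarrow> 'x \<Rightarrow> ('x, 'e) tangent_vector \<Rightarrow> ennreal" where
  "quotient_norm M \<tau> p act N y X =
     (INF z\<in>{z \<in> skew_hermitian M. orbit_differential act N y z = X}. ennreal (pnorm \<tau> p z))"

text \<open>The velocity is not meaningful at the finitely many break points of a piecewise
  \<open>C\<^sup>1\<close> curve; these form a null set.\<close>

definition curve_length ::
  "('h::complex_hilbert \<Rightarrow>\<^sub>L 'h) set \<Rightarrow> (('h \<Rightarrow>\<^sub>L 'h) \<Rightarrow> complex) \<Rightarrow> real \<Rightarrow> (('h \<Rightarrow>\<^sub>L 'h) \<Rightarrow> 'x \<Rightarrow> 'x)
     \<Rightarrow> ('x, 'e::banach) bmanifold \<Rightarrow> (real \<Rightarrow> 'x) \<Rightarrow> ennreal" where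
  "curve_length M \<tau> p act N \<gamma> =
     (\<integral>\<^sup>+ t\<in>{0..1}. quotient_norm M \<tau> p act N (\<gamma> t) (velocity N \<gamma> t) \<partial>lborel)"

definition quotient_dist ::
  "('h::complex_hilbert \<Rightarrow>\<^sub>L 'h) set \<Rightarrow> (('h \<Rightarrow>\<^sub>L 'h) \<Rightarrow> complex) \<Rightarrow> real \<Rightarrow> (('h \<Rightarrow>\<^sub>L 'h) \<Rightarrow> 'x \<Rightarrow> 'x)
     \<Rightarrow> ('x, 'e::banach) bmanifold \<Rightarrow> 'x \<Rightarrow> 'x \<Rightarrow> ennreal" where
  "quotient_dist M \<tau> p act N y0 y1 =
     (INF \<gamma>\<in>{\<gamma>. piecewise_smooth N \<gamma> \<and> \<gamma> 0 = y0 \<and> \<gamma> 1 = y1}. curve_length M \<tau> p act N \<gamma>)"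

definition quotient_path ::
  "('h::complex_hilbert \<Rightarrow>\<^sub>L 'h) set \<Rightarrow> (('h \<Rightarrow>\<^sub>L 'h) \<Rightarrow> complex) \<Rightarrow> real \<Rightarrow> (('h \<Rightarrow>\<^sub>L 'h) \<Rightarrow> 'x \<Rightarrow> 'x)
     \<Rightarrow> ('x, 'e::banach) bmanifold \<Rightarrow> (real \<Rightarrow> 'x) \<Rightarrow> bool" where
  "quotient_path M \<tau> p act N \<gamma> \<longleftrightarrow> \<gamma> ` {0..1} \<subseteq> topspace (mtop N) \<and>
     (\<forall>t\<in>{0..1::real}. ((\<lambda>s. quotient_dist M \<tau> p act N (\<gamma> s) (\<gamma> t)) \<longlongrightarrow> 0) (at t within {0..1}))"

definition rectifiable_length ::
  "('h::complex_hilbert \<Rightarrow>\<^sub>L 'h) set \<Rightarrow> (('h \<Rightarrow>\<^sub>L 'h) \<Rightarrow> complex) \<Rightarrow> real \<Rightarrow> (('h \<Rightarrow>\<^sub>L 'h) \<Rightarrow> 'x \<Rightarrow> 'x)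
     \<Rightarrow> ('x, 'e::banach) bmanifold \<Rightarrow> (real \<Rightarrow> 'x) \<Rightarrow> ennreal" where
  "rectifiable_length M \<tau> p act N \<gamma> =
     (SUP (n, t)\<in>{(n, t). unit_partition n t}.
        \<Sum>i<n. quotient_dist M \<tau> p act N (\<gamma> (t i)) (\<gamma> (t (Suc i))))"

definition rectifiable_dist ::
  "('h::complex_hilbert \<Rightarrow>\<^sub>L 'h) set \<Rightarrow> (('h \<Rightarrow>\<^sub>L 'h) \<Rightarrow> complex) \<Rightarrow> real \<Rightarrow> (('h \<Rightarrow>\<^sub>L 'h) \<Rightarrow> 'x \<Rightarrow> 'x)
     \<Rightarrow> ('x, 'e::banach) bmanifold \<Rightarrow> 'x \<Rightarrow> 'x \<Rightarrow> ennreal" where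
  "rectifiable_dist M \<tau> p act N y0 y1 =
     (INF \<gamma>\<in>{\<gamma>. quotient_path M \<tau> p act N \<gamma> \<and> rectifiable_length M \<tau> p act N \<gamma> < \<infinity> \<and>
                 \<gamma> 0 = y0 \<and> \<gamma> 1 = y1}. rectifiable_length M \<tau> p act N \<gamma>)"

end

theory Submission
  imports Defs
begin

text \<open>The length inequality reduces to \<open>d (\<gamma> u) (\<gamma> v) \<le> \<integral> \<parallel>\<gamma>'\<parallel>\<close> over \<open>[u, v]\<close>, summed over a
partition; the equality of the two distances then follows, because a piecewise smooth curve of
finite length is a rectifiable path that is no longer than itself, while the trivial partition
gives \<open>d (\<gamma> 0) (\<gamma> 1) \<le> \<ell> (\<gamma>)\<close> for every path.

A piecewise \<open>C\<^sup>1\<close> curve need not be an admissible competitor for the distance, since its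
velocity may vanish, so it is replaced by chains of exponential curves
\<open>s \<mapsto> exp (s z) \<cdot> y\<close>. Such a curve has the velocity of \<open>z\<close> at each of its points, hence its length
is at most \<open>\<parallel>z\<parallel>\<^sub>p\<close>; and it is admissible, because its velocity vanishes either nowhere or
everywhere (\<open>exp_curve_smooth\<close>). Therefore a chain of steps \<open>y \<mapsto> exp z \<cdot> y\<close> costs at most the sum
of the numbers \<open>\<parallel>z\<parallel>\<^sub>p\<close> (\<open>qdist_le_exp_chain\<close>).

Let \<open>\<gamma>\<close> be differentiable at \<open>t\<close> and let \<open>z\<close> be a lift of \<open>\<gamma>' t\<close> to the Lie algebra. The orbit map
\<open>k \<mapsto> exp k \<cdot> \<gamma> t\<close> is smooth with surjective derivative, so it is metrically regular (Graves'
theorem, \<open>metric_regularity\<close>), and \<open>\<gamma> (t + h) = exp k \<cdot> \<gamma> t\<close> with \<open>k = h z + o(h)\<close>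
(\<open>curve_first_order_exp\<close>). The p-norm is positively homogeneous and continuous in the operator norm
on skew-hermitian elements (\<open>pnorm_scaleR\<close>, \<open>tendsto_pnorm\<close>); hence the cost of the step from
\<open>\<gamma> t\<close> to \<open>\<gamma> (t + h)\<close> is at most \<open>h (\<parallel>z\<parallel>\<^sub>p + o(1))\<close>. In other words, the function
\<open>g s = \<close> cost of reaching \<open>\<gamma> s\<close> from \<open>\<gamma> u\<close> has upper derivate at most the quotient norm of
\<open>\<gamma>' t\<close>.

It remains to integrate this. The quotient norm along \<open>\<gamma>\<close> is not known to be measurable, so its
integral is a lower integral; but the upper derivate of the continuous function \<open>g\<close> is measurable
and lies below the integrand, and a Henstock sum bounds \<open>g v - g u\<close> by its integral
(\<open>increment_le_nn_integral\<close>).\<close>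

section \<open>Inner products and adjoints\<close>

lemma scaleC_zero [simp]: "scaleC 0 x = (0::'h::complex_hilbert)"
  using scaleC_of_real[of 0 x] by simp

lemma cinner_zero_left [simp]: "cinner 0 y = (0 :: complex)" for y :: "'h::complex_hilbert"
  using cinner_add_left[of 0 0 y] by simp

lemma cinner_scaleR_left: "cinner (r *\<^sub>R x) y = of_real r * cinner x y"
  by (metis cinner_scaleC_left scaleC_of_real)

lemma cinner_minus_left: "cinner (- x) y = - cinner x y"
  using cinner_scaleR_left[of "-1" x y] by simp

lemma cinner_diff_left: "cinner (x - z) y = cinner x y - cinner z y"
  using cinner_add_left[of x "- z" y] by (simp add: cinner_minus_left)

lemma cinner_add_right: "cinner x (y + z) = cinner x y + cinner x z"
  by (metis cinner_add_left cinner_commute complex_cnj_add)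

lemma cinner_scaleR_right: "cinner x (r *\<^sub>R y) = of_real r * cinner x y"
  by (metis cinner_scaleR_left cinner_commute complex_cnj_mult complex_cnj_complex_of_real)

lemma cinner_minus_right: "cinner x (- y) = - cinner x y"
  using cinner_scaleR_right[of x "-1" y] by simp

lemma cinner_diff_right: "cinner x (y - z) = cinner x y - cinner x z"
  using cinner_add_right[of x y "- z"] by (simp add: cinner_minus_right)

lemma cinner_zero_right [simp]: "cinner x 0 = (0 :: complex)" for x :: "'h::complex_hilbert"
  using cinner_add_right[of x 0 0] by simp

lemmas cinner_simps = cinner_add_left cinner_add_right cinner_diff_left cinner_diff_right
  cinner_minus_left cinner_minus_right cinner_scaleR_left cinner_scaleR_right

lemma cinner_eq_zero_iff: "cinner x x = 0 \<longleftrightarrow> x = 0" for x :: "'h::complex_hilbert"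
  by (simp add: cinner_self)

lemma cinner_extensionality:
  fixes u v :: "'h::complex_hilbert"
  assumes "\<And>y. cinner u y = cinner v y"
  shows "u = v"
  using cinner_eq_zero_iff[of "u - v"] assms[of "u - v"] by (simp add: cinner_diff_left)

lemma norm_add_squared:
  fixes x y :: "'h::complex_hilbert"
  shows "(norm (x + y))\<^sup>2 = (norm x)\<^sup>2 + (norm y)\<^sup>2 + 2 * Re (cinner x y)"
proof -
  have "complex_of_real ((norm (x + y))\<^sup>2) =
      of_real ((norm x)\<^sup>2) + of_real ((norm y)\<^sup>2) + (cinner x y + cnj (cinner x y))"
    unfolding cinner_self[symmetric] by (simp add: cinner_simps cinner_commute[of y x])
  then have "Re (complex_of_real ((norm (x + y))\<^sup>2)) = Re (of_real ((norm x)\<^sup>2) + of_real ((norm y)\<^sup>2) + (cinner x y + cnj (cinner x y)))"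
    by simp
  then show ?thesis by simp
qed

lemma Re_cinner_le: "Re (cinner x y) \<le> ((norm x)\<^sup>2 + (norm y)\<^sup>2) / 2" for x y :: "'h::complex_hilbert"
  using norm_add_squared[of x "- y"] zero_le_power2[of "norm (x - y)"] by (simp add: cinner_minus_right)

text \<open>Polarization expresses the inner product through norms, which are continuous; for the imaginary part, multiplication by \<open>-\<i>\<close> is an isometry.\<close>

lemma tendsto_cinner:
  fixes f g :: "'a \<Rightarrow> 'h::complex_hilbert"
  assumes f: "(f \<longlongrightarrow> x) F" and g: "(g \<longlongrightarrow> y) F"
  shows "((\<lambda>n. cinner (f n) (g n)) \<longlongrightarrow> cinner x y) F"
proof -
  have Re: "Re (cinner u v) = ((norm (u + v))\<^sup>2 - (norm u)\<^sup>2 - (norm v)\<^sup>2) / 2" for u v :: 'h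
    using norm_add_squared[of u v] by simp
  have Im: "Im (cinner u v) = Re (cinner (scaleC (- \<i>) u) v)" for u v :: 'h
    by (simp add: cinner_scaleC_left)
  have "norm (scaleC (- \<i>) u) = norm u" for u :: 'h
  proof -
    have "complex_of_real ((norm (scaleC (- \<i>) u))\<^sup>2) = of_real ((norm u)\<^sup>2)"
      unfolding cinner_self[symmetric]
      by (subst cinner_scaleC_left, subst cinner_commute, subst cinner_scaleC_left, subst cinner_commute) simp
    then show ?thesis by (metis norm_ge_zero of_real_eq_iff power2_eq_imp_eq)
  qed
  moreover have "scaleC (- \<i>) (u - v) = scaleC (- \<i>) u - scaleC (- \<i>) v" for u v :: 'h
    by (metis scaleC_add_right diff_add_cancel eq_diff_eq)
  ultimately have iso: "norm (scaleC (- \<i>) u - scaleC (- \<i>) v) = norm (u - v)" for u v :: 'h by metis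
  have f': "((\<lambda>n. scaleC (- \<i>) (f n)) \<longlongrightarrow> scaleC (- \<i>) x) F"
    using f unfolding tendsto_dist_iff[of _ "_ :: 'h"] dist_norm iso .
  have "((\<lambda>n. Re (cinner (f n) (g n))) \<longlongrightarrow> Re (cinner x y)) F"
    unfolding Re by (intro tendsto_intros f g) auto
  moreover have "((\<lambda>n. Im (cinner (f n) (g n))) \<longlongrightarrow> Im (cinner x y)) F"
    unfolding Im Re by (intro tendsto_intros f' g) auto
  ultimately show ?thesis using tendsto_Complex by fastforce
qed

lemma is_adjoint_unique:
  assumes "is_adjoint a b" "is_adjoint a c"
  shows "b = c"
proof (rule blinfun_eqI)
  fix x
  show "blinfun_apply b x = blinfun_apply c x"
  proof (rule cinner_extensionality)
    fix y
    have "cinner y (blinfun_apply b x) = cinner y (blinfun_apply c x)"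
      using assms unfolding is_adjoint_def by metis
    then show "cinner (blinfun_apply b x) y = cinner (blinfun_apply c x) y"
      using cinner_commute by metis
  qed
qed

lemma adj_eqI: "is_adjoint a b \<Longrightarrow> adj a = b"
  unfolding adj_def using is_adjoint_unique by blast

lemma is_adjoint_sym: "is_adjoint a b \<Longrightarrow> is_adjoint b a"
  unfolding is_adjoint_def by (metis cinner_commute)

lemma is_adjoint_compose: "is_adjoint a b \<Longrightarrow> is_adjoint c d \<Longrightarrow> is_adjoint (a o\<^sub>L c) (d o\<^sub>L b)"
  unfolding is_adjoint_def by simp

lemma is_adjoint_id: "is_adjoint id_blinfun id_blinfun"
  unfolding is_adjoint_def by simp

lemma is_adjoint_add: "is_adjoint a b \<Longrightarrow> is_adjoint c d \<Longrightarrow> is_adjoint (a + c) (b + d)"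
  unfolding is_adjoint_def by (simp add: blinfun.bilinear_simps cinner_simps)

lemma is_adjoint_diff: "is_adjoint a b \<Longrightarrow> is_adjoint c d \<Longrightarrow> is_adjoint (a - c) (b - d)"
  unfolding is_adjoint_def by (simp add: blinfun.bilinear_simps cinner_simps)

lemma is_adjoint_scaleR: "is_adjoint a b \<Longrightarrow> is_adjoint (r *\<^sub>R a) (r *\<^sub>R b)"
  unfolding is_adjoint_def by (simp add: blinfun.bilinear_simps cinner_simps)

lemma is_adjoint_zero: "is_adjoint 0 0"
  unfolding is_adjoint_def by simp

lemma is_adjoint_sum: "(\<And>i. i \<in> I \<Longrightarrow> is_adjoint (f i) (g i)) \<Longrightarrow> is_adjoint (sum f I) (sum g I)"
  by (induction I rule: infinite_finite_induct) (auto intro: is_adjoint_add is_adjoint_zero)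

lemma is_adjoint_lim:
  assumes "a \<longlonglongrightarrow> a'" "b \<longlonglongrightarrow> b'" "\<And>n. is_adjoint (a n) (b n)"
  shows "is_adjoint a' b'"
  unfolding is_adjoint_def
proof (intro allI)
  fix x y
  have 1: "(\<lambda>n. cinner (a n x) y) \<longlonglongrightarrow> cinner (a' x) y"
    by (intro tendsto_cinner blinfun.tendsto assms tendsto_const)
  have 2: "(\<lambda>n. cinner x (b n y)) \<longlonglongrightarrow> cinner x (b' y)"
    by (intro tendsto_cinner blinfun.tendsto assms tendsto_const)
  have "(\<lambda>n. cinner (a n x) y) = (\<lambda>n. cinner x (b n y))"
    using assms(3) unfolding is_adjoint_def by auto
  then show "cinner (a' x) y = cinner x (b' y)" using 1 2 LIMSEQ_unique by metis
qed

lemma blinfun_compose_assoc: "(a o\<^sub>L b) o\<^sub>L c = a o\<^sub>L (b o\<^sub>L c)"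
  by (rule blinfun_eqI) simp

lemmas blinfun_compose_simps =
  bounded_bilinear.add_left[OF bounded_bilinear_blinfun_compose]
  bounded_bilinear.add_right[OF bounded_bilinear_blinfun_compose]
  bounded_bilinear.diff_left[OF bounded_bilinear_blinfun_compose]
  bounded_bilinear.diff_right[OF bounded_bilinear_blinfun_compose]
  bounded_bilinear.minus_left[OF bounded_bilinear_blinfun_compose]
  bounded_bilinear.minus_right[OF bounded_bilinear_blinfun_compose]
  bounded_bilinear.scaleR_left[OF bounded_bilinear_blinfun_compose]
  bounded_bilinear.scaleR_right[OF bounded_bilinear_blinfun_compose]

lemmas tendsto_blinfun_compose = bounded_bilinear.tendsto[OF bounded_bilinear_blinfun_compose]

lemma blinfun_compose_id [simp]: "a o\<^sub>L id_blinfun = a" "id_blinfun o\<^sub>L a = a"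
  by (auto intro: blinfun_eqI)

section \<open>Von Neumann algebras as norm closed algebras\<close>

lemma commutant_subspace: "subspace (commutant S)"
proof (rule subspaceI)
  show "0 \<in> commutant S" unfolding commutant_def bounded_ops_def by (simp add: blinfun_compose_zero) (metis scaleC_zero add_cancel_right_left scaleC_add_right)
next
  fix x y assume "x \<in> commutant S" "y \<in> commutant S"
  then show "x + y \<in> commutant S" unfolding commutant_def bounded_ops_def
    by (auto simp: blinfun.bilinear_simps scaleC_add_right blinfun_compose_simps)
next
  fix r :: real and x assume "x \<in> commutant S"
  then show "r *\<^sub>R x \<in> commutant S" unfolding commutant_def bounded_ops_def
    by (auto simp: blinfun.bilinear_simps blinfun_compose_simps
      scaleC_of_real[symmetric] scaleC_scaleC mult.commute)
qed

lemma commutant_compose: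
  assumes "a \<in> commutant S" "b \<in> commutant S"
  shows "a o\<^sub>L b \<in> commutant S"
proof -
  have "(a o\<^sub>L b) o\<^sub>L s = s o\<^sub>L (a o\<^sub>L b)" if "s \<in> S" for s
  proof -
    have "a o\<^sub>L s = s o\<^sub>L a" "b o\<^sub>L s = s o\<^sub>L b" using assms that by (auto simp: commutant_def)
    then show ?thesis by (metis blinfun_compose_assoc)
  qed
  then show ?thesis using assms by (simp add: commutant_def bounded_ops_def)
qed

lemma id_in_commutant: "id_blinfun \<in> commutant S"
  unfolding commutant_def bounded_ops_def by (auto intro!: blinfun_eqI)

lemma commutant_closed: "closed (commutant S)"
  unfolding closed_sequential_limits
proof (intro allI impI, elim conjE)
  fix a l assume a: "\<forall>n. a n \<in> commutant S" and lim: "a \<longlonglongrightarrow> l"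
  have "l (scaleC c x) = scaleC c (l x)" for c x
  proof -
    have 1: "(\<lambda>n. cinner (a n (scaleC c x)) y) \<longlonglongrightarrow> cinner (l (scaleC c x)) y" for y
      by (intro tendsto_cinner blinfun.tendsto lim tendsto_const)
    have 2: "(\<lambda>n. c * cinner (a n x) y) \<longlonglongrightarrow> c * cinner (l x) y" for y
      by (intro tendsto_intros tendsto_cinner blinfun.tendsto lim)
    have "cinner (l (scaleC c x)) y = cinner (scaleC c (l x)) y" for y
      using LIMSEQ_unique[OF 1[of y]] 2[of y] a
      by (simp add: commutant_def bounded_ops_def cinner_scaleC_left)
    then show ?thesis by (rule cinner_extensionality)
  qed
  moreover have "l o\<^sub>L s = s o\<^sub>L l" if "s \<in> S" for s
  proof -
    have "(\<lambda>n. a n o\<^sub>L s) \<longlonglongrightarrow> (l o\<^sub>L s)" "(\<lambda>n. s o\<^sub>L a n) \<longlonglongrightarrow> (s o\<^sub>L l)"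
      by (intro tendsto_blinfun_compose lim tendsto_const)+
    moreover have "(\<lambda>n. a n o\<^sub>L s) = (\<lambda>n. s o\<^sub>L a n)" using a that by (auto simp: commutant_def)
    ultimately show ?thesis using LIMSEQ_unique by metis
  qed
  ultimately show "l \<in> commutant S" unfolding commutant_def bounded_ops_def by blast
qed

context
  fixes M :: "('h::complex_hilbert \<Rightarrow>\<^sub>L 'h) set"
  assumes M: "von_neumann_algebra M"
begin

lemma vna_eq: "M = commutant (commutant M)"
  using M unfolding von_neumann_algebra_def by simp

lemma vna_subspace: "subspace M" using commutant_subspace vna_eq by metis
lemma vna_closed: "closed M" using commutant_closed vna_eq by metis
lemma vna_id: "id_blinfun \<in> M" using id_in_commutant vna_eq by metis
lemma vna_compose: "a \<in> M \<Longrightarrow> b \<in> M \<Longrightarrow> a o\<^sub>L b \<in> M" using commutant_compose vna_eq by metis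

lemma vna_is_adjoint: "a \<in> M \<Longrightarrow> is_adjoint a (adj a) \<and> adj a \<in> M"
  using M adj_eqI unfolding von_neumann_algebra_def by metis

lemma skew_hermitian_iff: "z \<in> skew_hermitian M \<longleftrightarrow> z \<in> M \<and> is_adjoint z (- z)"
  unfolding skew_hermitian_def using vna_is_adjoint[of z] adj_eqI[of z] by auto

lemma skew_hermitian_subspace: "subspace (skew_hermitian M)"
proof (rule subspaceI)
  show "0 \<in> skew_hermitian M"
    using subspace_0[OF vna_subspace] is_adjoint_zero by (simp add: skew_hermitian_iff)
  show "x + y \<in> skew_hermitian M" if "x \<in> skew_hermitian M" "y \<in> skew_hermitian M" for x y
    using that subspace_add[OF vna_subspace, of x y] is_adjoint_add[of x "- x" y "- y"]
    by (simp add: skew_hermitian_iff)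
  show "r *\<^sub>R x \<in> skew_hermitian M" if "x \<in> skew_hermitian M" for r x
    using that subspace_scale[OF vna_subspace, of x r] is_adjoint_scaleR[of x "- x" r]
    by (simp add: skew_hermitian_iff)
qed

lemma skew_hermitian_closed: "closed (skew_hermitian M)"
  unfolding closed_sequential_limits skew_hermitian_iff
  using vna_closed is_adjoint_lim[OF _ tendsto_minus] closed_sequentially by blast

lemma unitary_group_iff: "u \<in> unitary_group M \<longleftrightarrow>
   u \<in> M \<and> (\<exists>v\<in>M. is_adjoint u v \<and> v o\<^sub>L u = id_blinfun \<and> u o\<^sub>L v = id_blinfun)"
  unfolding unitary_group_def using vna_is_adjoint adj_eqI by fastforce

lemma id_unitary: "id_blinfun \<in> unitary_group M"
  unfolding unitary_group_iff using vna_id is_adjoint_id by auto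

end

section \<open>The exponential of an operator\<close>

abbreviation op_pow :: "('h::complex_hilbert \<Rightarrow>\<^sub>L 'h) \<Rightarrow> nat \<Rightarrow> ('h \<Rightarrow>\<^sub>L 'h)" where
  "op_pow a n \<equiv> ((o\<^sub>L) a ^^ n) id_blinfun"

lemma op_pow_commute: "op_pow a n o\<^sub>L a = a o\<^sub>L op_pow a n"
  by (induction n) (simp_all add: blinfun_compose_assoc)

lemma op_pow_add: "op_pow a (m + n) = op_pow a m o\<^sub>L op_pow a n"
  by (induction m) (simp_all add: blinfun_compose_assoc)

lemma op_pow_scaleR: "op_pow (s *\<^sub>R a) n = s ^ n *\<^sub>R op_pow a n"
  by (induction n) (simp_all add: blinfun_compose_simps mult.commute)

lemma norm_op_pow_le: "norm (op_pow a n) \<le> norm a ^ n"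
proof (induction n)
  case (Suc n)
  have "norm (op_pow a (Suc n)) \<le> norm a * norm (op_pow a n)" by (simp add: norm_blinfun_compose)
  also have "\<dots> \<le> norm a * norm a ^ n" by (intro mult_left_mono Suc) simp
  finally show ?case by simp
qed (simp add: norm_blinfun_id_le)

text \<open>Telescoping: \<open>a\<^sup>n - b\<^sup>n\<close> is a sum of \<open>n\<close> products of powers of \<open>a\<close> and \<open>b\<close> with one factor
\<open>a - b\<close> between them.\<close>

lemma norm_op_pow_diff_le:
  assumes "norm a \<le> r" "norm b \<le> r"
  shows "norm (op_pow a (Suc n) - op_pow b (Suc n)) \<le> real (Suc n) * r ^ n * norm (a - b)"
proof (induction n)
  case (Suc n)
  have r: "0 \<le> r" using assms(1) norm_ge_zero order_trans by blast
  have "op_pow a (Suc (Suc n)) - op_pow b (Suc (Suc n)) =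
      (a o\<^sub>L (op_pow a (Suc n) - op_pow b (Suc n))) + ((a - b) o\<^sub>L op_pow b (Suc n))"
    by (simp add: blinfun_compose_simps)
  also have "norm \<dots> \<le> norm (a o\<^sub>L (op_pow a (Suc n) - op_pow b (Suc n))) + norm ((a - b) o\<^sub>L op_pow b (Suc n))"
    by (rule norm_triangle_ineq)
  also have "\<dots> \<le> norm a * norm (op_pow a (Suc n) - op_pow b (Suc n)) + norm (a - b) * norm (op_pow b (Suc n))"
    by (intro add_mono norm_blinfun_compose)
  also have "\<dots> \<le> r * (real (Suc n) * r ^ n * norm (a - b)) + norm (a - b) * r ^ Suc n"
  proof (intro add_mono mult_mono)
    show "norm (op_pow b (Suc n)) \<le> r ^ Suc n"
      using norm_op_pow_le power_mono[OF assms(2) norm_ge_zero] by (meson order_trans)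
  qed (use Suc assms r in auto)
  finally show ?case by (simp add: algebra_simps)
qed simp

lemma op_exp_sums: "(\<lambda>n. (1 / fact n) *\<^sub>R op_pow a n) sums op_exp a"
proof -
  have "summable (\<lambda>n. (1 / fact n) *\<^sub>R op_pow a n)"
  proof (rule summable_comparison_test')
    show "summable (\<lambda>n. inverse (fact n) * norm a ^ n)" by (rule summable_exp)
    show "norm ((1 / fact n) *\<^sub>R op_pow a n) \<le> inverse (fact n) * norm a ^ n" if "n \<ge> 0" for n
      using norm_op_pow_le[where a = a and n = n] by (simp add: divide_simps)
  qed
  then show ?thesis unfolding op_exp_def by (rule summable_sums)
qed

lemma op_exp_partial_sums: "(\<lambda>n. \<Sum>i\<le>n. (1 / fact i) *\<^sub>R op_pow a i) \<longlonglongrightarrow> op_exp a"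
  using op_exp_sums unfolding sums_def_le .

lemma op_exp_zero [simp]: "op_exp 0 = id_blinfun"
proof -
  have "(\<lambda>n. (1 / fact n) *\<^sub>R op_pow (0 :: 'a \<Rightarrow>\<^sub>L 'a) n) = (\<lambda>n. if n = 0 then id_blinfun else 0)"
    by (rule ext) (auto simp: gr0_conv_Suc)
  then show ?thesis using op_exp_sums[of "0 :: 'a \<Rightarrow>\<^sub>L 'a"] sums_single[of 0 "\<lambda>_. id_blinfun"] sums_unique2
    by (metis (mono_tags, lifting) sums_cong)
qed

text \<open>The terms of order at least two in the exponential series have a small Lipschitz constant. On balls
of radius below \<open>1 / 2\<close> the constant \<open>r / (1 - r)\<close> is less than one, and this makes the exponential
injective there.\<close>

lemma op_exp_strict_estimate:
  assumes r: "norm a \<le> r" "norm b \<le> r" "r < 1"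
  shows "norm (op_exp a - op_exp b - (a - b)) \<le> r / (1 - r) * norm (a - b)"
proof -
  have r0: "0 \<le> r" using assms(1) norm_ge_zero order_trans by blast
  let ?t = "\<lambda>n. (1 / fact n) *\<^sub>R (op_pow a n - op_pow b n)"
  have "?t sums (op_exp a - op_exp b)"
    using sums_diff[OF op_exp_sums op_exp_sums, of a b] by (simp add: scaleR_diff_right)
  then have "(\<lambda>n. ?t (n + 2)) sums (op_exp a - op_exp b - (\<Sum>n<2. ?t n))"
    by (subst sums_iff_shift) simp
  also have "(\<Sum>n<2. ?t n) = a - b" by (simp add: numeral_2_eq_2)
  finally have s: "(\<lambda>n. ?t (n + 2)) sums (op_exp a - op_exp b - (a - b))" .
  have g: "(\<lambda>n. norm (a - b) * r * r ^ n) sums (norm (a - b) * r * (1 / (1 - r)))"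
    by (intro sums_mult geometric_sums) (use r0 r in auto)
  have "norm (?t (n + 2)) \<le> norm (a - b) * r * r ^ n" for n
  proof -
    have "norm (?t (n + 2)) \<le> 1 / fact (n + 2) * (real (n + 2) * r ^ Suc n * norm (a - b))"
      using mult_left_mono[OF norm_op_pow_diff_le[OF r(1,2), of "Suc n"], of "1 / fact (n + 2)"]
      by (simp del: funpow.simps fact_Suc add: numeral_2_eq_2)
    also have "\<dots> = 1 / fact (Suc n) * (r ^ Suc n * norm (a - b))"
      by (simp add: divide_simps del: of_nat_Suc) (simp add: algebra_simps)?
    also have "\<dots> \<le> 1 * (r ^ Suc n * norm (a - b))"
      using r0 by (intro mult_right_mono) (auto simp: divide_simps fact_ge_1 simp del: fact_Suc)
    finally show ?thesis by (simp add: mult_ac)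
  qed
  then have "norm (suminf (\<lambda>n. ?t (n + 2))) \<le> suminf (\<lambda>n. norm (a - b) * r * r ^ n)"
    by (intro norm_suminf_le) (use g in \<open>auto simp: sums_iff\<close>)
  then show ?thesis
    unfolding sums_unique[OF s, symmetric] sums_unique[OF g, symmetric] by (simp add: mult_ac)
qed

lemma inj_on_op_exp: "inj_on op_exp {a. norm a < 1 / 2}"
proof (rule inj_onI)
  fix a b :: "'a \<Rightarrow>\<^sub>L 'a" assume ab: "a \<in> {a. norm a < 1 / 2}" "b \<in> {a. norm a < 1 / 2}" "op_exp a = op_exp b"
  define r where "r = max (norm a) (norm b)"
  have r: "norm a \<le> r" "norm b \<le> r" "r < 1 / 2" using ab by (auto simp: r_def)
  then have "r / (1 - r) < 1" by simp
  moreover have "norm (a - b) \<le> r / (1 - r) * norm (a - b)"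
    using op_exp_strict_estimate[OF r(1,2)] r(3) ab(3) norm_minus_commute[of a b] by simp
  ultimately show "a = b" by (smt (verit) mult_le_cancel_right1 norm_eq_zero norm_ge_zero right_minus_eq)
qed

lemma norm_op_exp_minus_id_le:
  assumes "norm a \<le> 1 / 2"
  shows "norm (op_exp a - id_blinfun) \<le> 2 * norm a"
proof -
  have "norm (op_exp a - id_blinfun - a) \<le> norm a"
    using op_exp_strict_estimate[of a "1 / 2" 0] assms by simp
  then show ?thesis using norm_triangle_sub[of "op_exp a - id_blinfun" a] by simp
qed

text \<open>The difference between the product of the partial sums for \<open>s\<close> and \<open>t\<close> and the partial sum for
\<open>s + t\<close> consists of the terms in a square that lie outside a triangle. Its norm is bounded by the
corresponding difference for the real exponential series at \<open>\<bar>s\<bar> \<parallel>z\<parallel>\<close> and \<open>\<bar>t\<bar> \<parallel>z\<parallel>\<close>, which tends to \<open>0\<close>.\<close>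

lemma op_exp_add_scaleR: "op_exp ((s + t) *\<^sub>R z) = op_exp (s *\<^sub>R z) o\<^sub>L op_exp (t *\<^sub>R z)"
proof -
  define c :: "real \<Rightarrow> nat \<Rightarrow> real" where "c x i = x ^ i / fact i" for x i
  define A where "A N = {..N} \<times> {..N}" for N :: nat
  define T where "T N = {(i, j). i + j \<le> N}" for N :: nat
  have TA: "T N \<subseteq> A N" "finite (A N)" for N by (auto simp: T_def A_def)
  have c_add: "c (x + y) n = (\<Sum>i\<le>n. c x i * c y (n - i))" for x y n
    using exp_series_add_commuting[of x y n] by (simp add: c_def divide_inverse mult_ac)
  have S: "(\<lambda>N. \<Sum>i\<le>N. c x i *\<^sub>R op_pow z i) \<longlonglongrightarrow> op_exp (x *\<^sub>R z)" for x
    using op_exp_partial_sums[of "x *\<^sub>R z"] by (simp add: op_pow_scaleR c_def)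
  have prod: "(\<Sum>i\<le>N. c s i *\<^sub>R op_pow z i) o\<^sub>L (\<Sum>i\<le>N. c t i *\<^sub>R op_pow z i) =
      (\<Sum>(i, j)\<in>A N. (c s i * c t j) *\<^sub>R op_pow z (i + j))" for N
    unfolding A_def sum.cartesian_product[symmetric]
    by (simp add: bounded_bilinear.sum_left[OF bounded_bilinear_blinfun_compose]
        bounded_bilinear.sum_right[OF bounded_bilinear_blinfun_compose] blinfun_compose_simps op_pow_add mult.commute scaleR_sum_right)
      (rule sum.swap)
  have tri: "(\<Sum>i\<le>N. c (s + t) i *\<^sub>R op_pow z i) =
      (\<Sum>(i, j)\<in>T N. (c s i * c t j) *\<^sub>R op_pow z (i + j))" for N
    unfolding T_def sum.triangle_reindex_eq by (simp add: c_add scaleR_sum_left)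
  define r where "r = norm z"
  let ?R = "\<lambda>N. (\<Sum>(i, j)\<in>A N. c (\<bar>s\<bar> * r) i * c (\<bar>t\<bar> * r) j) - (\<Sum>(i, j)\<in>T N. c (\<bar>s\<bar> * r) i * c (\<bar>t\<bar> * r) j)"
  have R: "?R N = (\<Sum>i\<le>N. c (\<bar>s\<bar> * r) i) * (\<Sum>i\<le>N. c (\<bar>t\<bar> * r) i) - (\<Sum>i\<le>N. c (\<bar>s\<bar> * r + \<bar>t\<bar> * r) i)" for N
    unfolding T_def sum.triangle_reindex_eq by (simp add: A_def sum.cartesian_product[symmetric] sum_product c_add)
  have E: "(\<lambda>N. \<Sum>i\<le>N. c x i) \<longlonglongrightarrow> exp x" for x
    using exp_converges[of x] unfolding sums_def_le by (simp add: c_def divide_inverse mult_ac)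
  have "?R \<longlonglongrightarrow> exp (\<bar>s\<bar> * r) * exp (\<bar>t\<bar> * r) - exp (\<bar>s\<bar> * r + \<bar>t\<bar> * r)"
    unfolding R by (intro tendsto_intros E)
  then have R0: "?R \<longlonglongrightarrow> 0" by (simp add: exp_add)
  have "norm ((\<Sum>(i, j)\<in>A N. (c s i * c t j) *\<^sub>R op_pow z (i + j)) -
      (\<Sum>(i, j)\<in>T N. (c s i * c t j) *\<^sub>R op_pow z (i + j))) \<le> ?R N" for N
    unfolding sum_diff[OF TA(2,1), symmetric]
  proof (rule sum_norm_le)
    fix ij assume "ij \<in> A N - T N"
    obtain i j where ij: "ij = (i, j)" by fastforce
    have "norm ((c s i * c t j) *\<^sub>R op_pow z (i + j)) \<le> \<bar>c s i * c t j\<bar> * r ^ (i + j)"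
      using norm_op_pow_le[where a = z and n = "i + j"] by (simp add: r_def mult_left_mono)
    also have "\<dots> = c (\<bar>s\<bar> * r) i * c (\<bar>t\<bar> * r) j"
      by (simp add: c_def abs_mult power_abs power_mult_distrib power_add)
    finally show "norm (case ij of (i, j) \<Rightarrow> (c s i * c t j) *\<^sub>R op_pow z (i + j))
        \<le> (case ij of (i, j) \<Rightarrow> c (\<bar>s\<bar> * r) i * c (\<bar>t\<bar> * r) j)" by (simp add: ij)
  qed
  then have "(\<lambda>N. (\<Sum>(i, j)\<in>A N. (c s i * c t j) *\<^sub>R op_pow z (i + j)) -
      (\<Sum>(i, j)\<in>T N. (c s i * c t j) *\<^sub>R op_pow z (i + j))) \<longlonglongrightarrow> 0"
    by (intro Lim_null_comparison[OF _ R0] always_eventually allI)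
  moreover have "(\<lambda>N. (\<Sum>(i, j)\<in>A N. (c s i * c t j) *\<^sub>R op_pow z (i + j)) -
      (\<Sum>(i, j)\<in>T N. (c s i * c t j) *\<^sub>R op_pow z (i + j))) \<longlonglongrightarrow> (op_exp (s *\<^sub>R z) o\<^sub>L op_exp (t *\<^sub>R z)) - op_exp ((s + t) *\<^sub>R z)"
    unfolding prod[symmetric] tri[symmetric] by (intro tendsto_diff tendsto_blinfun_compose S)
  ultimately show ?thesis using LIMSEQ_unique by fastforce
qed

lemma op_exp_minus: "op_exp (- z) o\<^sub>L op_exp z = id_blinfun" "op_exp z o\<^sub>L op_exp (- z) = id_blinfun"
  using op_exp_add_scaleR[of "-1" 1 z] op_exp_add_scaleR[of 1 "-1" z] by simp_all

lemma continuous_op_exp_scaleR: "continuous_on UNIV (\<lambda>s. op_exp (s *\<^sub>R z))"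
  unfolding continuous_on_def
proof
  fix s :: real
  have "((\<lambda>h. op_exp ((h - s) *\<^sub>R z) - id_blinfun) \<longlongrightarrow> 0) (at s)"
  proof (rule Lim_null_comparison)
    have lim: "((\<lambda>h. norm ((h - s) *\<^sub>R z)) \<longlongrightarrow> 0) (at s)" by (auto intro!: tendsto_eq_intros)
    then have "\<forall>\<^sub>F h in at s. norm ((h - s) *\<^sub>R z) < 1 / 2" by (rule order_tendstoD) simp
    then show "\<forall>\<^sub>F h in at s. norm (op_exp ((h - s) *\<^sub>R z) - id_blinfun) \<le> 2 * norm ((h - s) *\<^sub>R z)"
      by (rule eventually_mono) (intro norm_op_exp_minus_id_le, simp)
    show "((\<lambda>h. 2 * norm ((h - s) *\<^sub>R z)) \<longlongrightarrow> 0) (at s)" using tendsto_mult_right_zero[OF lim] .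
  qed
  then have "((\<lambda>h. (op_exp ((h - s) *\<^sub>R z) - id_blinfun) o\<^sub>L op_exp (s *\<^sub>R z)) \<longlongrightarrow> (0 o\<^sub>L op_exp (s *\<^sub>R z))) (at s)"
    by (intro tendsto_blinfun_compose tendsto_const)
  moreover have "(op_exp ((h - s) *\<^sub>R z) - id_blinfun) o\<^sub>L op_exp (s *\<^sub>R z) = op_exp (h *\<^sub>R z) - op_exp (s *\<^sub>R z)" for h
    using op_exp_add_scaleR[of "h - s" s z] by (simp add: blinfun_compose_simps)
  ultimately have "((\<lambda>h. op_exp (h *\<^sub>R z) - op_exp (s *\<^sub>R z)) \<longlongrightarrow> 0) (at s)" by simp
  then show "((\<lambda>s. op_exp (s *\<^sub>R z)) \<longlongrightarrow> op_exp (s *\<^sub>R z)) (at s within UNIV)" by (rule LIM_zero_cancel)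
qed

lemma op_exp_conjugate:
  assumes "v o\<^sub>L u = id_blinfun" "u o\<^sub>L v = id_blinfun"
  shows "op_exp (u o\<^sub>L z o\<^sub>L v) = u o\<^sub>L op_exp z o\<^sub>L v"
proof -
  have pow: "op_pow (u o\<^sub>L z o\<^sub>L v) n = u o\<^sub>L op_pow z n o\<^sub>L v" for n
  proof (induction n)
    case (Suc n)
    have "op_pow (u o\<^sub>L z o\<^sub>L v) (Suc n) = u o\<^sub>L (z o\<^sub>L ((v o\<^sub>L u) o\<^sub>L (op_pow z n o\<^sub>L v)))"
      unfolding funpow.simps o_apply Suc by (simp only: blinfun_compose_assoc)
    also have "\<dots> = u o\<^sub>L op_pow z (Suc n) o\<^sub>L v" by (simp add: assms blinfun_compose_assoc)
    finally show ?case .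
  qed (simp add: assms)
  have "(\<lambda>n. u o\<^sub>L (\<Sum>i\<le>n. (1 / fact i) *\<^sub>R op_pow z i) o\<^sub>L v) \<longlonglongrightarrow> (u o\<^sub>L op_exp z o\<^sub>L v)"
    by (intro tendsto_blinfun_compose tendsto_const op_exp_partial_sums)
  moreover have "u o\<^sub>L (\<Sum>i\<le>n. (1 / fact i) *\<^sub>R op_pow z i) o\<^sub>L v = (\<Sum>i\<le>n. (1 / fact i) *\<^sub>R op_pow (u o\<^sub>L z o\<^sub>L v) i)" for n
    by (simp add: pow bounded_bilinear.sum_left[OF bounded_bilinear_blinfun_compose]
        bounded_bilinear.sum_right[OF bounded_bilinear_blinfun_compose] blinfun_compose_simps)
  ultimately have "(\<lambda>n. \<Sum>i\<le>n. (1 / fact i) *\<^sub>R op_pow (u o\<^sub>L z o\<^sub>L v) i) \<longlonglongrightarrow> (u o\<^sub>L op_exp z o\<^sub>L v)"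
    by (simp only:)
  then show ?thesis by (rule LIMSEQ_unique[OF op_exp_partial_sums])
qed

lemma is_adjoint_op_pow: "is_adjoint a b \<Longrightarrow> is_adjoint (op_pow a n) (op_pow b n)"
proof (induction n)
  case (Suc n)
  then show ?case
    using is_adjoint_compose[OF Suc.prems Suc.IH[OF Suc.prems]] by (simp add: op_pow_commute)
qed (simp add: is_adjoint_id)

lemma op_pow_in_vna: "von_neumann_algebra M \<Longrightarrow> a \<in> M \<Longrightarrow> op_pow a n \<in> M"
  by (induction n) (auto simp: vna_id vna_compose)

lemma op_exp_unitary:
  assumes M: "von_neumann_algebra M" and z: "z \<in> skew_hermitian M"
  shows "op_exp z \<in> unitary_group M"
proof -
  have zM: "z \<in> M" "- z \<in> M" and adj: "is_adjoint z (- z)"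
    using z subspace_neg[OF vna_subspace[OF M]] unfolding skew_hermitian_iff[OF M] by auto
  have exp: "op_exp a \<in> M" if "a \<in> M" for a
    using that op_pow_in_vna[OF M that] vna_subspace[OF M]
    by (intro closed_sequentially[OF vna_closed[OF M] _ op_exp_partial_sums])
      (auto intro!: subspace_sum subspace_scale)
  have "is_adjoint (op_exp z) (op_exp (- z))"
    by (rule is_adjoint_lim[OF op_exp_partial_sums op_exp_partial_sums])
      (intro is_adjoint_sum is_adjoint_scaleR is_adjoint_op_pow adj)
  then show ?thesis unfolding unitary_group_iff[OF M] using exp zM op_exp_minus by blast
qed

lemma skew_hermitian_conjugate:
  assumes M: "von_neumann_algebra M" and z: "z \<in> skew_hermitian M"
    and u: "u \<in> M" "v \<in> M" "is_adjoint u v"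
  shows "u o\<^sub>L z o\<^sub>L v \<in> skew_hermitian M"
proof -
  have "is_adjoint (u o\<^sub>L z o\<^sub>L v) (u o\<^sub>L (- z o\<^sub>L v))"
    using z unfolding skew_hermitian_iff[OF M]
    by (intro is_adjoint_compose[OF is_adjoint_compose[OF u(3)] is_adjoint_sym[OF u(3)]]) simp
  then show ?thesis
    using z u vna_compose[OF M] unfolding skew_hermitian_iff[OF M] by (simp add: blinfun_compose_simps blinfun_compose_assoc)
qed

section \<open>Functional calculus of positive operators\<close>

lemma op_poly_eq_sum:
  assumes "degree q \<le> n"
  shows "op_poly q a = (\<Sum>i\<le>n. coeff q i *\<^sub>R op_pow a i)"
  unfolding op_poly_def
  by (rule sum.mono_neutral_left) (use assms in \<open>auto simp: coeff_eq_0\<close>)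

lemma op_poly_pCons: "op_poly (pCons c q) a = c *\<^sub>R id_blinfun + (a o\<^sub>L op_poly q a)"
proof -
  have "op_poly (pCons c q) a = (\<Sum>i\<le>Suc (degree q). coeff (pCons c q) i *\<^sub>R op_pow a i)"
    by (rule op_poly_eq_sum) (rule degree_pCons_le)
  also have "\<dots> = c *\<^sub>R id_blinfun + (\<Sum>i\<le>degree q. coeff q i *\<^sub>R (a o\<^sub>L op_pow a i))"
    by (subst sum.atMost_Suc_shift) simp
  finally show ?thesis
    by (simp add: op_poly_def bounded_bilinear.sum_right[OF bounded_bilinear_blinfun_compose] blinfun_compose_simps)
qed

lemma op_poly_0 [simp]: "op_poly 0 a = 0"
  by (simp add: op_poly_def)

lemma op_poly_add: "op_poly (p + q) a = op_poly p a + op_poly q a"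
  using op_poly_eq_sum[of "p + q" "max (degree p) (degree q)" a] op_poly_eq_sum[of p "max (degree p) (degree q)" a]
    op_poly_eq_sum[of q "max (degree p) (degree q)" a]
  by (simp add: degree_add_le scaleR_add_left sum.distrib)

lemma op_poly_smult: "op_poly (smult c q) a = c *\<^sub>R op_poly q a"
  using op_poly_eq_sum[OF degree_smult_le, of c q a] by (simp add: op_poly_def scaleR_sum_right)

lemma op_poly_diff: "op_poly (p - q) a = op_poly p a - op_poly q a"
  using op_poly_add[of "p - q" q a] by simp

lemma op_poly_mult: "op_poly (p * q) a = op_poly p a o\<^sub>L op_poly q a"
  by (induction p)
    (simp_all add: op_poly_pCons op_poly_add op_poly_smult blinfun_compose_simps blinfun_compose_assoc)

lemma op_poly_const [simp]: "op_poly [:c:] a = c *\<^sub>R id_blinfun"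
  by (simp add: op_poly_pCons)

lemma op_poly_scaleR: "op_poly q (c *\<^sub>R a) = op_poly (pcompose q [:0, c:]) a"
  by (induction q) (simp_all add: op_poly_pCons pcompose_pCons op_poly_add op_poly_mult op_poly_smult blinfun_compose_simps)

lemma tendsto_op_poly: "(f \<longlongrightarrow> a) F \<Longrightarrow> ((\<lambda>n. op_poly q (f n)) \<longlongrightarrow> op_poly q a) F"
  by (induction q) (auto simp: op_poly_pCons intro!: tendsto_intros tendsto_blinfun_compose)

lemma is_adjoint_op_poly: "is_adjoint a a \<Longrightarrow> is_adjoint (op_poly q a) (op_poly q a)"
  unfolding op_poly_def by (intro is_adjoint_sum is_adjoint_scaleR is_adjoint_op_pow)

lemma op_poly_in_vna: "von_neumann_algebra M \<Longrightarrow> a \<in> M \<Longrightarrow> op_poly q a \<in> M"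
  unfolding op_poly_def by (intro subspace_sum vna_subspace subspace_scale op_pow_in_vna)

definition op_nonneg :: "('h::complex_hilbert \<Rightarrow>\<^sub>L 'h) \<Rightarrow> bool" where
  "op_nonneg a \<longleftrightarrow> is_adjoint a a \<and> (\<forall>x. 0 \<le> Re (cinner (a x) x))"

lemma op_nonneg_imp_positive_op:
  assumes "op_nonneg a" shows "positive_op a"
  unfolding positive_op_def
proof
  fix x
  have "cinner (a x) x = cnj (cinner (a x) x)"
    using assms unfolding op_nonneg_def is_adjoint_def by (metis cinner_commute)
  then have "Im (cinner (a x) x) = 0" by (metis Reals_cnj_iff complex_is_Real_iff)
  then show "cinner (a x) x \<in> \<real>\<^sub>\<ge>\<^sub>0" using assms by (simp add: complex_nonneg_Reals_iff op_nonneg_def)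
qed

lemma op_nonneg_add: "op_nonneg a \<Longrightarrow> op_nonneg b \<Longrightarrow> op_nonneg (a + b)"
  unfolding op_nonneg_def by (auto intro: is_adjoint_add simp: blinfun.add_left cinner_simps)

lemma op_nonneg_scaleR: "op_nonneg a \<Longrightarrow> 0 \<le> c \<Longrightarrow> op_nonneg (c *\<^sub>R a)"
  unfolding op_nonneg_def by (auto intro: is_adjoint_scaleR simp: blinfun.scaleR_left cinner_simps)

lemma op_nonneg_id: "op_nonneg id_blinfun"
  unfolding op_nonneg_def by (simp add: is_adjoint_id cinner_self)

lemma op_nonneg_sandwich:
  assumes "op_nonneg a" "is_adjoint b b" shows "op_nonneg (b o\<^sub>L a o\<^sub>L b)"
proof -
  have "cinner ((b o\<^sub>L a o\<^sub>L b) x) x = cinner (a (b x)) (b x)" for x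
    using assms(2) unfolding is_adjoint_def by simp
  moreover have "is_adjoint (b o\<^sub>L a o\<^sub>L b) (b o\<^sub>L (a o\<^sub>L b))"
    using assms unfolding op_nonneg_def by (intro is_adjoint_compose) auto
  ultimately show ?thesis using assms unfolding op_nonneg_def by (simp add: blinfun_compose_assoc)
qed

lemma op_nonneg_lim:
  assumes "a \<longlonglongrightarrow> l" "\<And>n. op_nonneg (a n)" shows "op_nonneg l"
proof -
  have "0 \<le> Re (cinner (l x) x)" for x
  proof (rule LIMSEQ_le_const)
    show "(\<lambda>n. Re (cinner (a n x) x)) \<longlonglongrightarrow> Re (cinner (l x) x)"
      by (intro tendsto_intros tendsto_cinner blinfun.tendsto assms)
  qed (use assms(2) in \<open>auto simp: op_nonneg_def\<close>)
  then show ?thesis using is_adjoint_lim[OF assms(1,1)] assms(2) unfolding op_nonneg_def by blast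
qed

text \<open>The arithmetic-geometric form of the Cauchy-Schwarz inequality suffices after rescaling by \<open>m\<close>.\<close>

lemma Re_cinner_apply_le:
  assumes "norm a \<le> m" "0 < m"
  shows "\<bar>Re (cinner (blinfun_apply a x) x)\<bar> \<le> m * (norm x)\<^sup>2"
proof -
  have le: "Re (cinner (b x) x) \<le> m * (norm x)\<^sup>2" if b: "norm b \<le> m" for b :: "'a \<Rightarrow>\<^sub>L 'a"
  proof -
    have "norm (b x) \<le> m * norm x"
      using norm_blinfun[of b x] mult_right_mono[OF b norm_ge_zero] by (rule order_trans)
    define y where "y = (1 / m) *\<^sub>R b x"
    have "norm y \<le> norm x"
      using \<open>norm (b x) \<le> m * norm x\<close> assms(2) by (simp add: y_def field_simps)
    then have "(norm y)\<^sup>2 \<le> (norm x)\<^sup>2" by (rule power_mono) simp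
    then have "((norm y)\<^sup>2 + (norm x)\<^sup>2) / 2 \<le> (norm x)\<^sup>2" by simp
    then have "Re (cinner y x) \<le> (norm x)\<^sup>2" by (rule order_trans[OF Re_cinner_le])
    then show ?thesis using assms(2) by (simp add: y_def cinner_simps field_simps)
  qed
  show ?thesis using le[of a] le[of "- a"] assms(1) by (simp add: blinfun.minus_left cinner_simps)
qed

lemma op_nonneg_norm_bound:
  assumes "is_adjoint a a" "norm a \<le> m" "0 < m"
  shows "op_nonneg (m *\<^sub>R id_blinfun - a)"
  unfolding op_nonneg_def
proof
  show "is_adjoint (m *\<^sub>R id_blinfun - a) (m *\<^sub>R id_blinfun - a)"
    by (intro is_adjoint_diff is_adjoint_scaleR is_adjoint_id assms)
  show "\<forall>x. 0 \<le> Re (cinner ((m *\<^sub>R id_blinfun - a) x) x)"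
    using Re_cinner_apply_le[OF assms(2,3)]
    by (auto simp: blinfun.bilinear_simps cinner_simps cinner_self abs_le_iff)
qed

lemma poly_nonneg_closure:
  assumes "u < v" "\<And>t. u < t \<Longrightarrow> t < v \<Longrightarrow> 0 \<le> poly p t" "u \<le> t" "t \<le> (v::real)"
  shows "0 \<le> poly p t"
  by (rule continuous_ge_on_closure[of "{u<..<v}"]) (use assms in \<open>auto intro!: continuous_intros\<close>)

text \<open>An induction on the degree of \<open>q\<close>. Subtracting its minimum on \<open>[0, m]\<close>,
attained at \<open>r\<close>, gives \<open>q\<close> a root at \<open>r\<close>; hence \<open>q\<close> is a nonnegative constant plus \<open>t q\<^sub>1\<close>,
\<open>(m - t) q\<^sub>1\<close> or \<open>(t - r)\<^sup>2 q\<^sub>1\<close>, according as \<open>r\<close> is \<open>0\<close>, \<open>m\<close> or an interior point, where \<open>q\<^sub>1\<close> is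
nonnegative on \<open>[0, m]\<close> and has smaller degree. To survive multiplication by \<open>t\<close> and by \<open>m - t\<close>, the
induction hypothesis has to assert positivity of \<open>q\<close>, \<open>t q\<close>, \<open>(m - t) q\<close> and \<open>t (m - t) q\<close> at \<open>a\<close>;
multiplying by \<open>t\<close> then permutes these up to a factor \<open>t\<^sup>2\<close>, which is harmless.\<close>

lemma op_poly_nonneg:
  assumes a: "op_nonneg a" "norm a \<le> m" "0 < m"
    and q: "\<And>t. 0 \<le> t \<Longrightarrow> t \<le> m \<Longrightarrow> 0 \<le> poly q t"
  shows "op_nonneg (op_poly q a)"
proof -
  define X Y where "X = [:0, 1 :: real:]" and "Y = [:m, -1:]"
  define P where "P r \<longleftrightarrow> op_nonneg (op_poly r a)" for r
  have aa: "is_adjoint a a" using a unfolding op_nonneg_def by blast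
  have P_add: "P r \<Longrightarrow> P s \<Longrightarrow> P (r + s)" for r s
    unfolding P_def by (simp add: op_poly_add op_nonneg_add)
  have P_smult: "P r \<Longrightarrow> 0 \<le> c \<Longrightarrow> P (smult c r)" for r c
    unfolding P_def by (simp add: op_poly_smult op_nonneg_scaleR)
  have P_square: "P (s * s * r)" if "P r" for r s
  proof -
    have "op_poly (s * s * r) a = op_poly s a o\<^sub>L op_poly r a o\<^sub>L op_poly s a"
      by (metis op_poly_mult mult.assoc mult.commute)
    then show ?thesis using op_nonneg_sandwich that is_adjoint_op_poly[OF aa] unfolding P_def by metis
  qed
  have P1: "P 1" unfolding P_def using op_nonneg_id by (simp add: one_pCons)
  have PX: "P X" unfolding P_def X_def using a by (simp add: op_poly_pCons)
  have PY: "P Y" unfolding P_def Y_def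
    using op_nonneg_norm_bound[OF aa a(2,3)] by (simp add: op_poly_pCons blinfun_compose_simps)
  \<comment> \<open>\<open>X + Y\<close> is the constant \<open>m\<close>, so \<open>m X Y = X\<^sup>2 Y + Y\<^sup>2 X\<close>\<close>
  have PXY: "P (X * Y)"
  proof -
    have "P (X * X * Y + Y * Y * X)" using P_add P_square PX PY by blast
    moreover have "X * Y = smult (1 / m) (X * X * Y + Y * Y * X)"
    proof -
      have "X * X * Y + Y * Y * X = (X * Y) * (X + Y)" by (simp add: algebra_simps)
      also have "X + Y = [:m:]" by (simp add: X_def Y_def)
      finally show ?thesis using a(3) by (simp add: mult.commute)
    qed
    ultimately show ?thesis using P_smult a(3) by (metis less_imp_le zero_le_divide_1_iff)
  qed
  define S where "S r \<longleftrightarrow> P r \<and> P (X * r) \<and> P (Y * r) \<and> P (X * Y * r)" for r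
  have S_const: "S [:c:]" if "0 \<le> c" for c
    using P_smult[OF P1 that] P_smult[OF PX that] P_smult[OF PY that] P_smult[OF PXY that]
    unfolding S_def by (simp add: mult.commute[of _ "[:c:]"])
  have S_add: "S r \<Longrightarrow> S s \<Longrightarrow> S (r + s)" for r s
    unfolding S_def using P_add by (simp add: distrib_left)
  have S_X: "S (X * r)" if "S r" for r
    using that P_square[of r X] P_square[of "Y * r" X] unfolding S_def by (simp add: ac_simps)
  have S_Y: "S (Y * r)" if "S r" for r
    using that P_square[of r Y] P_square[of "X * r" Y] unfolding S_def by (simp add: ac_simps)
  have S_square: "S (s * s * r)" if "S r" for r s
    using that P_square[of r s] P_square[of "X * r" s] P_square[of "Y * r" s] P_square[of "X * Y * r" s]
    unfolding S_def by (simp add: ac_simps)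
  have "S q" using q
  proof (induction "degree q" arbitrary: q rule: less_induct)
    case less
    show ?case
    proof (cases "degree q = 0")
      case True
      then obtain c where "q = [:c:]" using degree_eq_zeroE by blast
      then show ?thesis using S_const less.prems[of 0] a(3) by simp
    next
      case False
      have "\<exists>r\<in>{0..m}. \<forall>t\<in>{0..m}. poly q r \<le> poly q t"
        by (rule continuous_attains_inf) (use a(3) in \<open>auto intro!: continuous_intros\<close>)
      then obtain r where r: "0 \<le> r" "r \<le> m" "\<And>t. 0 \<le> t \<Longrightarrow> t \<le> m \<Longrightarrow> poly q r \<le> poly q t" by auto
      define \<mu> where "\<mu> = poly q r"
      have \<mu>: "0 \<le> \<mu>" using less.prems r by (simp add: \<mu>_def)
      have "poly (q - [:\<mu>:]) r = 0" by (simp add: \<mu>_def)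
      then obtain q1 where q1: "q - [:\<mu>:] = [:- r, 1:] * q1"
        unfolding poly_eq_0_iff_dvd by (elim dvdE)
      then have q_eq: "q = [:- r, 1:] * q1 + [:\<mu>:]" by (metis diff_add_cancel)
      have q1_0: "q1 \<noteq> 0" using q_eq False by auto
      have "degree q = degree ([:- r, 1:] * q1)"
        using degree_add_eq_left[of "[:\<mu>:]" "[:- r, 1:] * q1"] degree_mult_eq[of "[:- r, 1:]" q1] q1_0 q_eq by simp
      then have deg1: "degree q = Suc (degree q1)" using degree_mult_eq[of "[:- r, 1:]" q1] q1_0 by simp
      have sgn: "0 \<le> (t - r) * poly q1 t" if "0 \<le> t" "t \<le> m" for t
      proof -
        have "poly q t = (t - r) * poly q1 t + \<mu>" by (subst q_eq) (simp add: algebra_simps)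
        then show ?thesis using r(3)[OF that] by (simp add: \<mu>_def)
      qed
      have right: "0 \<le> poly q1 t" if "r < t" "t \<le> m" for t
        using sgn[of t] that r(1) by (simp add: zero_le_mult_iff)
      have left: "poly q1 t \<le> 0" if "0 \<le> t" "t < r" for t
        using sgn[of t] that r(2) by (simp add: zero_le_mult_iff)
      consider "r = 0" | "r = m" | "0 < r" "r < m" using r by linarith
      then have "S ([:- r, 1:] * q1)"
      proof cases
        case 1
        have "S q1"
        proof (rule less.hyps)
          show "0 \<le> poly q1 t" if "0 \<le> t" "t \<le> m" for t
            using poly_nonneg_closure[of 0 m q1 t] right that 1 a(3) by auto
        qed (use deg1 in simp)
        then show ?thesis using S_X 1 by (simp add: X_def)
      next
        case 2
        have "S (- q1)"
        proof (rule less.hyps)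
          show "0 \<le> poly (- q1) t" if "0 \<le> t" "t \<le> m" for t
            using poly_nonneg_closure[of 0 m "- q1" t] left that 2 a(3) by auto
        qed (use deg1 in simp)
        moreover have "[:- r, 1:] * q1 = Y * (- q1)" using 2 by (simp add: Y_def)
        ultimately show ?thesis using S_Y by metis
      next
        case 3
        \<comment> \<open>the cofactor changes sign at an interior minimum, so it vanishes there\<close>
        have "0 \<le> poly q1 r" using poly_nonneg_closure[of r m q1 r] right 3 by auto
        moreover have "0 \<le> poly (- q1) r" using poly_nonneg_closure[of 0 r "- q1" r] left 3 by auto
        ultimately have "poly q1 r = 0" by simp
        then obtain q2 where q2: "q1 = [:- r, 1:] * q2" unfolding poly_eq_0_iff_dvd by (elim dvdE)
        have off: "0 \<le> poly q2 t" if "0 \<le> t" "t \<le> m" "t \<noteq> r" for t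
        proof -
          have "0 \<le> (t - r)\<^sup>2 * poly q2 t"
            using sgn[OF that(1,2)] by (simp add: q2 power2_eq_square algebra_simps)
          then show ?thesis using that(3) by (simp add: zero_le_mult_iff)
        qed
        have "S q2"
        proof (rule less.hyps)
          have "q2 \<noteq> 0" using q1_0 q2 by auto
          then have "degree q1 = Suc (degree q2)"
            unfolding q2 by (subst degree_mult_eq) auto
          then show "degree q2 < degree q" using deg1 by simp
          show "0 \<le> poly q2 t" if "0 \<le> t" "t \<le> m" for t
            using poly_nonneg_closure[of 0 r q2 t] off that 3 by (cases "t = r") auto
        qed
        then show ?thesis using S_square[of q2 "[:- r, 1:]"] by (simp only: q2 mult.assoc)
      qed
      then show ?thesis using S_add S_const[OF \<mu>] q_eq by metis
    qed
  qed
  then show ?thesis unfolding S_def P_def by blast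
qed

lemma op_poly_nonneg':
  assumes a: "op_nonneg a" and q: "\<And>t. 0 \<le> t \<Longrightarrow> t \<le> norm a \<Longrightarrow> 0 \<le> poly q t"
  shows "op_nonneg (op_poly q a)"
proof (cases "a = 0")
  case True
  then have "op_poly q a = poly q 0 *\<^sub>R id_blinfun"
    by (cases q) (simp add: op_poly_pCons)
  then show ?thesis using q[of 0] op_nonneg_scaleR[OF op_nonneg_id] by simp
next
  case False
  then show ?thesis using op_poly_nonneg[OF a order_refl] q by simp
qed

text \<open>The polynomial \<open>s\<^sup>2 - q\<^sup>2\<close> is nonnegative on the interval, so \<open>\<parallel>q(a) x\<parallel>\<^sup>2 = (q(a)\<^sup>2 x, x) \<le> s\<^sup>2 \<parallel>x\<parallel>\<^sup>2\<close>.\<close>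

lemma norm_op_poly_le:
  assumes a: "op_nonneg a" and q: "\<And>t. 0 \<le> t \<Longrightarrow> t \<le> norm a \<Longrightarrow> \<bar>poly q t\<bar> \<le> s"
  shows "norm (op_poly q a) \<le> s"
proof (rule norm_blinfun_bound)
  show s: "0 \<le> s" using q[of 0] abs_ge_zero[of "poly q 0"] by (meson norm_ge_zero order_refl order_trans)
  fix x
  have Q: "is_adjoint (op_poly q a) (op_poly q a)" using a is_adjoint_op_poly unfolding op_nonneg_def by blast
  have "op_nonneg (op_poly ([:s\<^sup>2:] - q * q) a)"
  proof (rule op_poly_nonneg'[OF a])
    fix t assume "0 \<le> t" "t \<le> norm a"
    then have "(poly q t)\<^sup>2 \<le> s\<^sup>2" using abs_le_square_iff[of "poly q t" s] q s by simp
    then show "0 \<le> poly ([:s\<^sup>2:] - q * q) t" by (simp add: power2_eq_square)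
  qed
  then have "0 \<le> Re (cinner (op_poly ([:s\<^sup>2:] - q * q) a x) x)" unfolding op_nonneg_def by blast
  also have "cinner (op_poly ([:s\<^sup>2:] - q * q) a x) x = of_real (s\<^sup>2 * (norm x)\<^sup>2) - cinner (op_poly q a (op_poly q a x)) x"
    by (simp add: op_poly_diff op_poly_mult blinfun.bilinear_simps cinner_simps cinner_self)
  also have "cinner (op_poly q a (op_poly q a x)) x = of_real ((norm (op_poly q a x))\<^sup>2)"
    using Q unfolding is_adjoint_def by (simp add: cinner_self)
  finally have "(norm (op_poly q a x))\<^sup>2 \<le> (s * norm x)\<^sup>2" by (simp add: power_mult_distrib)
  then show "norm (op_poly q a x) \<le> s * norm x" by (rule power2_le_imp_le) (simp add: s)
qed

lemma norm_op_poly_diff_le: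
  assumes "op_nonneg a" "\<And>t. 0 \<le> t \<Longrightarrow> t \<le> norm a \<Longrightarrow> \<bar>poly p t - poly q t\<bar> \<le> s"
  shows "norm (op_poly p a - op_poly q a) \<le> s"
  using norm_op_poly_le[OF assms(1), of "p - q" s] assms(2) by (simp add: op_poly_diff)

lemma exists_approximating_poly:
  fixes f :: "real \<Rightarrow> real"
  assumes "continuous_on {0..R} f" "0 < e"
  shows "\<exists>q. \<forall>t. 0 \<le> t \<longrightarrow> t \<le> R \<longrightarrow> \<bar>poly q t - f t\<bar> < e"
proof -
  obtain g where g: "real_polynomial_function g" "\<And>t. t \<in> {0..R} \<Longrightarrow> \<bar>f t - g t\<bar> < e"
    using Stone_Weierstrass_real_polynomial_function[OF compact_Icc assms] by blast
  obtain c :: "nat \<Rightarrow> real" and n where c: "g = (\<lambda>t. \<Sum>i\<le>n. c i * t ^ i)"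
    using g(1) unfolding real_polynomial_function_iff_sum by blast
  have "poly (\<Sum>i\<le>n. monom (c i) i) t = g t" for t by (simp add: c poly_sum poly_monom)
  then show ?thesis
    using g(2) by (intro exI[of _ "\<Sum>i\<le>n. monom (c i) i"]) (simp add: abs_minus_commute)
qed

lemma exists_approximating_poly_sequence:
  fixes f :: "real \<Rightarrow> real"
  assumes "continuous_on {0..R} f"
  shows "\<exists>q. \<forall>n t. 0 \<le> t \<longrightarrow> t \<le> R \<longrightarrow> \<bar>poly (q n) t - f t\<bar> < 1 / real (Suc n)"
  using exists_approximating_poly[OF assms, of "1 / real (Suc _)"] by (intro choice) simp

lemma approximating_sequence_uniform_limit:
  fixes R :: real
  assumes "\<And>n t. 0 \<le> t \<Longrightarrow> t \<le> R \<Longrightarrow> \<bar>poly (q n) t - f t\<bar> < 1 / real (Suc n)"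
  shows "uniform_limit {0..R} (\<lambda>n t. poly (q n) t) f sequentially"
proof (rule uniform_limitI)
  fix e :: real assume "0 < e"
  then have "\<forall>\<^sub>F n in sequentially. 1 / real (Suc n) < e"
    using order_tendstoD(2)[OF LIMSEQ_Suc[OF lim_inverse_n']] by simp
  then show "\<forall>\<^sub>F n in sequentially. \<forall>x\<in>{0..R}. dist (poly (q n) x) (f x) < e"
    by (rule eventually_mono) (auto simp: dist_real_def intro: less_trans[OF assms])
qed

text \<open>The norm bound makes the values of approximating polynomials a Cauchy sequence with a limit that
does not depend on the approximation, so the definite description in the functional calculus
is well-defined.\<close>

lemma cfc_limit:
  assumes a: "op_nonneg a" and f: "continuous_on {0..norm a} f"
    and q: "uniform_limit {0..norm a} (\<lambda>n t. poly (q n) t) f sequentially"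
  shows "(\<lambda>n. op_poly (q n) a) \<longlonglongrightarrow> cfc f a"
proof -
  define ap where "ap q \<longleftrightarrow> uniform_limit {0..norm a} (\<lambda>n t. poly (q n) t) f sequentially" for q
  have close: "\<exists>N. \<forall>m\<ge>N. \<forall>n\<ge>N. norm (op_poly (q m) a - op_poly (r n) a) < e"
    if "ap q" "ap r" "0 < e" for q r and e :: real
  proof -
    have "\<forall>\<^sub>F n in sequentially. \<forall>t\<in>{0..norm a}. dist (poly (q n) t) (f t) < e / 4"
      "\<forall>\<^sub>F n in sequentially. \<forall>t\<in>{0..norm a}. dist (poly (r n) t) (f t) < e / 4"
      using that(1,2) divide_pos_pos[OF that(3), of 4] unfolding ap_def uniform_limit_iff by (meson zero_less_numeral)+
    then obtain N where N: "\<And>n t. n \<ge> N \<Longrightarrow> t \<in> {0..norm a} \<Longrightarrow> \<bar>poly (q n) t - f t\<bar> < e / 4"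
        "\<And>n t. n \<ge> N \<Longrightarrow> t \<in> {0..norm a} \<Longrightarrow> \<bar>poly (r n) t - f t\<bar> < e / 4"
      unfolding eventually_sequentially dist_real_def by (metis nle_le order_trans)
    have "norm (op_poly (q m) a - op_poly (r n) a) \<le> e / 2" if "m \<ge> N" "n \<ge> N" for m n
    proof (rule norm_op_poly_diff_le[OF a])
      fix t assume "0 \<le> t" "t \<le> norm a"
      then have "\<bar>poly (q m) t - f t\<bar> < e / 4" "\<bar>poly (r n) t - f t\<bar> < e / 4"
        using N(1)[OF that(1), of t] N(2)[OF that(2), of t] by auto
      then show "\<bar>poly (q m) t - poly (r n) t\<bar> \<le> e / 2" by linarith
    qed
    then show ?thesis using that(3) by (intro exI[of _ N] allI impI) (smt (verit) field_sum_of_halves)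
  qed
  have "Cauchy (\<lambda>n. op_poly (q n) a)"
    unfolding Cauchy_iff using close[of q q] q by (simp add: ap_def)
  then obtain b where b: "(\<lambda>n. op_poly (q n) a) \<longlonglongrightarrow> b" using Cauchy_convergent convergent_def by blast
  have all: "(\<lambda>n. op_poly (r n) a) \<longlonglongrightarrow> b" if "ap r" for r
  proof -
    have "(\<lambda>n. op_poly (r n) a - op_poly (q n) a) \<longlonglongrightarrow> 0"
      unfolding LIMSEQ_iff using close[OF that, of q] q by (simp add: ap_def) blast
    then show ?thesis using tendsto_add[OF _ b] by fastforce
  qed
  have "cfc f a = b"
    unfolding cfc_def ap_def[symmetric]
  proof (rule the_equality)
    show "\<forall>q. ap q \<longrightarrow> (\<lambda>n. op_poly (q n) a) \<longlonglongrightarrow> b" using all by blast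
    show "c = b" if "\<forall>q. ap q \<longrightarrow> (\<lambda>n. op_poly (q n) a) \<longlonglongrightarrow> c" for c
      using that q b LIMSEQ_unique unfolding ap_def by blast
  qed
  then show ?thesis using b by simp
qed

lemma cfc_approximating_sequence:
  assumes a: "op_nonneg a" and f: "continuous_on {0..norm a} f"
  shows "\<exists>q. (\<forall>n t. 0 \<le> t \<longrightarrow> t \<le> norm a \<longrightarrow> \<bar>poly (q n) t - f t\<bar> < 1 / real (Suc n)) \<and>
    (\<lambda>n. op_poly (q n) a) \<longlonglongrightarrow> cfc f a"
proof -
  obtain q where q: "\<And>n t. 0 \<le> t \<Longrightarrow> t \<le> norm a \<Longrightarrow> \<bar>poly (q n) t - f t\<bar> < 1 / real (Suc n)"
    using exists_approximating_poly_sequence[OF f] by blast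
  show ?thesis using q cfc_limit[OF a f approximating_sequence_uniform_limit[OF q]] by blast
qed

lemma norm_op_poly_minus_cfc_le:
  assumes a: "op_nonneg a" and f: "continuous_on {0..norm a} f"
    and p: "\<And>t. 0 \<le> t \<Longrightarrow> t \<le> norm a \<Longrightarrow> \<bar>poly p t - f t\<bar> \<le> e"
  shows "norm (op_poly p a - cfc f a) \<le> e"
proof -
  obtain q where q: "\<And>n t. 0 \<le> t \<Longrightarrow> t \<le> norm a \<Longrightarrow> \<bar>poly (q n) t - f t\<bar> < 1 / real (Suc n)"
    and lim: "(\<lambda>n. op_poly (q n) a) \<longlonglongrightarrow> cfc f a" using cfc_approximating_sequence[OF a f] by blast
  have "(\<lambda>n. 1 / real (Suc n)) \<longlonglongrightarrow> 0" using LIMSEQ_Suc[OF lim_inverse_n'] .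
  then have "(\<lambda>n. e + 1 / real (Suc n)) \<longlonglongrightarrow> e" using tendsto_add[OF tendsto_const] by fastforce
  moreover have "(\<lambda>n. norm (op_poly p a - op_poly (q n) a)) \<longlonglongrightarrow> norm (op_poly p a - cfc f a)"
    by (intro tendsto_intros lim)
  moreover have "norm (op_poly p a - op_poly (q n) a) \<le> e + 1 / real (Suc n)" for n
  proof (rule norm_op_poly_diff_le[OF a])
    fix t assume t: "0 \<le> t" "t \<le> norm a"
    show "\<bar>poly p t - poly (q n) t\<bar> \<le> e + 1 / real (Suc n)" using p[OF t] q[OF t, of n] by linarith
  qed
  ultimately show ?thesis by (intro LIMSEQ_le) auto
qed

lemma op_nonneg_cfc:
  assumes a: "op_nonneg a" and f: "continuous_on {0..norm a} f" "\<And>t. 0 \<le> t \<Longrightarrow> t \<le> norm a \<Longrightarrow> 0 \<le> f t"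
  shows "op_nonneg (cfc f a)"
proof -
  obtain q where q: "\<And>n t. 0 \<le> t \<Longrightarrow> t \<le> norm a \<Longrightarrow> \<bar>poly (q n) t - f t\<bar> < 1 / real (Suc n)"
    and lim: "(\<lambda>n. op_poly (q n) a) \<longlonglongrightarrow> cfc f a" using cfc_approximating_sequence[OF a f(1)] by blast
  have pos: "op_nonneg (op_poly (q n) a + (1 / real (Suc n)) *\<^sub>R id_blinfun)" for n
  proof -
    have "op_nonneg (op_poly (q n + [:1 / real (Suc n):]) a)"
    proof (rule op_poly_nonneg'[OF a])
      fix t assume t: "0 \<le> t" "t \<le> norm a"
      show "0 \<le> poly (q n + [:1 / real (Suc n):]) t" using q[OF t, of n] f(2)[OF t] by simp
    qed
    then show ?thesis by (simp only: op_poly_add op_poly_const)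
  qed
  have "(\<lambda>n. op_poly (q n) a + (1 / real (Suc n)) *\<^sub>R id_blinfun) \<longlonglongrightarrow> cfc f a + 0 *\<^sub>R id_blinfun"
    by (intro tendsto_add tendsto_scaleR tendsto_const lim LIMSEQ_Suc[OF lim_inverse_n'])
  from op_nonneg_lim[OF this pos] show ?thesis by simp
qed

lemma cfc_in_vna:
  assumes "von_neumann_algebra M" "a \<in> M" "op_nonneg a" "continuous_on {0..norm a} f"
  shows "cfc f a \<in> M"
proof -
  obtain q where lim: "(\<lambda>n. op_poly (q n) a) \<longlonglongrightarrow> cfc f a"
    using cfc_approximating_sequence[OF assms(3,4)] by (elim exE conjE)
  show ?thesis by (rule closed_sequentially[OF vna_closed[OF assms(1)] op_poly_in_vna[OF assms(1,2)] lim])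
qed

text \<open>Both the square root and the p-th power are homogeneous functions; their functional calculus
inherits this, since approximating polynomials on \<open>[0, \<parallel>a\<parallel>]\<close> rescale to \<open>[0, c \<parallel>a\<parallel>]\<close>.\<close>

lemma cfc_scaleR:
  assumes a: "op_nonneg a" and c: "0 < c" and f: "continuous_on {0..c * norm a} f"
    and fk: "\<And>t. 0 \<le> t \<Longrightarrow> t \<le> norm a \<Longrightarrow> f (c * t) = k * f t"
    and f': "continuous_on {0..norm a} f"
  shows "cfc f (c *\<^sub>R a) = k *\<^sub>R cfc f a"
proof -
  have ca: "op_nonneg (c *\<^sub>R a)" "norm (c *\<^sub>R a) = c * norm a" using op_nonneg_scaleR[OF a] c by auto
  have f1: "continuous_on {0..norm (c *\<^sub>R a)} f" using f unfolding ca(2) .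
  obtain q where q: "\<And>n t. 0 \<le> t \<Longrightarrow> t \<le> norm a \<Longrightarrow> \<bar>poly (q n) t - f t\<bar> < 1 / real (Suc n)"
    and lim: "(\<lambda>n. op_poly (q n) a) \<longlonglongrightarrow> cfc f a" using cfc_approximating_sequence[OF a f'] by blast
  define r where "r n = smult k (pcompose (q n) [:0, 1 / c:])" for n
  have r: "op_poly (r n) (c *\<^sub>R a) = k *\<^sub>R op_poly (q n) a" for n
    using c by (simp add: r_def op_poly_smult op_poly_scaleR[of _ "1 / c", symmetric])
  have "norm (op_poly (r n) (c *\<^sub>R a) - cfc f (c *\<^sub>R a)) \<le> \<bar>k\<bar> * (1 / real (Suc n))" for n
  proof (rule norm_op_poly_minus_cfc_le[OF ca(1) f1])
    fix t assume t: "0 \<le> t" "t \<le> norm (c *\<^sub>R a)"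
    have tc: "0 \<le> t / c" "t / c \<le> norm a" using t c by (auto simp: field_simps)
    have "poly (r n) t - f t = k * (poly (q n) (t / c) - f (t / c))"
      using fk[OF tc] c by (simp add: r_def poly_pcompose algebra_simps)
    then have "\<bar>poly (r n) t - f t\<bar> = \<bar>k\<bar> * \<bar>poly (q n) (t / c) - f (t / c)\<bar>" by (simp add: abs_mult)
    also have "\<dots> \<le> \<bar>k\<bar> * (1 / real (Suc n))" using q[OF tc, of n] by (intro mult_left_mono) auto
    finally show "\<bar>poly (r n) t - f t\<bar> \<le> \<bar>k\<bar> * (1 / real (Suc n))" .
  qed
  moreover have "(\<lambda>n. \<bar>k\<bar> * (1 / real (Suc n))) \<longlonglongrightarrow> 0"
    using tendsto_mult_right_zero[OF LIMSEQ_Suc[OF lim_inverse_n']] .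
  ultimately have "(\<lambda>n. op_poly (r n) (c *\<^sub>R a) - cfc f (c *\<^sub>R a)) \<longlonglongrightarrow> 0"
    by (rule Lim_null_comparison[OF always_eventually, OF allI])
  then have "(\<lambda>n. k *\<^sub>R op_poly (q n) a) \<longlonglongrightarrow> cfc f (c *\<^sub>R a)"
    unfolding r by (rule LIM_zero_cancel)
  moreover have "(\<lambda>n. k *\<^sub>R op_poly (q n) a) \<longlonglongrightarrow> k *\<^sub>R cfc f a" by (intro tendsto_intros lim)
  ultimately show ?thesis by (rule LIMSEQ_unique)
qed

text \<open>A three epsilon argument with one polynomial that approximates \<open>f\<close> on an interval containing the
spectra of all the operators.\<close>

lemma tendsto_cfc:
  assumes a: "\<And>n. op_nonneg (a n)" and lim: "a \<longlonglongrightarrow> b" and f: "continuous_on {0..} f"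
  shows "(\<lambda>n. cfc f (a n)) \<longlonglongrightarrow> cfc f b"
proof (rule LIMSEQ_I)
  fix e :: real assume e: "0 < e"
  have b: "op_nonneg b" using op_nonneg_lim[OF lim a] .
  have fc: "continuous_on {0..norm c} f" for c :: "'a \<Rightarrow>\<^sub>L 'a" by (rule continuous_on_subset[OF f]) auto
  obtain R where R: "\<And>n. norm (a n) \<le> R" using lim convergent_imp_Bseq[OF convergentI] by (metis BseqE)
  have Rb: "norm b \<le> R" using LIMSEQ_le_const2[OF tendsto_norm[OF lim]] R by blast
  obtain q where q: "\<And>t. 0 \<le> t \<Longrightarrow> t \<le> R \<Longrightarrow> \<bar>poly q t - f t\<bar> < e / 3"
    using exists_approximating_poly[of R f "e / 3"] e continuous_on_subset[OF f] by auto
  have 1: "norm (op_poly q (a n) - cfc f (a n)) \<le> e / 3" for n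
    using q R[of n] by (intro norm_op_poly_minus_cfc_le[OF a fc] less_imp_le) auto
  have 2: "norm (op_poly q b - cfc f b) \<le> e / 3"
    using q Rb by (intro norm_op_poly_minus_cfc_le[OF b fc] less_imp_le) auto
  obtain N where N: "\<And>n. n \<ge> N \<Longrightarrow> norm (op_poly q (a n) - op_poly q b) < e / 3"
    using LIMSEQ_D[OF tendsto_op_poly[OF lim, of q], of "e / 3"] e by auto
  have "norm (cfc f (a n) - cfc f b) < e" if "n \<ge> N" for n
  proof -
    have "cfc f (a n) - cfc f b = (op_poly q (a n) - op_poly q b) + ((op_poly q b - cfc f b) - (op_poly q (a n) - cfc f (a n)))"
      by simp
    then have "norm (cfc f (a n) - cfc f b) \<le> norm (op_poly q (a n) - op_poly q b) + (norm (op_poly q b - cfc f b) + norm (op_poly q (a n) - cfc f (a n)))"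
      by (simp only:) (rule norm_triangle_mono[OF order_refl norm_triangle_ineq4])
    then show ?thesis using N[OF that] 1[of n] 2 by linarith
  qed
  then show "\<exists>N. \<forall>n\<ge>N. norm (cfc f (a n) - cfc f b) < e" by blast
qed

section \<open>The p-norm on skew-hermitian elements\<close>

context
  fixes M :: "('h::complex_hilbert \<Rightarrow>\<^sub>L 'h) set" and \<tau> :: "('h \<Rightarrow>\<^sub>L 'h) \<Rightarrow> complex"
  assumes M: "von_neumann_algebra M" and \<tau>: "faithful_normal_tracial_state M \<tau>"
begin

lemma trace_add: "a \<in> M \<Longrightarrow> b \<in> M \<Longrightarrow> \<tau> (a + b) = \<tau> a + \<tau> b"
  and trace_op_scaleC: "a \<in> M \<Longrightarrow> \<tau> (op_scaleC c a) = c * \<tau> a"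
  and trace_positive_op: "a \<in> M \<Longrightarrow> positive_op a \<Longrightarrow> \<tau> a \<in> \<real>\<^sub>\<ge>\<^sub>0"
  and trace_id: "\<tau> id_blinfun = 1"
  using \<tau> by (simp_all add: faithful_normal_tracial_state_def)

lemma trace_scaleR:
  assumes "a \<in> M" shows "\<tau> (r *\<^sub>R a) = of_real r * \<tau> a"
proof -
  have "(\<lambda>x. r *\<^sub>R blinfun_apply a x) = blinfun_apply (r *\<^sub>R a)"
    by (rule ext) (simp add: blinfun.scaleR_left)
  then have "op_scaleC (of_real r) a = Blinfun (blinfun_apply (r *\<^sub>R a))"
    by (simp only: op_scaleC_def scaleC_of_real)
  also have "\<dots> = r *\<^sub>R a" by (rule blinfun_apply_inverse)
  finally show ?thesis using trace_op_scaleC[OF assms, of "of_real r"] by simp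
qed

lemma trace_nonneg: "a \<in> M \<Longrightarrow> op_nonneg a \<Longrightarrow> 0 \<le> Re (\<tau> a)"
  using trace_positive_op[of a] op_nonneg_imp_positive_op[of a] by (simp add: complex_nonneg_Reals_iff)

text \<open>Positivity of the trace applied to \<open>m - a\<close>: a tracial state has norm one on self-adjoint elements.\<close>

lemma Re_trace_le:
  assumes "a \<in> M" "is_adjoint a a" "norm a \<le> m" "0 < m"
  shows "Re (\<tau> a) \<le> m"
proof -
  have "m *\<^sub>R id_blinfun - a = m *\<^sub>R id_blinfun + (-1) *\<^sub>R a" by simp
  moreover have "m *\<^sub>R id_blinfun \<in> M" "(-1) *\<^sub>R a \<in> M"
    using vna_id[OF M] vna_subspace[OF M] assms(1) subspace_scale by blast+
  ultimately have "\<tau> (m *\<^sub>R id_blinfun - a) = of_real m - \<tau> a" "m *\<^sub>R id_blinfun - a \<in> M"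
    using trace_add[of "m *\<^sub>R id_blinfun" "(-1) *\<^sub>R a"] trace_scaleR[OF assms(1), of "-1"]
      trace_scaleR[OF vna_id[OF M], of m] trace_id
      subspace_add[OF vna_subspace[OF M], of "m *\<^sub>R id_blinfun" "(-1) *\<^sub>R a"] by auto
  then show ?thesis using trace_nonneg[of "m *\<^sub>R id_blinfun - a"] op_nonneg_norm_bound[OF assms(2-4)] by simp
qed

lemma tendsto_Re_trace:
  assumes a: "\<And>n. a n \<in> M" "\<And>n. is_adjoint (a n) (a n)" and lim: "a \<longlonglongrightarrow> b"
  shows "(\<lambda>n. Re (\<tau> (a n))) \<longlonglongrightarrow> Re (\<tau> b)"
proof (rule LIMSEQ_I)
  fix e :: real assume e: "0 < e"
  have b: "b \<in> M" "is_adjoint b b"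
    using closed_sequentially[OF vna_closed[OF M] a(1) lim] is_adjoint_lim[OF lim lim a(2)] by auto
  obtain N where N: "\<And>n. n \<ge> N \<Longrightarrow> norm (a n - b) < e / 2" using LIMSEQ_D[OF lim, of "e / 2"] e by auto
  have le: "Re (\<tau> x) - Re (\<tau> y) \<le> e / 2"
    if "x \<in> M" "y \<in> M" "is_adjoint x x" "is_adjoint y y" "norm (x - y) < e / 2" for x y
  proof -
    have "x - y \<in> M" using that subspace_diff[OF vna_subspace[OF M]] by blast
    then have "Re (\<tau> (x - y)) \<le> e / 2" "\<tau> x = \<tau> (x - y) + \<tau> y"
      using Re_trace_le[of "x - y" "e / 2"] trace_add[of "x - y" y] that is_adjoint_diff e by auto
    then show ?thesis by simp
  qed
  have "norm (Re (\<tau> (a n)) - Re (\<tau> b)) < e" if "n \<ge> N" for n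
    using le[of "a n" b] le[of b "a n"] a[of n] b N[OF that] e by (auto simp: norm_minus_commute abs_le_iff)
  then show "\<exists>N. \<forall>n\<ge>N. norm (Re (\<tau> (a n)) - Re (\<tau> b)) < e" by blast
qed

lemma skew_square:
  assumes "z \<in> skew_hermitian M"
  shows "adj z o\<^sub>L z = - (z o\<^sub>L z)" "op_nonneg (adj z o\<^sub>L z)" "adj z o\<^sub>L z \<in> M"
proof -
  have z: "z \<in> M" "is_adjoint z (- z)" using assms skew_hermitian_iff[OF M] by auto
  show eq: "adj z o\<^sub>L z = - (z o\<^sub>L z)" using adj_eqI[OF z(2)] by (simp add: blinfun_compose_simps)
  have "is_adjoint (- z o\<^sub>L z) (- z o\<^sub>L z)" by (rule is_adjoint_compose[OF is_adjoint_sym[OF z(2)] z(2)])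
  moreover have "cinner ((- z o\<^sub>L z) x) x = of_real ((norm (z x))\<^sup>2)" for x
    using is_adjoint_sym[OF z(2)] unfolding is_adjoint_def by (simp add: cinner_self)
  ultimately show "op_nonneg (adj z o\<^sub>L z)" by (simp add: adj_eqI[OF z(2)] op_nonneg_def)
  show "adj z o\<^sub>L z \<in> M" unfolding eq using vna_compose[OF M z(1,1)] subspace_neg[OF vna_subspace[OF M]] by blast
qed

lemma op_abs_skew:
  assumes "z \<in> skew_hermitian M"
  shows "op_nonneg (op_abs z)" "op_abs z \<in> M"
  unfolding op_abs_def using skew_square[OF assms] M
  by (auto intro!: op_nonneg_cfc cfc_in_vna continuous_intros)

context
  fixes p :: real
  assumes p: "1 \<le> p"
begin

lemma continuous_powr: "continuous_on {0..} (\<lambda>t::real. t powr p)"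
  using p by (intro continuous_on_powr') (auto intro!: continuous_intros)

lemma cfc_powr_op_abs:
  assumes "z \<in> skew_hermitian M"
  shows "op_nonneg (cfc (\<lambda>t. t powr p) (op_abs z))" "cfc (\<lambda>t. t powr p) (op_abs z) \<in> M"
  using op_abs_skew[OF assms] M
  by (auto intro!: op_nonneg_cfc cfc_in_vna continuous_on_subset[OF continuous_powr])

lemma pnorm_scaleR:
  assumes z: "z \<in> skew_hermitian M" and c: "0 < c"
  shows "pnorm \<tau> p (c *\<^sub>R z) = c * pnorm \<tau> p z"
proof -
  have cz: "c *\<^sub>R z \<in> skew_hermitian M" using z skew_hermitian_subspace[OF M] subspace_scale by blast
  have "adj (c *\<^sub>R z) o\<^sub>L (c *\<^sub>R z) = c\<^sup>2 *\<^sub>R (adj z o\<^sub>L z)"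
    unfolding skew_square(1)[OF z] skew_square(1)[OF cz] by (simp add: blinfun_compose_simps power2_eq_square)
  then have "op_abs (c *\<^sub>R z) = c *\<^sub>R op_abs z"
    unfolding op_abs_def using skew_square(2)[OF z] c
    by (simp only:) (rule cfc_scaleR, auto simp: real_sqrt_mult intro!: continuous_intros)
  then have "cfc (\<lambda>t. t powr p) (op_abs (c *\<^sub>R z)) = (c powr p) *\<^sub>R cfc (\<lambda>t. t powr p) (op_abs z)"
    using op_abs_skew(1)[OF z] c
    by (simp only:) (rule cfc_scaleR, auto simp: powr_mult intro!: continuous_on_subset[OF continuous_powr])
  then have "Re (\<tau> (cfc (\<lambda>t. t powr p) (op_abs (c *\<^sub>R z)))) = c powr p * Re (\<tau> (cfc (\<lambda>t. t powr p) (op_abs z)))"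
    by (simp add: trace_scaleR cfc_powr_op_abs[OF z])
  then show ?thesis
    unfolding pnorm_def using trace_nonneg cfc_powr_op_abs[OF z] c p by (simp add: powr_mult powr_powr)
qed

lemma pnorm_nonneg: "0 \<le> pnorm \<tau> p z"
  unfolding pnorm_def by simp

lemma pnorm_zero: "pnorm \<tau> p 0 = 0"
  using pnorm_scaleR[of 0 2] subspace_0[OF skew_hermitian_subspace[OF M]] by simp

lemma tendsto_pnorm:
  assumes z: "\<And>n. z n \<in> skew_hermitian M" and lim: "z \<longlonglongrightarrow> w"
  shows "(\<lambda>n. pnorm \<tau> p (z n)) \<longlonglongrightarrow> pnorm \<tau> p w"
proof -
  have w: "w \<in> skew_hermitian M" using closed_sequentially[OF skew_hermitian_closed[OF M] z lim] .
  have "(\<lambda>n. adj (z n) o\<^sub>L z n) \<longlonglongrightarrow> (adj w o\<^sub>L w)"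
    unfolding skew_square(1)[OF z] skew_square(1)[OF w]
    by (intro tendsto_minus tendsto_blinfun_compose lim)
  then have "(\<lambda>n. op_abs (z n)) \<longlonglongrightarrow> op_abs w"
    unfolding op_abs_def by (intro tendsto_cfc skew_square(2) z) (auto intro!: continuous_intros)
  then have "(\<lambda>n. cfc (\<lambda>t. t powr p) (op_abs (z n))) \<longlonglongrightarrow> cfc (\<lambda>t. t powr p) (op_abs w)"
    by (intro tendsto_cfc op_abs_skew(1) z continuous_powr)
  then have "(\<lambda>n. Re (\<tau> (cfc (\<lambda>t. t powr p) (op_abs (z n))))) \<longlonglongrightarrow> Re (\<tau> (cfc (\<lambda>t. t powr p) (op_abs w)))"
    using cfc_powr_op_abs[OF z] unfolding op_nonneg_def by (intro tendsto_Re_trace) auto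
  then show ?thesis
    unfolding pnorm_def using p trace_nonneg cfc_powr_op_abs[OF z]
    by (intro tendsto_powr' tendsto_const) auto
qed

lemma pnorm_less_nearby:
  assumes w: "w \<in> skew_hermitian M" and "pnorm \<tau> p w < c"
  shows "\<exists>d>0. \<forall>z\<in>skew_hermitian M. norm (z - w) < d \<longrightarrow> pnorm \<tau> p z < c"
proof (rule ccontr)
  assume "\<not> ?thesis"
  then have "\<exists>z\<in>skew_hermitian M. norm (z - w) < 1 / real (Suc n) \<and> c \<le> pnorm \<tau> p z" for n
    by (metis not_less of_nat_0_less_iff zero_less_Suc zero_less_divide_1_iff)
  then obtain z where z: "\<And>n. z n \<in> skew_hermitian M" "\<And>n. norm (z n - w) < 1 / real (Suc n)" "\<And>n. c \<le> pnorm \<tau> p (z n)"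
    by metis
  have lim: "(\<lambda>n. z n - w) \<longlonglongrightarrow> 0"
    using z(2) by (intro Lim_null_comparison[OF always_eventually LIMSEQ_Suc[OF lim_inverse_n']]) (auto intro: less_imp_le)
  have "c \<le> pnorm \<tau> p w"
    using LIMSEQ_le_const[OF tendsto_pnorm[OF z(1) LIM_zero_cancel[OF lim]]] z(3) by blast
  then show False using assms(2) by simp
qed

end

end

section \<open>Metric regularity of smooth maps\<close>

definition bounded_linear_onto :: "'a::real_normed_vector set \<Rightarrow> 'b::real_normed_vector set \<Rightarrow> ('a \<Rightarrow> 'b) \<Rightarrow> bool" where
  "bounded_linear_onto E F L \<longleftrightarrow>
     (\<forall>v\<in>E. \<forall>w\<in>E. L (v + w) = L v + L w) \<and> (\<forall>c. \<forall>v\<in>E. L (c *\<^sub>R v) = c *\<^sub>R L v) \<and>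
     (\<exists>K. \<forall>v\<in>E. norm (L v) \<le> K * norm v) \<and> L ` E = F"

lemma bounded_linear_onto_diff:
  assumes "bounded_linear_onto E F L" "subspace E" "v \<in> E" "w \<in> E"
  shows "L (v - w) = L v - L w"
proof -
  have "L (v + (-1) *\<^sub>R w) = L v + L ((-1) *\<^sub>R w)"
    using assms subspace_scale unfolding bounded_linear_onto_def by blast
  also have "L ((-1) *\<^sub>R w) = (-1) *\<^sub>R L w"
    using assms unfolding bounded_linear_onto_def by blast
  finally show ?thesis by simp
qed

text \<open>The Baire category part of the open mapping theorem. Solutions up to half of the right-hand side
are enough, because the iteration that would remove the error is performed once, for the nonlinear
map, in \<open>metric_regularity\<close>.\<close>

lemma bounded_linear_onto_approximate_solutions:
  fixes L :: "'a::banach \<Rightarrow> 'b::banach"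
  assumes E: "subspace E" and F: "subspace F" "closed F" and L: "bounded_linear_onto E F L"
  shows "\<exists>C>0. \<forall>w\<in>F. \<exists>v\<in>E. norm v \<le> C * norm w \<and> norm (w - L v) \<le> norm w / 2"
proof -
  define A where "A n = closure (L ` (E \<inter> cball 0 (real n)))" for n
  have LF: "L v \<in> F" if "v \<in> E" for v using L that unfolding bounded_linear_onto_def by blast
  have AF: "A n \<subseteq> F" for n
    unfolding A_def using LF F(2) by (intro closure_minimal) auto
  have un: "(\<Union>n. A n) = F"
  proof
    show "F \<subseteq> (\<Union>n. A n)"
    proof
      fix w assume "w \<in> F"
      then obtain v where v: "v \<in> E" "w = L v" using L unfolding bounded_linear_onto_def by blast
      obtain n where "norm v \<le> real n" using real_arch_simple by blast
      then have "w \<in> A n" unfolding A_def using v by (intro subsetD[OF closure_subset]) auto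
      then show "w \<in> (\<Union>n. A n)" by blast
    qed
  qed (use AF in blast)
  have "\<exists>n. (top_of_set F) interior_of (A n) \<noteq> {}"
  proof (rule ccontr)
    assume "\<not> ?thesis"
    then have none: "(top_of_set F) interior_of (A n) = {}" for n by blast
    have "(top_of_set F) interior_of \<Union>(range A) = {}"
    proof (rule Baire_category_alt)
      show "completely_metrizable_space (top_of_set F) \<or> locally_compact_space (top_of_set F) \<and> regular_space (top_of_set F)"
        using F(2) completely_metrizable_space_closedin[OF completely_metrizable_space_euclidean] by auto
    qed (use none AF in \<open>auto simp: A_def closedin_closed_eq[OF F(2)]\<close>)
    then have "F = {}" using un interior_of_topspace[of "top_of_set F"] by simp
    then show False using subspace_0[OF F(1)] by blast
  qed
  then obtain n w0 where "w0 \<in> (top_of_set F) interior_of (A n)" by blast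
  then obtain U where U: "openin (top_of_set F) U" "w0 \<in> U" "U \<subseteq> A n"
    unfolding interior_of_def by blast
  then obtain r where r: "r > 0" "ball w0 r \<inter> F \<subseteq> A n" and w0: "w0 \<in> F"
    unfolding openin_contains_ball by blast
  \<comment> \<open>the summand \<open>1\<close> only serves to make the constant positive\<close>
  define C where "C = 4 * real n / r + 1"
  have C: "C > 0" using r(1) by (auto simp: C_def add_nonneg_pos)
  have "\<exists>v\<in>E. norm v \<le> C * norm w \<and> norm (w - L v) \<le> norm w / 2" if w: "w \<in> F" for w
  proof (cases "w = 0")
    case True
    have "L 0 = 0" using bounded_linear_onto_diff[OF L E, of 0 0] subspace_0[OF E] by simp
    then show ?thesis using True subspace_0[OF E] by (intro bexI[of _ 0]) auto
  next
    case False
    define c where "c = r / (2 * norm w)"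
    have c: "c > 0" using False r(1) by (simp add: c_def)
    have cw: "norm (c *\<^sub>R w) < r" using False r(1) by (simp add: c_def)
    have "w0 + c *\<^sub>R w \<in> A n"
      using cw subspace_add[OF F(1) w0 subspace_scale[OF F(1) w, of c]] r(2) unfolding subset_iff by (simp add: dist_norm)
    moreover have "w0 \<in> A n" using r w0 by (auto intro!: subsetD[OF r(2)])
    moreover have e: "0 < c * norm w / 4" using c False by simp
    moreover have "\<exists>v\<in>E. norm v \<le> real n \<and> norm (L v - x) < c * norm w / 4" if x: "x \<in> A n" for x
    proof -
      obtain y where "y \<in> L ` (E \<inter> cball 0 (real n))" "dist y x < c * norm w / 4"
        using x e unfolding A_def closure_approachable by meson
      then show ?thesis by (auto simp: dist_norm)
    qed
    ultimately obtain v1 v2 where v: "v1 \<in> E" "norm v1 \<le> real n" "norm (L v1 - (w0 + c *\<^sub>R w)) < c * norm w / 4"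
        "v2 \<in> E" "norm v2 \<le> real n" "norm (L v2 - w0) < c * norm w / 4"
      by meson
    define v where "v = (1 / c) *\<^sub>R (v1 - v2)"
    have vE: "v \<in> E" unfolding v_def using E v by (simp add: subspace_diff subspace_scale)
    have Lv: "L v = (1 / c) *\<^sub>R (L v1 - L v2)"
      using L v(1,4) bounded_linear_onto_diff[OF L E v(1,4)] subspace_diff[OF E v(1,4)]
      unfolding v_def bounded_linear_onto_def by metis
    have "norm (v1 - v2) \<le> 2 * real n" using norm_triangle_ineq4[of v1 v2] v by simp
    then have "norm v \<le> 1 / c * (2 * real n)" unfolding v_def using c by (simp add: divide_right_mono)
    also have "\<dots> = 4 * real n / r * norm w" using False r(1) by (simp add: c_def field_simps)
    also have "\<dots> \<le> C * norm w" unfolding C_def by (intro mult_right_mono) auto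
    finally have 1: "norm v \<le> C * norm w" .
    have "w - L v = (1 / c) *\<^sub>R ((L v2 - w0) - (L v1 - (w0 + c *\<^sub>R w)))"
      unfolding Lv using c by (simp add: algebra_simps)
    then have "norm (w - L v) = 1 / c * norm ((L v2 - w0) - (L v1 - (w0 + c *\<^sub>R w)))"
      using c by simp
    also have "\<dots> \<le> 1 / c * (c * norm w / 2)"
      using v c norm_triangle_ineq4[of "L v2 - w0" "L v1 - (w0 + c *\<^sub>R w)"]
      by (intro mult_left_mono) auto
    also have "\<dots> = norm w / 2" using c by simp
    finally show ?thesis using 1 vE by blast
  qed
  then show ?thesis using C by blast
qed

text \<open>Strict (two-point) differentiability along the subspace \<open>E\<close>; it holds for \<open>C\<^sup>1\<close> maps and is the form of
differentiability that Newton's iteration requires.\<close>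

definition strict_derivative_at_0 ::
  "'a::real_normed_vector set \<Rightarrow> ('a \<Rightarrow> 'b::real_normed_vector) \<Rightarrow> ('a \<Rightarrow> 'b) \<Rightarrow> bool" where
  "strict_derivative_at_0 E g L \<longleftrightarrow> (\<forall>e>0. \<exists>d>0. \<forall>k\<in>E. \<forall>l\<in>E. norm k < d \<longrightarrow> norm l < d \<longrightarrow>
     norm (g l - g k - L (l - k)) \<le> e * norm (l - k))"

text \<open>Graves' theorem. The chord method \<open>k\<^sub>n\<^sub>+\<^sub>1 = k\<^sub>n + R (w - g k\<^sub>n)\<close>, with \<open>R\<close> an approximate right inverse of
the derivative, multiplies the residual by at most \<open>3 / 4\<close>: the approximate inverse leaves \<open>1 / 2\<close> of
it and the linearization error adds \<open>1 / 4\<close>.\<close>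

lemma metric_regularity:
  fixes L :: "'a::banach \<Rightarrow> 'b::banach"
  assumes E: "subspace E" "closed E" and F: "subspace F" "closed F" and L: "bounded_linear_onto E F L"
    and r: "0 < r" and gF: "\<And>k. k \<in> E \<Longrightarrow> norm k < r \<Longrightarrow> g k \<in> F"
    and strict: "strict_derivative_at_0 E g L"
  shows "\<exists>C>0. \<exists>d>0. \<forall>k0\<in>E. \<forall>w\<in>F. norm k0 < d \<longrightarrow> norm (w - g k0) < d \<longrightarrow>
    (\<exists>k\<in>E. norm k < r \<and> g k = w \<and> norm (k - k0) \<le> C * norm (w - g k0))"
proof -
  obtain C where C: "C > 0" "\<And>w. w \<in> F \<Longrightarrow> \<exists>v\<in>E. norm v \<le> C * norm w \<and> norm (w - L v) \<le> norm w / 2"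
    using bounded_linear_onto_approximate_solutions[OF E(1) F L] by blast
  then obtain R where R: "\<And>w. w \<in> F \<Longrightarrow> R w \<in> E" "\<And>w. w \<in> F \<Longrightarrow> norm (R w) \<le> C * norm w"
      "\<And>w. w \<in> F \<Longrightarrow> norm (w - L (R w)) \<le> norm w / 2" by metis
  obtain K where K: "\<And>v. v \<in> E \<Longrightarrow> norm (L v) \<le> K * norm v"
    using L unfolding bounded_linear_onto_def by blast
  have e: "1 / (4 * C) > 0" using C by simp
  obtain d1 where d1: "d1 > 0" "\<And>k l. k \<in> E \<Longrightarrow> l \<in> E \<Longrightarrow> norm k < d1 \<Longrightarrow> norm l < d1 \<Longrightarrow>
     norm (g l - g k - L (l - k)) \<le> 1 / (4 * C) * norm (l - k)"
    using strict e unfolding strict_derivative_at_0_def by meson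
  define d2 where "d2 = min d1 r"
  have d2: "d2 > 0" "d2 \<le> d1" "d2 \<le> r" using d1(1) r by (auto simp: d2_def)
  \<comment> \<open>the iterates stay within \<open>4 C d\<close> of \<open>k\<^sub>0\<close>, since \<open>C\<close> times the sum of \<open>(3 / 4)\<^sup>n\<close> is \<open>4 C\<close>\<close>
  define d where "d = d2 / (1 + 4 * C)"
  have d: "d > 0" "d + 4 * C * d = d2"
    using d2(1) C(1) by (auto simp: d_def add_pos_pos divide_simps) (simp add: algebra_simps)?
  have "\<exists>k\<in>E. norm k < r \<and> g k = w \<and> norm (k - k0) \<le> 4 * C * norm (w - g k0)"
    if k0: "k0 \<in> E" "norm k0 < d" and w: "w \<in> F" "norm (w - g k0) < d" for k0 w
  proof -
    define k where "k = rec_nat k0 (\<lambda>_ k. k + R (w - g k))"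
    have k_simps: "k 0 = k0" "\<And>n. k (Suc n) = k n + R (w - g (k n))" by (auto simp: k_def)
    define e where "e n = w - g (k n)" for n
    have small: "norm (l :: 'a) < d2" if "norm (l - k0) \<le> 4 * C * norm (w - g k0)" for l
    proof -
      have "norm l \<le> norm k0 + norm (l - k0)" using norm_triangle_sub by blast
      also have "\<dots> < d + 4 * C * d"
        using that k0(2) w(2) C(1) by (smt (verit, best) mult_less_cancel_left_pos)
      finally show ?thesis using d by simp
    qed
    have inv: "k n \<in> E \<and> e n \<in> F \<and> norm (e n) \<le> (3/4)^n * norm (e 0) \<and>
        norm (k n - k0) \<le> 4 * C * (1 - (3/4)^n) * norm (e 0)" for n
    proof (induction n)
      case 0
      have "norm k0 < r" using small[of k0] d2 C(1) by simp
      then show ?case using k0(1) gF[of k0] w(1) F(1) by (simp add: k_simps e_def subspace_diff)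
    next
      case (Suc n)
      let ?l = "k (Suc n)"
      have l: "?l = k n + R (e n)" by (simp add: k_simps e_def)
      have lE: "?l \<in> E" unfolding l using Suc R(1) E(1) by (simp add: subspace_add)
      have step: "norm (R (e n)) \<le> C * ((3/4)^n * norm (e 0))"
        using R(2)[of "e n"] Suc C(1) by (meson mult_left_mono less_imp_le order_trans)
      have "norm (?l - k0) \<le> norm (k n - k0) + norm (R (e n))"
        unfolding l by (metis add_diff_eq add.commute norm_triangle_ineq)
      also have "\<dots> \<le> 4 * C * (1 - (3/4)^n) * norm (e 0) + C * ((3/4)^n * norm (e 0))"
        using Suc step by linarith
      also have "\<dots> = 4 * C * (1 - (3/4)^Suc n) * norm (e 0)" by (simp add: algebra_simps)
      finally have dist: "norm (?l - k0) \<le> 4 * C * (1 - (3/4)^Suc n) * norm (e 0)" .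
      have le: "4 * C * (1 - (3/4)^m) * norm (e 0) \<le> 4 * C * norm (w - g k0)" for m
        using C(1) by (simp add: e_def k_simps mult_left_le_one_le power_le_one)
      have sm: "norm (k n) < d2" "norm ?l < d2"
        using small Suc dist le by (meson order_trans)+
      have "g ?l \<in> F" using gF[OF lE] sm d2 by simp
      then have eF: "e (Suc n) \<in> F" using w(1) F(1) by (simp add: e_def subspace_diff)
      have "e (Suc n) = (e n - L (R (e n))) - (g ?l - g (k n) - L (?l - k n))"
        by (simp add: e_def l)
      then have "norm (e (Suc n)) \<le> norm (e n - L (R (e n))) + norm (g ?l - g (k n) - L (?l - k n))"
        by (metis norm_triangle_ineq4)
      also have "\<dots> \<le> norm (e n) / 2 + 1 / (4 * C) * norm (?l - k n)"
        using R(3)[of "e n"] Suc d1(2)[of "k n" ?l] lE sm d2 by (intro add_mono) auto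
      also have "\<dots> \<le> norm (e n) / 2 + 1 / (4 * C) * (C * norm (e n))"
        using R(2)[of "e n"] Suc C(1) by (intro add_left_mono mult_left_mono) (auto simp: l)
      also have "\<dots> = 3/4 * norm (e n)" using C(1) by simp
      also have "\<dots> \<le> (3/4)^Suc n * norm (e 0)" using Suc by simp
      finally show ?case using lE eF dist by blast
    qed
    have "summable (\<lambda>n. R (e n))"
    proof (rule summable_comparison_test')
      show "summable (\<lambda>n. C * norm (e 0) * (3/4)^n)" by (intro summable_mult) simp
      show "norm (R (e n)) \<le> C * norm (e 0) * (3/4)^n" if "n \<ge> 0" for n
        using order_trans[OF R(2)[of "e n"] mult_left_mono[of "norm (e n)" "(3/4)^n * norm (e 0)" C]] inv[of n] C(1)
        by (simp add: mult_ac)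
    qed
    then obtain S where "(\<lambda>n. \<Sum>i<n. R (e i)) \<longlonglongrightarrow> S" using summable_LIMSEQ by blast
    then have "(\<lambda>n. k0 + (\<Sum>i<n. R (e i))) \<longlonglongrightarrow> k0 + S" by (intro tendsto_intros)
    moreover have "k n = k0 + (\<Sum>i<n. R (e i))" for n by (induction n) (auto simp: k_simps e_def add.assoc)
    ultimately have lim: "k \<longlonglongrightarrow> k0 + S" by presburger
    define l where "l = k0 + S"
    have lE: "l \<in> E" using E(2) lim inv unfolding l_def by (metis closed_sequentially)
    have le: "norm (k n - k0) \<le> 4 * C * norm (w - g k0)" for n
    proof -
      have "4 * C * (1 - (3/4)^n) * norm (e 0) \<le> 4 * C * norm (w - g k0)"
        using C(1) by (simp add: e_def k_simps mult_left_le_one_le power_le_one)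
      then show ?thesis using inv[of n] by linarith
    qed
    have dist: "norm (l - k0) \<le> 4 * C * norm (w - g k0)"
    proof (rule LIMSEQ_le_const2)
      show "(\<lambda>n. norm (k n - k0)) \<longlonglongrightarrow> norm (l - k0)" using lim unfolding l_def by (intro tendsto_intros)
    qed (use le in blast)
    have "norm (g l - g (k n)) \<le> (K + 1 / (4 * C)) * norm (l - k n)" for n
    proof -
      have "norm (g l - g (k n)) \<le> norm (L (l - k n)) + norm (g l - g (k n) - L (l - k n))"
        by (rule norm_triangle_sub)
      also have "\<dots> \<le> K * norm (l - k n) + 1 / (4 * C) * norm (l - k n)"
        using K[of "l - k n"] d1(2)[of "k n" l] lE inv small[OF dist] small[OF le[of n]] d2 E(1)
        by (intro add_mono) (auto simp: subspace_diff)
      finally show ?thesis by (simp add: algebra_simps)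
    qed
    moreover have "(\<lambda>n. (K + 1 / (4 * C)) * norm (l - k n)) \<longlonglongrightarrow> 0"
    proof (intro tendsto_mult_right_zero tendsto_norm_zero)
      show "(\<lambda>n. l - k n) \<longlonglongrightarrow> 0" using tendsto_diff[OF tendsto_const lim, of l] unfolding l_def by simp
    qed
    ultimately have "(\<lambda>n. g l - g (k n)) \<longlonglongrightarrow> 0"
      by (rule Lim_null_comparison[OF always_eventually, OF allI])
    moreover have "e \<longlonglongrightarrow> 0"
    proof (rule Lim_null_comparison)
      show "\<forall>\<^sub>F n in sequentially. norm (e n) \<le> (3/4)^n * norm (e 0)" using inv by simp
      show "(\<lambda>n. (3/4)^n * norm (e 0)) \<longlonglongrightarrow> 0"
        by (intro tendsto_mult_left_zero LIMSEQ_realpow_zero) auto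
    qed
    ultimately have "(\<lambda>n. (g l - g (k n)) - e n) \<longlonglongrightarrow> 0 - 0" by (intro tendsto_diff)
    then have "g l = w" by (simp add: e_def LIMSEQ_const_iff)
    then show ?thesis using lE dist small[OF dist] d2 by force
  qed
  then show ?thesis using C(1) d(1) by (intro exI[of _ "4 * C"] conjI exI[of _ d]) auto
qed

lemma norm_scaleR_add_le:
  fixes k l :: "'a::real_normed_vector"
  assumes "0 \<le> t" "t \<le> 1" "norm k < d" "norm l < d"
  shows "norm (k + t *\<^sub>R (l - k)) < d"
proof -
  have "k + t *\<^sub>R (l - k) \<in> ball 0 d"
    using convexD[OF convex_ball[of 0 d], of k l "1 - t" t] assms by (simp add: algebra_simps)
  then show ?thesis by simp
qed

text \<open>The first derivative \<open>D\<close> of a smooth map near \<open>0\<close>, with what is needed of it: derivatives along lines,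
local Lipschitz continuity (from the second derivative), and strictness at \<open>0\<close> (from the mean value
inequality).\<close>

lemma smooth_on_derivative:
  fixes f :: "'a::real_normed_vector \<Rightarrow> 'b::real_normed_vector"
  assumes E: "subspace E" and sm: "smooth_on E B f" and r: "{k \<in> E. norm k < r} \<subseteq> B" "0 < r"
  shows "\<exists>D :: 'a \<Rightarrow> 'a \<Rightarrow> 'b.
    (\<forall>k\<in>E. \<forall>v\<in>E. \<forall>s. norm (k + s *\<^sub>R v) < r \<longrightarrow>
      ((\<lambda>h. f (k + h *\<^sub>R v)) has_vector_derivative D (k + s *\<^sub>R v) v) (at s)) \<and>
    (\<forall>k\<in>E. norm k < r \<longrightarrow> (\<exists>K\<ge>0. \<exists>d>0. \<forall>l\<in>E. norm l < r \<longrightarrow> norm (l - k) < d \<longrightarrow>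
      (\<forall>v\<in>E. norm (D l v - D k v) \<le> K * norm (l - k) * norm v))) \<and>
    strict_derivative_at_0 E f (D 0)"
proof -
  obtain D' :: "'a \<Rightarrow> 'a list \<Rightarrow> 'b" where D0: "\<And>x. x \<in> B \<Longrightarrow> D' x [] = f x"
    and ml: "\<And>x n. x \<in> B \<Longrightarrow> bounded_multilinear_on E n (D' x)"
    and dD: "\<And>n x e. x \<in> B \<Longrightarrow> e > 0 \<Longrightarrow> \<exists>d>0. \<forall>y\<in>B. norm (y - x) < d \<longrightarrow>
      (\<forall>vs. set vs \<subseteq> E \<and> length vs = n \<longrightarrow>
        norm (D' y vs - D' x vs - D' x ((y - x) # vs)) \<le> e * norm (y - x) * prod_list (map norm vs))"
    using sm unfolding smooth_on_def by blast
  define D where "D x v = D' x [v]" for x v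
  have inB: "k \<in> E \<Longrightarrow> norm k < r \<Longrightarrow> k \<in> B" for k using r(1) by blast
  have scale: "D x (c *\<^sub>R v) = c *\<^sub>R D x v" if "x \<in> B" "v \<in> E" for x v c
    using ml[OF that(1), of 1] that(2) subspace_0[OF E]
    unfolding bounded_multilinear_on_def D_def by (elim conjE allE[of _ "[]"] allE[of _ "[]"] allE[of _ v] allE[of _ 0] allE[of _ c]) auto
  have deriv: "((\<lambda>h. f (k + h *\<^sub>R v)) has_vector_derivative D (k + s *\<^sub>R v) v) (at s)"
    if k: "k \<in> E" "v \<in> E" "norm (k + s *\<^sub>R v) < r" for k v s
    unfolding has_vector_derivative_def has_derivative_at_alt
  proof (intro conjI bounded_linear_scaleR_left allI impI)
    fix e :: real assume e: "0 < e"
    let ?x = "k + s *\<^sub>R v"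
    have xE: "k + h *\<^sub>R v \<in> E" for h using E k by (simp add: subspace_add subspace_scale)
    have x: "?x \<in> B" using inB[OF xE] k(3) by blast
    define e' where "e' = e / (norm v + 1)"
    have e': "e' > 0" using e by (simp add: e'_def add_nonneg_pos)
    have e'v: "e' * norm v \<le> e"
    proof -
      have "e' * norm v \<le> e' * (norm v + 1)" using e' by (intro mult_left_mono) auto
      also have "\<dots> = e" unfolding e'_def using norm_ge_zero[of v] by (simp add: add_nonneg_eq_0_iff)
      finally show ?thesis .
    qed
    obtain d where d: "d > 0" "\<And>y. y \<in> B \<Longrightarrow> norm (y - ?x) < d \<Longrightarrow> norm (D' y [] - D' ?x [] - D' ?x [y - ?x]) \<le> e' * norm (y - ?x)"
      using dD[OF x e', of 0] by auto
    define d2 where "d2 = min d (r - norm ?x) / (norm v + 1)"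
    have d2: "d2 > 0" using d k(3) by (simp add: d2_def add_nonneg_pos)
    have "norm (f (k + h *\<^sub>R v) - f ?x - (h - s) *\<^sub>R D ?x v) \<le> e * norm (h - s)" if h: "norm (h - s) < d2" for h
    proof -
      have diff: "(k + h *\<^sub>R v) - ?x = (h - s) *\<^sub>R v" by (simp add: algebra_simps)
      have "\<bar>h - s\<bar> * (norm v + 1) < min d (r - norm ?x)"
        using h by (simp add: d2_def pos_less_divide_eq add_nonneg_pos)
      moreover have "\<bar>h - s\<bar> * norm v \<le> \<bar>h - s\<bar> * (norm v + 1)" by (intro mult_left_mono) auto
      ultimately have small: "norm ((h - s) *\<^sub>R v) < d" "norm ((h - s) *\<^sub>R v) < r - norm ?x" by auto
      have "norm (k + h *\<^sub>R v) \<le> norm ?x + norm ((h - s) *\<^sub>R v)"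
        unfolding diff[symmetric] by (rule norm_triangle_sub)
      then have y: "k + h *\<^sub>R v \<in> B" using inB[OF xE] small(2) by simp
      have "norm (D' (k + h *\<^sub>R v) [] - D' ?x [] - D' ?x [(h - s) *\<^sub>R v]) \<le> e' * norm ((h - s) *\<^sub>R v)"
        using d(2)[OF y] small(1) unfolding diff by blast
      also have "D' ?x [(h - s) *\<^sub>R v] = (h - s) *\<^sub>R D ?x v" using scale[OF x k(2)] by (simp add: D_def)
      also have "e' * norm ((h - s) *\<^sub>R v) = (e' * norm v) * norm (h - s)" by simp
      also have "\<dots> \<le> e * norm (h - s)" by (intro mult_right_mono e'v) simp
      finally show ?thesis using D0 x y by simp
    qed
    then show "\<exists>d>0. \<forall>y. norm (y - s) < d \<longrightarrow> norm (f (k + y *\<^sub>R v) - f ?x - (y - s) *\<^sub>R D ?x v) \<le> e * norm (y - s)"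
      using d2 by blast
  qed
  have cont: "\<exists>K\<ge>0. \<exists>d>0. \<forall>l\<in>E. norm l < r \<longrightarrow> norm (l - k) < d \<longrightarrow>
      (\<forall>v\<in>E. norm (D l v - D k v) \<le> K * norm (l - k) * norm v)" if k: "k \<in> E" "norm k < r" for k
  proof -
    have kB: "k \<in> B" using inB k by blast
    obtain K where K: "\<And>vs. set vs \<subseteq> E \<Longrightarrow> length vs = 2 \<Longrightarrow> norm (D' k vs) \<le> K * prod_list (map norm vs)"
      using ml[OF kB, of 2, unfolded bounded_multilinear_on_def, THEN conjunct2] by metis
    obtain d where d: "d > 0" "\<And>y vs. y \<in> B \<Longrightarrow> norm (y - k) < d \<Longrightarrow> set vs \<subseteq> E \<Longrightarrow> length vs = 1 \<Longrightarrow>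
        norm (D' y vs - D' k vs - D' k ((y - k) # vs)) \<le> norm (y - k) * prod_list (map norm vs)"
      using dD[OF kB zero_less_one, of 1] by auto
    have "norm (D l v - D k v) \<le> (\<bar>K\<bar> + 1) * norm (l - k) * norm v"
      if l: "l \<in> E" "norm l < r" "norm (l - k) < d" "v \<in> E" for l v
    proof -
      have "norm (D l v - D k v) \<le> norm (D' k [l - k, v]) + norm (D l v - D k v - D' k [l - k, v])"
        by (rule norm_triangle_sub)
      also have "\<dots> \<le> K * (norm (l - k) * norm v) + norm (l - k) * norm v"
        using K[of "[l - k, v]"] d(2)[of l "[v]"] l inB k subspace_diff[OF E, of l k]
        by (intro add_mono) (auto simp: D_def)
      also have "\<dots> \<le> \<bar>K\<bar> * (norm (l - k) * norm v) + norm (l - k) * norm v"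
        by (intro add_right_mono mult_right_mono) auto
      finally show ?thesis by (simp add: algebra_simps)
    qed
    then show ?thesis using d(1) by (intro exI[of _ "\<bar>K\<bar> + 1"] conjI exI[of _ d]) auto
  qed
  have "strict_derivative_at_0 E f (D 0)"
    unfolding strict_derivative_at_0_def
  proof (intro allI impI)
    fix e :: real assume e: "0 < e"
    obtain K d where K: "K \<ge> 0" "d > 0" "\<And>l v. l \<in> E \<Longrightarrow> norm l < r \<Longrightarrow> norm l < d \<Longrightarrow> v \<in> E \<Longrightarrow>
        norm (D l v - D 0 v) \<le> K * norm l * norm v"
      using cont[of 0] subspace_0[OF E] r(2) by auto
    define d' where "d' = min (min r d) (e / (3 * K + 1))"
    have d': "d' > 0" "d' \<le> r" "d' \<le> d" using r(2) K e by (auto simp: d'_def add_nonneg_pos)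
    have "3 * K * d' \<le> e"
    proof -
      have "3 * K * d' \<le> (3 * K + 1) * (e / (3 * K + 1))"
        using K(1) d'(1) by (intro mult_mono) (auto simp: d'_def)
      then show ?thesis using K(1) by simp
    qed
    have D0': "norm (D l v - D 0 v) \<le> K * d' * norm v" if "l \<in> E" "norm l < d'" "v \<in> E" for l v
    proof -
      have "norm (D l v - D 0 v) \<le> K * norm l * norm v" using K(3) that d' by simp
      also have "\<dots> \<le> K * d' * norm v" using K(1) that by (intro mult_right_mono mult_left_mono) auto
      finally show ?thesis .
    qed
    have "norm (f l - f k - D 0 (l - k)) \<le> e * norm (l - k)"
      if kl: "k \<in> E" "l \<in> E" "norm k < d'" "norm l < d'" for k l
    proof -
      have v: "l - k \<in> E" using kl E subspace_diff by blast
      have seg: "k + t *\<^sub>R (l - k) \<in> E" "norm (k + t *\<^sub>R (l - k)) < d'" if "t \<in> {0..1}" for t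
        using norm_scaleR_add_le[of t k d' l] that kl v E by (auto simp: subspace_add subspace_scale)
      have near: "norm (D (k + t *\<^sub>R (l - k)) (l - k) - D (k + 0 *\<^sub>R (l - k)) (l - k)) \<le> 2 * K * d' * norm (l - k)"
        if t: "t \<in> {0..1}" for t
      proof -
        have "norm (D (k + t *\<^sub>R (l - k)) (l - k) - D (k + 0 *\<^sub>R (l - k)) (l - k)) \<le>
          norm (D (k + t *\<^sub>R (l - k)) (l - k) - D 0 (l - k)) + norm (D (k + 0 *\<^sub>R (l - k)) (l - k) - D 0 (l - k))"
          using norm_triangle_ineq4[of "D (k + t *\<^sub>R (l - k)) (l - k) - D 0 (l - k)"
              "D (k + 0 *\<^sub>R (l - k)) (l - k) - D 0 (l - k)"] by simp
        also have "\<dots> \<le> K * d' * norm (l - k) + K * d' * norm (l - k)"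
          using t by (intro add_mono D0' seg v) auto
        finally show ?thesis by simp
      qed
      have "norm (f (k + 1 *\<^sub>R (l - k)) - f (k + 0 *\<^sub>R (l - k)) - (1 - 0) *\<^sub>R D (k + 0 *\<^sub>R (l - k)) (l - k))
          \<le> norm (1 - 0 :: real) * (2 * K * d' * norm (l - k))"
      proof (rule vector_differentiable_bound_linearization[where S = "{0..1}" and
            f' = "\<lambda>t. D (k + t *\<^sub>R (l - k)) (l - k)"])
        show "((\<lambda>h. f (k + h *\<^sub>R (l - k))) has_vector_derivative D (k + t *\<^sub>R (l - k)) (l - k)) (at t within {0..1})"
          if "t \<in> {0..1}" for t
          using deriv[OF kl(1) v, of t] seg(2)[OF that] d'(2) by (auto intro: has_vector_derivative_at_within)
      qed (use near in \<open>auto simp: closed_segment_eq_real_ivl\<close>)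
      then have 1: "norm (f l - f k - D k (l - k)) \<le> 2 * K * d' * norm (l - k)" by simp
      have "f l - f k - D 0 (l - k) = (f l - f k - D k (l - k)) + (D k (l - k) - D 0 (l - k))" by simp
      then have "norm (f l - f k - D 0 (l - k)) \<le> norm (f l - f k - D k (l - k)) + norm (D k (l - k) - D 0 (l - k))"
        by (metis norm_triangle_ineq)
      also have "\<dots> \<le> 2 * K * d' * norm (l - k) + K * d' * norm (l - k)"
        using 1 D0'[OF kl(1,3) v] by simp
      also have "\<dots> = (3 * K * d') * norm (l - k)" by simp
      also have "\<dots> \<le> e * norm (l - k)" by (intro mult_right_mono \<open>3 * K * d' \<le> e\<close>) simp
      finally show ?thesis .
    qed
    then show "\<exists>d>0. \<forall>k\<in>E. \<forall>l\<in>E. norm k < d \<longrightarrow> norm l < d \<longrightarrow>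
       norm (f l - f k - D 0 (l - k)) \<le> e * norm (l - k)" using d'(1) by blast
  qed
  then show ?thesis using deriv cont by (intro exI[of _ D]) blast
qed

lemma frechet_deriv_on_directional:
  fixes f :: "'a::real_normed_vector \<Rightarrow> 'b::real_normed_vector"
  assumes E: "subspace E" and L: "frechet_deriv_on E f L 0" and v: "v \<in> E"
  shows "((\<lambda>h. f (h *\<^sub>R v)) has_vector_derivative L v) (at 0)"
proof (cases "v = 0")
  case True
  have "L (0 *\<^sub>R 0) = 0 *\<^sub>R L 0" using L subspace_0[OF E] unfolding frechet_deriv_on_def by blast
  then show ?thesis using True by simp
next
  case False
  have lin: "L (h *\<^sub>R v) = h *\<^sub>R L v" for h using L v unfolding frechet_deriv_on_def by blast
  have lim: "((\<lambda>y. (f y - f 0 - L (y - 0)) /\<^sub>R norm (y - 0)) \<longlongrightarrow> 0) (at 0 within E)"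
    using L unfolding frechet_deriv_on_def by blast
  have "filterlim (\<lambda>h. h *\<^sub>R v) (at 0 within E) (at 0)"
    unfolding filterlim_at using v False E
    by (auto intro!: tendsto_eq_intros simp: eventually_at_filter subspace_scale)
  from filterlim_compose[OF lim this]
  have "((\<lambda>h. (f (h *\<^sub>R v) - f 0 - h *\<^sub>R L v) /\<^sub>R (\<bar>h\<bar> * norm v)) \<longlongrightarrow> 0) (at 0)" by (simp add: lin)
  from tendsto_scaleR[OF tendsto_const this, of "norm v"]
  have "((\<lambda>h. (f (h *\<^sub>R v) - f 0 - h *\<^sub>R L v) /\<^sub>R \<bar>h\<bar>) \<longlongrightarrow> 0) (at 0)"
    using False by (simp add: field_simps)
  from tendsto_norm_zero[OF this] show ?thesis
    unfolding has_vector_derivative_def has_derivative_at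
    by (simp add: bounded_linear_scaleR_left divide_inverse mult.commute)
qed

section \<open>Increments of functions and lower integrals of derivates\<close>

text \<open>The upper bilateral derivate of \<open>g\<close> at \<open>t\<close> is at most \<open>r\<close>.\<close>

definition upper_derivate_le :: "(real \<Rightarrow> real) \<Rightarrow> real \<Rightarrow> real \<Rightarrow> bool" where
  "upper_derivate_le g t r \<longleftrightarrow> (\<forall>e>0. \<forall>\<^sub>F s in at t. (g s - g t) / (s - t) \<le> r + e)"

text \<open>The positive part of the upper bilateral derivate.\<close>

definition upper_derivate :: "(real \<Rightarrow> real) \<Rightarrow> real \<Rightarrow> real" where
  "upper_derivate g t = Inf {r. 0 \<le> r \<and> upper_derivate_le g t r}"

lemma upper_derivate_nonneg: "\<exists>r\<ge>0. upper_derivate_le g t r \<Longrightarrow> 0 \<le> upper_derivate g t"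
  unfolding upper_derivate_def by (rule cInf_greatest) auto

lemma upper_derivate_lower:
  "0 \<le> r \<Longrightarrow> upper_derivate_le g t r \<Longrightarrow> upper_derivate g t \<le> r"
  unfolding upper_derivate_def by (rule cInf_lower) (auto intro!: bdd_belowI[of _ 0])

lemma upper_derivate_le_upper_derivate:
  assumes "\<exists>r\<ge>0. upper_derivate_le g t r"
  shows "upper_derivate_le g t (upper_derivate g t)"
  unfolding upper_derivate_le_def
proof (intro allI impI)
  fix e :: real assume e: "0 < e"
  obtain r where r: "0 \<le> r" "upper_derivate_le g t r" "r < upper_derivate g t + e/2"
    using cInf_lessD[of "{r. 0 \<le> r \<and> upper_derivate_le g t r}" "upper_derivate g t + e/2"] assms e
    unfolding upper_derivate_def by auto
  have "\<forall>\<^sub>F s in at t. (g s - g t) / (s - t) \<le> r + e/2"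
    using r(2) e unfolding upper_derivate_le_def by (simp add: half_gt_zero)
  then show "\<forall>\<^sub>F s in at t. (g s - g t) / (s - t) \<le> upper_derivate g t + e"
    by (rule eventually_mono) (use r(3) in linarith)
qed

text \<open>For a fixed scale and a fixed bound \<open>q\<close>, the points at which all difference quotients of that scale are
at most \<open>q\<close> form a relatively closed set, as \<open>g\<close> is continuous; countably many such sets describe
the sublevel sets of the derivate.\<close>

lemma upper_derivate_measurable:
  assumes cont: "continuous_on {a<..<b} g"
    and fin: "\<And>t. a < t \<Longrightarrow> t < b \<Longrightarrow> \<exists>r\<ge>0. upper_derivate_le g t r"
  shows "(\<lambda>t. if t \<in> {a<..<b} then upper_derivate g t else 0) \<in> borel_measurable borel"
proof -
  define E where "E q n = {t\<in>{a<..<b}. \<forall>s\<in>{a<..<b}. s \<noteq> t \<and> \<bar>s - t\<bar> < 1 / real (Suc n) \<longrightarrow>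
      (g s - g t) / (s - t) \<le> q}" for q n
  have E: "E q n \<in> sets borel" for q n
  proof -
    define W where "W s = {t \<in> ({a<..<b} - {s}) \<inter> {s - 1 / real (Suc n)<..<s + 1 / real (Suc n)}. 
       (g s - g t) / (s - t) \<in> {q<..}}" for s
    have "open (W s)" for s
      unfolding W_def
      unfolding Collect_conj_eq Collect_mem_eq vimage_def[symmetric]
      by (rule continuous_open_preimage) (auto intro!: continuous_intros continuous_on_subset[OF cont])
    then have "open (\<Union>s\<in>{a<..<b}. W s)" by blast
    moreover have "E q n = {a<..<b} - (\<Union>s\<in>{a<..<b}. W s)"
      unfolding E_def W_def by (auto simp: abs_less_iff not_le)
    ultimately show ?thesis by (simp add: sets.Diff)
  qed
  have less: "upper_derivate g t < c \<longleftrightarrow> (\<exists>q\<in>\<rat> \<inter> {0..<c}. \<exists>n. t \<in> E q n)"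
    if t: "a < t" "t < b" for t c
  proof
    assume "upper_derivate g t < c"
    then obtain q where q: "q \<in> \<rat>" "upper_derivate g t < q" "q < c"
      using Rats_dense_in_real by blast
    have "\<forall>\<^sub>F s in at t. (g s - g t) / (s - t) \<le> upper_derivate g t + (q - upper_derivate g t)"
      using upper_derivate_le_upper_derivate[OF fin[OF t]] q(2)
      unfolding upper_derivate_le_def by (metis diff_gt_0_iff_gt)
    then obtain d where d: "d > 0" "\<And>s. s \<noteq> t \<Longrightarrow> \<bar>s - t\<bar> < d \<Longrightarrow> (g s - g t) / (s - t) \<le> q"
      unfolding eventually_at dist_real_def by auto
    obtain n where n: "1 / real (Suc n) < d" using nat_approx_posE[OF d(1)] by auto
    have "t \<in> E q n" unfolding E_def using t d(2) n by force
    then show "\<exists>q\<in>\<rat> \<inter> {0..<c}. \<exists>n. t \<in> E q n"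
      using q upper_derivate_nonneg[OF fin[OF t]] by (intro bexI[of _ q] exI[of _ n]) auto
  next
    assume "\<exists>q\<in>\<rat> \<inter> {0..<c}. \<exists>n. t \<in> E q n"
    then obtain q n where q: "0 \<le> q" "q < c" "t \<in> E q n" by auto
    have "\<forall>\<^sub>F s in at t. s \<in> {a<..<b} \<and> s \<noteq> t \<and> \<bar>s - t\<bar> < 1 / real (Suc n)"
      unfolding eventually_at dist_real_def
      using t by (intro exI[of _ "min (1 / real (Suc n)) (min (t - a) (b - t))"]) auto
    then have "upper_derivate_le g t q"
      unfolding upper_derivate_le_def
      by (intro allI impI, elim eventually_mono) (use q in \<open>fastforce simp: E_def\<close>)
    then show "upper_derivate g t < c" using upper_derivate_lower q by force
  qed
  show ?thesis
  proof (rule borel_measurableI_less)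
    fix c :: real
    let ?A = "(\<Union>q\<in>\<rat> \<inter> {0..<c}. \<Union>n. E q n) \<union> (if 0 < c then - {a<..<b} else {})"
    have "{x \<in> space borel. (if x \<in> {a<..<b} then upper_derivate g x else 0) < c} = ?A"
    proof (rule set_eqI)
      fix t
      have "t \<in> E q n \<Longrightarrow> t \<in> {a<..<b}" for q n unfolding E_def by blast
      then show "t \<in> {x \<in> space borel. (if x \<in> {a<..<b} then upper_derivate g x else 0) < c} \<longleftrightarrow> t \<in> ?A"
        by (cases "t \<in> {a<..<b}") (auto simp: less)
    qed
    moreover have "?A \<in> sets borel"
      using E countable_rat by (intro sets.Un sets.countable_UN' sets.countable_UN) auto
    ultimately show "{x \<in> space borel. (if x \<in> {a<..<b} then upper_derivate g x else 0) < c} \<in> sets borel"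
      by simp
  qed
qed

text \<open>In a tagged partition fine enough for the bound on difference quotients at each tag (the straddle
lemma), the increments of \<open>g\<close> are bounded by the terms of a Riemann sum of \<open>m\<close>. The Henstock-Kurzweil
integral lets the fineness depend on the tag, which is why the bounds need not be uniform in \<open>t\<close>.\<close>

lemma increment_le_integral_upper_derivate:
  fixes g m :: "real \<Rightarrow> real"
  assumes ab: "a \<le> b"
    and m: "\<And>t. t \<in> {a..b} \<Longrightarrow> upper_derivate_le g t (m t)"
    and int: "(m has_integral I) {a..b}"
  shows "g b - g a \<le> I"
proof (rule field_le_epsilon)
  fix e :: real assume e: "0 < e"
  define e' where "e' = e / (1 + (b - a))"
  have e': "0 < e'" "e' * (b - a) + e' = e" using ab e 
    by (auto simp: e'_def add_pos_nonneg divide_simps) (simp add: algebra_simps)?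
  obtain \<gamma> where \<gamma>: "gauge \<gamma>" and
    \<gamma>I: "\<And>p. p tagged_division_of {a..b} \<Longrightarrow> \<gamma> fine p \<Longrightarrow> norm ((\<Sum>(x,k)\<in>p. measure lborel k *\<^sub>R m x) - I) < e'"
    using int[unfolded has_integral_real] e'(1) by metis
  have "\<exists>d>0. \<forall>s. \<bar>s - t\<bar> < d \<longrightarrow> s \<noteq> t \<longrightarrow> (g s - g t) / (s - t) \<le> m t + e'" if "t \<in> {a..b}" for t
    using m[OF that] e'(1) unfolding upper_derivate_le_def eventually_at dist_real_def by simp meson
  then obtain d where d: "\<And>t. t \<in> {a..b} \<Longrightarrow> d t > 0"
    "\<And>t s. t \<in> {a..b} \<Longrightarrow> \<bar>s - t\<bar> < d t \<Longrightarrow> s \<noteq> t \<Longrightarrow> (g s - g t) / (s - t) \<le> m t + e'"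
    by metis
  define \<beta> where "\<beta> t = \<gamma> t \<inter> ball t (if t \<in> {a..b} then d t else 1)" for t
  have "gauge \<beta>" using \<gamma> d(1) unfolding gauge_def \<beta>_def by auto
  then obtain p where p: "p tagged_division_of {a..b}" "\<beta> fine p"
    using fine_division_exists_real by blast
  have fine: "\<gamma> fine p" using p(2) unfolding fine_def \<beta>_def by blast
  have step: "g (Sup k) - g (Inf k) \<le> measure lborel k *\<^sub>R m x + e' * measure lborel k" if xk: "(x, k) \<in> p" for x k
  proof -
    obtain u v where k: "k = {u..v}" and x: "x \<in> k" and sub: "k \<subseteq> {a..b}"
      using tagged_division_ofD(2-4)[OF p(1) xk] by (metis box_real(2))
    have uv: "u \<le> x" "x \<le> v" using x k by auto
    have xab: "x \<in> {a..b}" using x sub by blast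
    have "k \<subseteq> ball x (d x)" using p(2) xk xab unfolding fine_def \<beta>_def by fastforce
    moreover have "u \<in> k" "v \<in> k" using uv k by auto
    ultimately have "\<bar>u - x\<bar> < d x" "\<bar>v - x\<bar> < d x"
      by (auto simp: dist_real_def abs_minus_commute subset_iff)
    then have "(g u - g x) / (u - x) \<le> m x + e'" if "u \<noteq> x" using d(2)[OF xab] that by auto
    then have 1: "g x - g u \<le> (m x + e') * (x - u)"
      using uv by (cases "u = x") (auto simp: field_simps)
    have "(g v - g x) / (v - x) \<le> m x + e'" if "v \<noteq> x" using d(2)[OF xab] that \<open>\<bar>v - x\<bar> < d x\<close> by auto
    then have 2: "g v - g x \<le> (m x + e') * (v - x)"
      using uv by (cases "v = x") (auto simp: field_simps)
    from 1 2 have "g v - g u \<le> (m x + e') * (v - u)" by (simp add: algebra_simps)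
    then show ?thesis using uv k by (simp add: algebra_simps)
  qed
  have "g b - g a = (\<Sum>(x,k)\<in>p. g (Sup k) - g (Inf k))"
    using additive_tagged_division_1[OF ab p(1), of g] by (rule sym)
  also have "\<dots> \<le> (\<Sum>(x,k)\<in>p. measure lborel k *\<^sub>R m x + e' * measure lborel k)"
    by (rule sum_mono) (use step in auto)
  also have "\<dots> = (\<Sum>(x,k)\<in>p. measure lborel k *\<^sub>R m x) + e' * (\<Sum>(x,k)\<in>p. measure lborel k)"
    by (simp add: sum.distrib sum_distrib_left case_prod_unfold)
  also have "(\<Sum>(x,k)\<in>p. measure lborel k) = b - a"
    using additive_content_tagged_division[of p a b] p(1) ab by simp
  also have "(\<Sum>(x,k)\<in>p. measure lborel k *\<^sub>R m x) \<le> I + e'"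
    using \<gamma>I[OF p(1) fine] by (auto simp: abs_less_iff)
  finally show "g b - g a \<le> I + e" using e'(2) by (simp add: algebra_simps)
qed

text \<open>The function \<open>f\<close> is arbitrary: its nonnegative integral is the supremum over measurable minorants, and
the upper derivate of \<open>g\<close> is one of them.\<close>

lemma increment_le_nn_integral:
  fixes g :: "real \<Rightarrow> real" and f :: "real \<Rightarrow> ennreal"
  assumes ab: "a \<le> b" and cont: "continuous_on {a..b} g"
    and fin: "\<And>t. a < t \<Longrightarrow> t < b \<Longrightarrow> \<exists>r\<ge>0. upper_derivate_le g t r"
    and le: "\<And>t r. a < t \<Longrightarrow> t < b \<Longrightarrow> 0 \<le> r \<Longrightarrow> f t < ennreal r \<Longrightarrow> upper_derivate_le g t r"
  shows "ennreal (g b - g a) \<le> (\<integral>\<^sup>+t\<in>{a..b}. f t \<partial>lborel)"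
proof (cases "a = b \<or> (\<integral>\<^sup>+t\<in>{a..b}. f t \<partial>lborel) = \<infinity>")
  case True
  then show ?thesis by auto
next
  case False
  then have ab: "a < b" and F: "(\<integral>\<^sup>+t\<in>{a..b}. f t \<partial>lborel) < \<infinity>" using ab by (auto simp: less_top)
  define m where "m t = (if t \<in> {a<..<b} then upper_derivate g t else 0)" for t
  have mm: "m \<in> borel_measurable borel"
    unfolding m_def using upper_derivate_measurable fin cont
    by (meson continuous_on_subset greaterThanLessThan_subseteq_atLeastAtMost_iff order_refl)
  have m0: "0 \<le> m t" for t using upper_derivate_nonneg fin unfolding m_def by auto
  have mf: "ennreal (m t) \<le> f t" if t: "a < t" "t < b" for t
  proof (rule ccontr)
    assume "\<not> ennreal (m t) \<le> f t"
    then have "f t < ennreal (m t)" by simp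
    then obtain r where r: "f t < ennreal r" "ennreal r < ennreal (m t)" "0 \<le> r"
      using dense by (metis ennreal_cases infinity_ennreal_def not_less_iff_gr_or_eq top_greatest top.not_eq_extremum)
    have "upper_derivate g t \<le> r" using le[OF t r(3) r(1)] r(3) upper_derivate_lower by auto
    then show False using r t unfolding m_def by (auto simp: ennreal_less_iff)
  qed
  define I where "I = enn2real (\<integral>\<^sup>+t\<in>{a..b}. f t \<partial>lborel)"
  have I: "ennreal I = (\<integral>\<^sup>+t\<in>{a..b}. f t \<partial>lborel)" using F unfolding I_def by simp
  have inner: "g v - g u \<le> I" if uv: "a < u" "u \<le> v" "v < b" for u v
  proof -
    let ?h = "\<lambda>t. if t \<in> {u..v} then m t else 0"
    have *: "(\<integral>\<^sup>+t. ennreal (?h t) \<partial>lborel) \<le> ennreal I"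
      unfolding I using mf uv by (intro nn_integral_mono) (auto simp: indicator_def)
    then obtain J where J: "(\<integral>\<^sup>+t. ennreal (?h t) \<partial>lborel) = ennreal J" "0 \<le> J" "J \<le> I"
      using ennreal_le_iff[of I] by (cases "\<integral>\<^sup>+t. ennreal (?h t) \<partial>lborel") (auto simp: I_def top_unique)
    have "(?h has_integral J) UNIV"
      by (rule nn_integral_has_integral[OF _ _ J(1,2)]) (use mm m0 in auto)
    then have "(m has_integral J) {u..v}"
      using has_integral_restrict_UNIV by blast
    then have "g v - g u \<le> J"
      using uv upper_derivate_le_upper_derivate fin
      by (intro increment_le_integral_upper_derivate[of u v g m J]) (auto simp: m_def)
    then show ?thesis using J by simp
  qed
  define c where "c n = (b - a) / (2 * real (Suc n))" for n
  have c0: "c \<longlonglongrightarrow> 0"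
    unfolding c_def using tendsto_mult[OF tendsto_const[of "(b - a) / 2"] LIMSEQ_Suc[OF lim_inverse_n]]
    by (simp add: field_simps)
  have c: "0 < c n" "c n \<le> (b - a) / 2" for n
    using ab by (auto simp: c_def field_simps intro!: mult_right_mono)
  \<comment> \<open>the derivate is controlled in the open interval only, so the end points are reached by continuity\<close>
  have "(\<lambda>n. g (b - c n) - g (a + c n)) \<longlonglongrightarrow> g b - g a"
  proof (intro tendsto_diff)
    have "(\<lambda>n. b - c n) \<longlonglongrightarrow> b" "(\<lambda>n. a + c n) \<longlonglongrightarrow> a" using c0 by (auto intro!: tendsto_eq_intros)
    moreover have "b - c n \<in> {a..b}" "a + c n \<in> {a..b}" for n using c[of n] ab by auto
    ultimately show "(\<lambda>n. g (b - c n)) \<longlonglongrightarrow> g b" "(\<lambda>n. g (a + c n)) \<longlonglongrightarrow> g a"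
      using ab by (auto intro!: continuous_on_tendsto_compose[OF cont])
  qed
  moreover have "g (b - c n) - g (a + c n) \<le> I" for n
    using c[of n] by (intro inner) auto
  ultimately have "g b - g a \<le> I" by (meson LIMSEQ_le_const2)
  then show ?thesis unfolding I[symmetric] by (simp add: ennreal_leI)
qed

text \<open>Without measurability of \<open>f\<close> the integral is only a supremum over simple minorants; minorants on two
adjacent intervals add up to a minorant on their union, up to the common end point.\<close>

lemma nn_integral_adjacent_intervals_le:
  fixes f :: "real \<Rightarrow> ennreal"
  assumes "a \<le> b" "b \<le> c"
  shows "(\<integral>\<^sup>+t\<in>{a..b}. f t \<partial>lborel) + (\<integral>\<^sup>+t\<in>{b..c}. f t \<partial>lborel) \<le> (\<integral>\<^sup>+t\<in>{a..c}. f t \<partial>lborel)"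
proof -
  let ?h = "\<lambda>t. f t * indicator {a..b} t" and ?k = "\<lambda>t. f t * indicator {b..c} t"
  have "integral\<^sup>N lborel ?h + integral\<^sup>N lborel ?k = 
    (SUP x\<in>{g. simple_function lborel g \<and> g \<le> ?h}. SUP y\<in>{g. simple_function lborel g \<and> g \<le> ?k}.
      integral\<^sup>S lborel x + integral\<^sup>S lborel y)"
    unfolding nn_integral_def
    by (subst ennreal_SUP_add_left[symmetric], force simp: le_fun_def)
       (subst ennreal_SUP_add_right, auto simp: le_fun_def intro!: exI[of _ "\<lambda>_. 0"])
  also have "\<dots> \<le> (\<integral>\<^sup>+t\<in>{a..c}. f t \<partial>lborel)"
  proof (intro SUP_least)
    fix x y assume x: "x \<in> {g. simple_function lborel g \<and> g \<le> ?h}" and y: "y \<in> {g. simple_function lborel g \<and> g \<le> ?k}"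
    have "integral\<^sup>S lborel x + integral\<^sup>S lborel y = (\<integral>\<^sup>+t. x t + y t \<partial>lborel)"
      using x y by (subst nn_integral_add) (auto simp: nn_integral_eq_simple_integral simp del: measurable_lborel2 dest: borel_measurable_simple_function)
    also have "\<dots> \<le> (\<integral>\<^sup>+t\<in>{a..c}. f t \<partial>lborel)"
    proof (rule nn_integral_mono_AE)
      have "x t + y t \<le> f t * indicator {a..c} t" if "t \<noteq> b" for t
      proof -
        have "x t \<le> f t * indicator {a..b} t" "y t \<le> f t * indicator {b..c} t" using x y by (auto simp: le_fun_def)
        then show ?thesis using that assms by (cases "t \<le> b") (auto simp: indicator_def split: if_splits)
      qed
      then show "AE t in lborel. x t + y t \<le> f t * indicator {a..c} t"
        using AE_lborel_singleton[of b] by auto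
    qed
    finally show "integral\<^sup>S lborel x + integral\<^sup>S lborel y \<le> (\<integral>\<^sup>+t\<in>{a..c}. f t \<partial>lborel)" .
  qed
  finally show ?thesis .
qed

section \<open>Orbit maps in charts\<close>

lemma bounded_linear_onto_cong:
  assumes L: "bounded_linear_onto E F L" and E: "subspace E" and eq: "\<And>v. v \<in> E \<Longrightarrow> L' v = L v"
  shows "bounded_linear_onto E F L'"
proof -
  have "L' ` E = L ` E" using eq by (rule image_cong[OF refl])
  then show ?thesis
    using L unfolding bounded_linear_onto_def by (simp add: eq subspace_add[OF E] subspace_scale[OF E])
qed

lemma smooth_on_cong:
  assumes "smooth_on E B f" "\<And>x. x \<in> B \<Longrightarrow> f' x = f x"
  shows "smooth_on E B f'"
  using assms(1) unfolding smooth_on_def by (elim exE, intro exI) (simp add: assms(2))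

lemma frechet_deriv_on_cong:
  assumes L: "frechet_deriv_on E f L x" and "x \<in> E" and r: "0 < r" and eq: "\<And>y. y \<in> E \<Longrightarrow> norm (y - x) < r \<Longrightarrow> f' y = f y"
  shows "frechet_deriv_on E f' L x"
proof -
  have "\<forall>\<^sub>F y in at x within E. (f y - f x - L (y - x)) /\<^sub>R norm (y - x) = (f' y - f' x - L (y - x)) /\<^sub>R norm (y - x)"
    unfolding eventually_at using r eq[OF \<open>x \<in> E\<close>] eq by (intro exI[of _ r]) (auto simp: dist_norm)
  from tendsto_cong[OF this] show ?thesis using L unfolding frechet_deriv_on_def by simp
qed

locale homogeneous_space =
  fixes M :: "('h::complex_hilbert \<Rightarrow>\<^sub>L 'h) set" and \<tau> :: "('h \<Rightarrow>\<^sub>L 'h) \<Rightarrow> complex"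
    and act :: "('h \<Rightarrow>\<^sub>L 'h) \<Rightarrow> 'x \<Rightarrow> 'x" and N :: "('x, 'e::banach) bmanifold" and p :: real
  assumes M: "von_neumann_algebra M" and \<tau>: "faithful_normal_tracial_state M \<tau>"
    and hom: "smooth_homogeneous_space M act N" and p: "1 \<le> p"
begin

abbreviation "E \<equiv> skew_hermitian M"
abbreviation "X \<equiv> topspace (mtop N)"
abbreviation "U \<equiv> unitary_group M"

lemma act_id: "x \<in> X \<Longrightarrow> act id_blinfun x = x"
  and act_compose: "u \<in> U \<Longrightarrow> v \<in> U \<Longrightarrow> x \<in> X \<Longrightarrow> act (u o\<^sub>L v) x = act u (act v x)"
  and manifold: "banach_manifold N"
  and orbit_submersion: "x \<in> X \<Longrightarrow> smooth_submersion (unitary_manifold M) N (\<lambda>u. act u x)"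
  using hom unfolding smooth_homogeneous_space_def by blast+

lemma orbit_continuous: "x \<in> X \<Longrightarrow> continuous_map (top_of_set U) (mtop N) (\<lambda>u. act u x)"
  using orbit_submersion unfolding smooth_submersion_def smooth_map_def unitary_manifold_def by auto

lemma act_in: "u \<in> U \<Longrightarrow> x \<in> X \<Longrightarrow> act u x \<in> X"
  using orbit_continuous unfolding continuous_map_def by auto

lemma E_subspace: "subspace E" and E_closed: "closed E"
  using skew_hermitian_subspace[OF M] skew_hermitian_closed[OF M] by auto

lemma model_subspace: "subspace (model N)" and model_closed: "closed (model N)"
  using manifold unfolding banach_manifold_def by auto

lemma E_zero: "0 \<in> E" and E_scale: "z \<in> E \<Longrightarrow> c *\<^sub>R z \<in> E" and E_neg: "z \<in> E \<Longrightarrow> - z \<in> E"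
  using E_subspace subspace_0 subspace_scale subspace_neg by blast+

lemma exp_U: "z \<in> E \<Longrightarrow> op_exp z \<in> U"
  using op_exp_unitary[OF M] .

lemma chart:
  assumes "(W, \<psi>) \<in> atlas N"
  shows "openin (mtop N) W" "W \<subseteq> X" "\<psi> ` W \<subseteq> model N" "inj_on \<psi> W"
    "continuous_map (subtopology (mtop N) W) euclidean \<psi>"
proof -
  have c: "openin (mtop N) W" "openin (top_of_set (model N)) (\<psi> ` W)"
    "homeomorphic_map (subtopology (mtop N) W) (top_of_set (\<psi> ` W)) \<psi>"
    using manifold assms unfolding banach_manifold_def is_chart_def by auto
  then show "openin (mtop N) W" "W \<subseteq> X" "\<psi> ` W \<subseteq> model N" using openin_subset by fastforce+
  have "topspace (subtopology (mtop N) W) = W" using c(1) openin_subset by fastforce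
  then show "inj_on \<psi> W" using homeomorphic_imp_injective_map[OF c(3)] by simp
  show "continuous_map (subtopology (mtop N) W) euclidean \<psi>"
    using homeomorphic_imp_continuous_map[OF c(3)] continuous_map_in_subtopology by blast
qed

lemma chart_exists: "y \<in> X \<Longrightarrow> \<exists>W \<psi>. (W, \<psi>) \<in> atlas N \<and> y \<in> W"
  using manifold unfolding banach_manifold_def by (metis (no_types, lifting) UnionE imageE prod.collapse)

lemma identity_chart:
  "(op_exp ` exp_ball M, inv_into (exp_ball M) op_exp) \<in> atlas (unitary_manifold M)"
  using id_unitary[OF M] unfolding unitary_manifold_def by (force simp: image_iff)

lemma identity_chart_apply:
  assumes k: "k \<in> exp_ball M"
  shows "inv_into (exp_ball M) op_exp (op_exp k) = k"
    "inv_into (op_exp ` exp_ball M) (inv_into (exp_ball M) op_exp) k = op_exp k"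
proof -
  have inj: "inj_on op_exp (exp_ball M)"
    by (rule inj_on_subset[OF inj_on_op_exp]) (auto simp: exp_ball_def)
  show 1: "inv_into (exp_ball M) op_exp (op_exp k) = k" by (rule inv_into_f_f[OF inj k])
  show "inv_into (op_exp ` exp_ball M) (inv_into (exp_ball M) op_exp) k = op_exp k"
    by (rule inv_into_f_eq[OF inj_on_inv_into[OF order_refl]]) (use k 1 in auto)
qed

text \<open>The submersion hypothesis read in the exponential chart at the identity: in a chart \<open>\<psi>\<close> around \<open>y\<close>,
the map \<open>k \<mapsto> \<psi> (exp k \<cdot> y)\<close> has near \<open>0\<close> the derivative \<open>D\<close>, which is strict at \<open>0\<close>, and \<open>D 0\<close> maps the
Lie algebra onto the model space.\<close>

lemma orbit_chart:
  assumes y: "y \<in> X" and c: "(W, \<psi>) \<in> atlas N" and yW: "y \<in> W"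
  shows "\<exists>r D. 0 < r \<and> r \<le> 1 / 2 \<and> (\<forall>k\<in>E. norm k < r \<longrightarrow> act (op_exp k) y \<in> W) \<and>
    (\<forall>v\<in>E. \<forall>s. norm (s *\<^sub>R v) < r \<longrightarrow>
      ((\<lambda>h. \<psi> (act (op_exp (h *\<^sub>R v)) y)) has_vector_derivative D (s *\<^sub>R v) v) (at s)) \<and>
    (\<forall>v\<in>E. ((\<lambda>s. D (s *\<^sub>R v) v) \<longlongrightarrow> D 0 v) (at 0)) \<and>
    strict_derivative_at_0 E (\<lambda>k. \<psi> (act (op_exp k) y)) (D 0) \<and>
    bounded_linear_onto E (model N) (D 0)"
proof -
  let ?g = "\<lambda>k. \<psi> (act (op_exp k) y)"
  let ?V = "op_exp ` exp_ball M" and ?\<phi> = "inv_into (exp_ball M) op_exp"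
  define B where "B = {k \<in> exp_ball M. act (op_exp k) y \<in> W}"
  have B_eq: "?\<phi> ` {u \<in> ?V. act u y \<in> W} = B"
    unfolding B_def using identity_chart_apply(1) by (force simp: image_iff)
  have g_eq: "(\<psi> \<circ> (\<lambda>u. act u y) \<circ> inv_into ?V ?\<phi>) k = ?g k" if "k \<in> exp_ball M" for k
    using identity_chart_apply(2)[OF that] by simp
  have model: "model (unitary_manifold M) = E" by (simp add: unitary_manifold_def)
  have "smooth_on E B (\<psi> \<circ> (\<lambda>u. act u y) \<circ> inv_into ?V ?\<phi>)"
    using orbit_submersion[OF y] identity_chart c unfolding smooth_submersion_def smooth_map_def B_eq[symmetric] model by fast
  then have sm: "smooth_on E B ?g"
    by (rule smooth_on_cong) (use g_eq in \<open>auto simp: B_def\<close>)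
  have "openin (top_of_set U) {u \<in> U. act u y \<in> W}"
    using openin_continuous_map_preimage[OF orbit_continuous[OF y] chart(1)[OF c]] by simp
  moreover have "id_blinfun \<in> {u \<in> U. act u y \<in> W}" using id_unitary[OF M] act_id[OF y] yW by simp
  ultimately obtain e where e: "e > 0" "ball id_blinfun e \<inter> U \<subseteq> {u \<in> U. act u y \<in> W}"
    unfolding openin_contains_ball by blast
  define r where "r = min (1 / 2) (e / 2)"
  have r: "0 < r" "r \<le> 1 / 2" using e(1) by (auto simp: r_def)
  have inW: "act (op_exp k) y \<in> W" if "k \<in> E" "norm k < r" for k
  proof -
    have "norm (op_exp k - id_blinfun) \<le> 2 * norm k" using that(2) by (intro norm_op_exp_minus_id_le) (simp add: r_def)
    also have "\<dots> < e" using that(2) by (simp add: r_def)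
    finally have "op_exp k \<in> ball id_blinfun e \<inter> U" using exp_U[OF that(1)] by (simp add: dist_norm norm_minus_commute)
    then show ?thesis using e(2) by blast
  qed
  have ball: "{k \<in> E. norm k < r} \<subseteq> B" using inW r by (auto simp: B_def exp_ball_def)
  obtain D where D: "\<And>k v s. k \<in> E \<Longrightarrow> v \<in> E \<Longrightarrow> norm (k + s *\<^sub>R v) < r \<Longrightarrow>
      ((\<lambda>h. ?g (k + h *\<^sub>R v)) has_vector_derivative D (k + s *\<^sub>R v) v) (at s)"
    and Dc: "\<And>k. k \<in> E \<Longrightarrow> norm k < r \<Longrightarrow> \<exists>K\<ge>0. \<exists>d>0. \<forall>l\<in>E. norm l < r \<longrightarrow> norm (l - k) < d \<longrightarrow>
      (\<forall>v\<in>E. norm (D l v - D k v) \<le> K * norm (l - k) * norm v)"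
    and Ds: "strict_derivative_at_0 E ?g (D 0)"
    using smooth_on_derivative[OF E_subspace sm ball r(1)] by blast
  have D0: "((\<lambda>h. ?g (h *\<^sub>R v)) has_vector_derivative D (s *\<^sub>R v) v) (at s)"
    if "v \<in> E" "norm (s *\<^sub>R v) < r" for v s
    using D[OF E_zero that(1), of s] that(2) by simp
  have lim: "((\<lambda>s. D (s *\<^sub>R v) v) \<longlongrightarrow> D 0 v) (at 0)" if v: "v \<in> E" for v
  proof -
    obtain K d where K: "d > 0" "\<And>l v. l \<in> E \<Longrightarrow> norm l < r \<Longrightarrow> norm l < d \<Longrightarrow> v \<in> E \<Longrightarrow>
        norm (D l v - D 0 v) \<le> K * norm l * norm v"
      using Dc[OF E_zero] r(1) by auto
    have nlim: "((\<lambda>s. norm (s *\<^sub>R v)) \<longlongrightarrow> 0) (at 0)" by (auto intro!: tendsto_eq_intros)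
    have "\<forall>\<^sub>F s in at 0. norm (s *\<^sub>R v) < min r d" by (rule order_tendstoD(2)[OF nlim]) (use r(1) K(1) in simp)
    then have "\<forall>\<^sub>F s in at 0. norm (D (s *\<^sub>R v) v - D 0 v) \<le> K * norm (s *\<^sub>R v) * norm v"
      by (rule eventually_mono) (rule K(2)[OF E_scale[OF v] _ _ v], simp_all)
    moreover have "((\<lambda>s. K * norm (s *\<^sub>R v) * norm v) \<longlongrightarrow> 0) (at 0)"
      using nlim by (intro tendsto_mult_left_zero tendsto_mult_right_zero)
    ultimately have "((\<lambda>s. D (s *\<^sub>R v) v - D 0 v) \<longlongrightarrow> 0) (at 0)" by (rule Lim_null_comparison)
    then show ?thesis by (rule LIM_zero_cancel)
  qed
  have id_ball: "0 \<in> exp_ball M" using E_zero by (simp add: exp_ball_def)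
  have "\<exists>L. frechet_deriv_on E (\<psi> \<circ> (\<lambda>u. act u y) \<circ> inv_into ?V ?\<phi>) L (?\<phi> (op_exp 0)) \<and>
             L ` E = model N \<and> split_subspace E {v \<in> E. L v = 0}"
    using orbit_submersion[OF y] identity_chart c id_ball yW act_id[OF y]
    unfolding smooth_submersion_def model[symmetric] by fastforce
  then obtain L where L: "frechet_deriv_on E (\<psi> \<circ> (\<lambda>u. act u y) \<circ> inv_into ?V ?\<phi>) L 0" "L ` E = model N"
    unfolding identity_chart_apply(1)[OF id_ball] by blast
  have L': "frechet_deriv_on E ?g L 0"
    by (rule frechet_deriv_on_cong[OF L(1) E_zero, of "1 / 2"]) (use g_eq in \<open>auto simp: exp_ball_def\<close>)
  have "D 0 v = L v" if v: "v \<in> E" for v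
    using vector_derivative_unique_at[OF D0[OF v, of 0] frechet_deriv_on_directional[OF E_subspace L' v]] r(1) by simp
  moreover have "bounded_linear_onto E (model N) L"
    using L' L(2) unfolding frechet_deriv_on_def bounded_linear_onto_def by blast
  ultimately have "bounded_linear_onto E (model N) (D 0)" using bounded_linear_onto_cong E_subspace by metis
  then show ?thesis using r inW D0 lim Ds by blast
qed

end

lemma has_vector_derivative_shift_iff:
  "((\<lambda>x. f (x - s)) has_vector_derivative f') (at t) \<longleftrightarrow> (f has_vector_derivative f') (at (t - s))" for s t :: real
proof
  assume "(f has_vector_derivative f') (at (t - s))"
  moreover have "((\<lambda>x. x - s) has_vector_derivative 1) (at t)"
    by (auto intro!: derivative_eq_intros)
  ultimately show "((\<lambda>x. f (x - s)) has_vector_derivative f') (at t)"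
    using vector_diff_chain_at[of "\<lambda>x. x - s" 1 t f f'] by (simp add: o_def)
next
  assume "((\<lambda>x. f (x - s)) has_vector_derivative f') (at t)"
  moreover have "((\<lambda>x. x + s) has_vector_derivative 1) (at (t - s))"
    by (auto intro!: derivative_eq_intros)
  ultimately show "(f has_vector_derivative f') (at (t - s))"
    using vector_diff_chain_at[of "\<lambda>x. x + s" 1 "t - s" "\<lambda>x. f (x - s)" f'] by (simp add: o_def)
qed

lemma has_vector_derivative_at_eventually:
  fixes f :: "real \<Rightarrow> 'a::real_normed_vector"
  shows "(f has_vector_derivative v) (at t) \<longleftrightarrow>
    (\<forall>e>0. \<forall>\<^sub>F s in at t. norm (f s - f t - (s - t) *\<^sub>R v) \<le> e * \<bar>s - t\<bar>)"
proof -
  have "(\<exists>d>0. \<forall>s. norm (s - t) < d \<longrightarrow> norm (f s - f t - (s - t) *\<^sub>R v) \<le> e * norm (s - t)) \<longleftrightarrow>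
     (\<forall>\<^sub>F s in at t. norm (f s - f t - (s - t) *\<^sub>R v) \<le> e * \<bar>s - t\<bar>)" for e
  proof -
    have "norm (f t - f t - (t - t) *\<^sub>R v) \<le> e * \<bar>t - t\<bar>" by simp
    then show ?thesis unfolding eventually_at dist_real_def real_norm_def by (metis UNIV_I)
  qed
  then show ?thesis
    unfolding has_vector_derivative_def has_derivative_at_alt by (simp add: bounded_linear_scaleR_left)
qed

context homogeneous_space
begin

lemma curve_eventually_in:
  fixes \<gamma> :: "real \<Rightarrow> 'x"
  assumes "continuous_map (top_of_set S) (mtop N) \<gamma>" "t \<in> S" "openin (mtop N) V" "\<gamma> t \<in> V"
  shows "\<forall>\<^sub>F s in at t within S. \<gamma> s \<in> V"
proof -
  have "openin (top_of_set S) {s \<in> S. \<gamma> s \<in> V}"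
    using openin_continuous_map_preimage[OF assms(1,3)] by simp
  then obtain e where "e > 0" "ball t e \<inter> S \<subseteq> {s \<in> S. \<gamma> s \<in> V}"
    using assms(2,4) unfolding openin_contains_ball by blast
  then show ?thesis unfolding eventually_at by (intro exI[of _ e]) (auto simp: dist_commute subset_iff)
qed

lemma curve_tendsto_in_chart:
  fixes \<gamma> :: "real \<Rightarrow> 'x"
  assumes "continuous_map (top_of_set S) (mtop N) \<gamma>" "t \<in> S" and c: "(W, \<psi>) \<in> atlas N" and "\<gamma> t \<in> W"
  shows "((\<lambda>s. \<psi> (\<gamma> s)) \<longlongrightarrow> \<psi> (\<gamma> t)) (at t within S)"
proof (rule topological_tendstoI)
  fix T assume T: "open T" "\<psi> (\<gamma> t) \<in> T"
  have W: "topspace (subtopology (mtop N) W) = W" using chart(2)[OF c] by auto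
  have "openin (subtopology (mtop N) W) {x \<in> W. \<psi> x \<in> T}"
    using openin_continuous_map_preimage[OF chart(5)[OF c], of T] T(1) unfolding W by simp
  then have "openin (mtop N) {x \<in> W. \<psi> x \<in> T}" using openin_trans_full chart(1)[OF c] by blast
  from curve_eventually_in[OF assms(1,2) this] show "\<forall>\<^sub>F s in at t within S. \<psi> (\<gamma> s) \<in> T"
    using T(2) assms(4) by (auto elim: eventually_mono)
qed

text \<open>Metric regularity of the orbit map: a point \<open>y'\<close> near \<open>y\<close> is \<open>exp k \<cdot> y\<close> for some \<open>k\<close> whose distance
to a small first guess \<open>k\<^sub>0\<close> is controlled by the error of that guess in the chart.\<close>

lemma orbit_solutions:
  assumes y: "y \<in> X" and c: "(W, \<psi>) \<in> atlas N" and yW: "y \<in> W"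
  shows "\<exists>C>0. \<exists>d>0. \<forall>k0\<in>E. \<forall>y'\<in>W. norm k0 < d \<longrightarrow> norm (\<psi> y' - \<psi> (act (op_exp k0) y)) < d \<longrightarrow>
     (\<exists>k\<in>E. act (op_exp k) y = y' \<and> norm (k - k0) \<le> C * norm (\<psi> y' - \<psi> (act (op_exp k0) y)))"
proof -
  obtain r and D :: "('h \<Rightarrow>\<^sub>L 'h) \<Rightarrow> ('h \<Rightarrow>\<^sub>L 'h) \<Rightarrow> 'e" where r: "0 < r" and inW: "\<And>k. k \<in> E \<Longrightarrow> norm k < r \<Longrightarrow> act (op_exp k) y \<in> W"
    and Ds: "strict_derivative_at_0 E (\<lambda>k. \<psi> (act (op_exp k) y)) (D 0)"
    and onto: "bounded_linear_onto E (model N) (D 0)"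
    using orbit_chart[OF assms] by blast
  have "\<exists>C>0. \<exists>d>0. \<forall>k0\<in>E. \<forall>w\<in>model N. norm k0 < d \<longrightarrow> norm (w - \<psi> (act (op_exp k0) y)) < d \<longrightarrow>
    (\<exists>k\<in>E. norm k < r \<and> \<psi> (act (op_exp k) y) = w \<and> norm (k - k0) \<le> C * norm (w - \<psi> (act (op_exp k0) y)))"
    by (rule metric_regularity[OF E_subspace E_closed model_subspace model_closed onto r _ Ds])
      (use inW chart(3)[OF c] in blast)
  then obtain C d where C: "C > 0" "d > 0" "\<And>k0 w. k0 \<in> E \<Longrightarrow> w \<in> model N \<Longrightarrow> norm k0 < d \<Longrightarrow>
      norm (w - \<psi> (act (op_exp k0) y)) < d \<Longrightarrow>
    \<exists>k\<in>E. norm k < r \<and> \<psi> (act (op_exp k) y) = w \<and> norm (k - k0) \<le> C * norm (w - \<psi> (act (op_exp k0) y))"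
    by metis
  have "\<exists>k\<in>E. act (op_exp k) y = y' \<and> norm (k - k0) \<le> C * norm (\<psi> y' - \<psi> (act (op_exp k0) y))"
    if k0: "k0 \<in> E" and y': "y' \<in> W" and near: "norm k0 < d" "norm (\<psi> y' - \<psi> (act (op_exp k0) y)) < d" for k0 y'
  proof -
    obtain k where k: "k \<in> E" "norm k < r" "\<psi> (act (op_exp k) y) = \<psi> y'"
      "norm (k - k0) \<le> C * norm (\<psi> y' - \<psi> (act (op_exp k0) y))"
      using C(3)[OF k0 _ near] y' chart(3)[OF c] by blast
    have "act (op_exp k) y = y'" using inj_onD[OF chart(4)[OF c] k(3) inW[OF k(1,2)] y'] .
    then show ?thesis using k by blast
  qed
  then show ?thesis using C(1,2) by blast
qed

text \<open>Continuity of a curve, expressed through the group: \<open>\<gamma> s = exp k \<cdot> \<gamma> t\<close> with small \<open>k\<close>.\<close>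

lemma curve_near_exp:
  fixes \<gamma> :: "real \<Rightarrow> 'x"
  assumes cont: "continuous_map (top_of_set S) (mtop N) \<gamma>" and t: "t \<in> S" and e: "0 < e"
  shows "\<forall>\<^sub>F s in at t within S. \<exists>k\<in>E. act (op_exp k) (\<gamma> t) = \<gamma> s \<and> norm k < e"
proof -
  have y: "\<gamma> t \<in> X" using cont t unfolding continuous_map_def by auto
  obtain W \<psi> where c: "(W, \<psi>) \<in> atlas N" "\<gamma> t \<in> W" using chart_exists[OF y] by blast
  obtain C d where C: "C > 0" "d > 0" "\<And>k0 y'. k0 \<in> E \<Longrightarrow> y' \<in> W \<Longrightarrow> norm k0 < d \<Longrightarrow>
      norm (\<psi> y' - \<psi> (act (op_exp k0) (\<gamma> t))) < d \<Longrightarrow>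
      \<exists>k\<in>E. act (op_exp k) (\<gamma> t) = y' \<and> norm (k - k0) \<le> C * norm (\<psi> y' - \<psi> (act (op_exp k0) (\<gamma> t)))"
    using orbit_solutions[OF y c] by blast
  have C0: "\<exists>k\<in>E. act (op_exp k) (\<gamma> t) = y' \<and> norm k \<le> C * norm (\<psi> y' - \<psi> (\<gamma> t))"
    if "y' \<in> W" "norm (\<psi> y' - \<psi> (\<gamma> t)) < d" for y'
    using C(3)[OF E_zero that(1)] that(2) C(2) act_id[OF y] by simp
  have "((\<lambda>s. norm (\<psi> (\<gamma> s) - \<psi> (\<gamma> t))) \<longlongrightarrow> 0) (at t within S)"
    using tendsto_norm_zero[OF LIM_zero[OF curve_tendsto_in_chart[OF cont t c]]] .
  then have "\<forall>\<^sub>F s in at t within S. norm (\<psi> (\<gamma> s) - \<psi> (\<gamma> t)) < min d (e / C)"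
    by (rule order_tendstoD(2)) (use C e in simp)
  moreover have "\<forall>\<^sub>F s in at t within S. \<gamma> s \<in> W"
    by (rule curve_eventually_in[OF cont t chart(1)[OF c(1)] c(2)])
  ultimately show ?thesis
  proof eventually_elim
    case (elim s)
    then obtain k where k: "k \<in> E" "act (op_exp k) (\<gamma> t) = \<gamma> s" "norm k \<le> C * norm (\<psi> (\<gamma> s) - \<psi> (\<gamma> t))"
      using C0[of "\<gamma> s"] by auto
    have "C * norm (\<psi> (\<gamma> s) - \<psi> (\<gamma> t)) < e" using elim(1) C(1) by (simp add: field_simps)
    then show ?case using k by (intro bexI[of _ k]) auto
  qed
qed

text \<open>Differentiability of a curve, expressed through the group: if \<open>z\<close> lifts the velocity \<open>w\<close> of \<open>\<gamma>\<close> at \<open>t\<close>,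
then \<open>\<gamma> s = exp k \<cdot> \<gamma> t\<close> with \<open>k = (s - t) z + o(s - t)\<close>. The first guess \<open>(s - t) z\<close> misses \<open>\<gamma> s\<close> by
\<open>o(s - t)\<close> in the chart, and metric regularity corrects it by an element of the same order.\<close>

lemma curve_first_order_exp:
  assumes y: "\<gamma> t \<in> X" and c: "(W, \<psi>) \<in> atlas N" and in_W: "\<gamma> t \<in> W" "\<forall>\<^sub>F s in at t. \<gamma> s \<in> W"
    and z: "z \<in> E" and d\<gamma>: "((\<lambda>s. \<psi> (\<gamma> s)) has_vector_derivative w) (at t)"
    and dz: "((\<lambda>h. \<psi> (act (op_exp (h *\<^sub>R z)) (\<gamma> t))) has_vector_derivative w) (at 0)"
    and e: "0 < e"
  shows "\<forall>\<^sub>F s in at t. \<exists>k\<in>E. act (op_exp k) (\<gamma> t) = \<gamma> s \<and> norm (k - (s - t) *\<^sub>R z) \<le> e * \<bar>s - t\<bar>"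
proof -
  obtain C d where C: "C > 0" "d > 0" "\<And>k0 y'. k0 \<in> E \<Longrightarrow> y' \<in> W \<Longrightarrow> norm k0 < d \<Longrightarrow>
      norm (\<psi> y' - \<psi> (act (op_exp k0) (\<gamma> t))) < d \<Longrightarrow>
      \<exists>k\<in>E. act (op_exp k) (\<gamma> t) = y' \<and> norm (k - k0) \<le> C * norm (\<psi> y' - \<psi> (act (op_exp k0) (\<gamma> t)))"
    using orbit_solutions[OF y c in_W(1)] by blast
  have dz': "((\<lambda>s. \<psi> (act (op_exp ((s - t) *\<^sub>R z)) (\<gamma> t))) has_vector_derivative w) (at t)"
    using dz has_vector_derivative_shift_iff[of "\<lambda>h. \<psi> (act (op_exp (h *\<^sub>R z)) (\<gamma> t))" t w t] by simp
  define e1 where "e1 = e / (2 * C)"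
  have e1: "e1 > 0" "C * (2 * e1) = e" using e C(1) by (auto simp: e1_def)
  have "((\<lambda>s. norm ((s - t) *\<^sub>R z)) \<longlongrightarrow> 0) (at t)" "((\<lambda>s. 2 * e1 * \<bar>s - t\<bar>) \<longlongrightarrow> 0) (at t)"
    by (auto intro!: tendsto_eq_intros)
  then have "\<forall>\<^sub>F s in at t. norm ((s - t) *\<^sub>R z) < d" "\<forall>\<^sub>F s in at t. 2 * e1 * \<bar>s - t\<bar> < d"
    using C(2) order_tendstoD(2) by blast+
  moreover have "\<forall>\<^sub>F s in at t. norm (\<psi> (\<gamma> s) - \<psi> (\<gamma> t) - (s - t) *\<^sub>R w) \<le> e1 * \<bar>s - t\<bar>"
    using d\<gamma> e1(1) unfolding has_vector_derivative_at_eventually by blast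
  moreover have "\<forall>\<^sub>F s in at t. norm (\<psi> (act (op_exp ((s - t) *\<^sub>R z)) (\<gamma> t)) - \<psi> (\<gamma> t) - (s - t) *\<^sub>R w) \<le> e1 * \<bar>s - t\<bar>"
    using dz' e1(1) act_id[OF y] unfolding has_vector_derivative_at_eventually by simp
  ultimately show ?thesis using in_W(2)
  proof eventually_elim
    case (elim s)
    let ?a = "\<psi> (\<gamma> s)" and ?b = "\<psi> (act (op_exp ((s - t) *\<^sub>R z)) (\<gamma> t))" and ?l = "\<psi> (\<gamma> t)" and ?w = "(s - t) *\<^sub>R w"
    have "?a - ?b = (?a - ?l - ?w) - (?b - ?l - ?w)" by simp
    then have "norm (?a - ?b) \<le> norm (?a - ?l - ?w) + norm (?b - ?l - ?w)" by (metis norm_triangle_ineq4)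
    then have ab: "norm (?a - ?b) \<le> 2 * e1 * \<bar>s - t\<bar>" using elim(3,4) by simp
    then obtain k where k: "k \<in> E" "act (op_exp k) (\<gamma> t) = \<gamma> s" "norm (k - (s - t) *\<^sub>R z) \<le> C * norm (?a - ?b)"
      using C(3)[OF E_scale[OF z] elim(5) elim(1)] elim(2) by fastforce
    have "C * norm (?a - ?b) \<le> C * (2 * e1 * \<bar>s - t\<bar>)" using ab C(1) by (intro mult_left_mono) auto
    also have "\<dots> = e * \<bar>s - t\<bar>" using e1(2) by (metis mult.assoc)
    finally show ?case using k by (intro bexI[of _ k]) auto
  qed
qed

section \<open>Exponential curves in the homogeneous space\<close>

context
  fixes z y and \<tau>0 :: real and c :: "real \<Rightarrow> 'x"
  assumes z: "z \<in> E" and y: "y \<in> X" and c_def: "c = (\<lambda>s. act (op_exp ((s - \<tau>0) *\<^sub>R z)) y)"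
begin

lemma exp_curve_in: "c s \<in> X"
  unfolding c_def by (intro act_in exp_U E_scale z y)

text \<open>The one-parameter group property makes every point of the curve look like its starting point, so
local statements are needed at parameter \<open>0\<close> only.\<close>

lemma exp_curve_shift: "c t = act (op_exp ((t - s) *\<^sub>R z)) (c s)"
proof -
  have "op_exp ((t - \<tau>0) *\<^sub>R z) = op_exp ((t - s) *\<^sub>R z) o\<^sub>L op_exp ((s - \<tau>0) *\<^sub>R z)"
    using op_exp_add_scaleR[of "t - s" "s - \<tau>0" z] by simp
  then show ?thesis unfolding c_def using act_compose exp_U E_scale[OF z] y by metis
qed

lemma exp_curve_continuous: "continuous_map (top_of_set S) (mtop N) c"
proof -
  have "continuous_on S (\<lambda>s. op_exp ((s - \<tau>0) *\<^sub>R z))"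
    by (rule continuous_on_compose2[OF continuous_op_exp_scaleR[of z]]) (auto intro!: continuous_intros)
  then have "continuous_map (top_of_set S) (top_of_set U) (\<lambda>s. op_exp ((s - \<tau>0) *\<^sub>R z))"
    using exp_U E_scale[OF z] by (auto simp: continuous_map_in_subtopology)
  from continuous_map_compose[OF this orbit_continuous[OF y]] show ?thesis by (simp add: c_def o_def)
qed

lemma exp_curve_derivative:
  assumes chart: "(W, \<psi>) \<in> atlas N" and sW: "c s \<in> W"
  shows "(\<psi> \<circ> c has_vector_derivative vector_derivative (\<psi> \<circ> c) (at s)) (at s)"
    "isCont (\<lambda>t. vector_derivative (\<psi> \<circ> c) (at t)) s"
proof -
  obtain r D where r: "0 < r"
    and D: "\<And>v h. v \<in> E \<Longrightarrow> norm (h *\<^sub>R v) < r \<Longrightarrow>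
      ((\<lambda>h. \<psi> (act (op_exp (h *\<^sub>R v)) (c s))) has_vector_derivative D (h *\<^sub>R v) v) (at h)"
    and Dc: "\<And>v. v \<in> E \<Longrightarrow> ((\<lambda>h. D (h *\<^sub>R v) v) \<longlongrightarrow> D 0 v) (at 0)"
    using orbit_chart[OF exp_curve_in chart sW] by blast
  have der: "(\<psi> \<circ> c has_vector_derivative D ((t - s) *\<^sub>R z) z) (at t)" if "norm ((t - s) *\<^sub>R z) < r" for t
  proof -
    have "\<psi> \<circ> c = (\<lambda>x. \<psi> (act (op_exp ((x - s) *\<^sub>R z)) (c s)))"
      by (intro ext, unfold o_apply, rule arg_cong[where f = \<psi>, OF exp_curve_shift])
    then show ?thesis
      using D[OF z that] has_vector_derivative_shift_iff[of "\<lambda>h. \<psi> (act (op_exp (h *\<^sub>R z)) (c s))" s _ t] by simp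
  qed
  show "(\<psi> \<circ> c has_vector_derivative vector_derivative (\<psi> \<circ> c) (at s)) (at s)"
    using der[of s] r vector_derivative_at by fastforce
  have eq: "vector_derivative (\<psi> \<circ> c) (at t) = D ((t - s) *\<^sub>R z) z" if "norm ((t - s) *\<^sub>R z) < r" for t
    using vector_derivative_at[OF der[OF that]] .
  have "((\<lambda>t. norm ((t - s) *\<^sub>R z)) \<longlongrightarrow> 0) (at s)" by (auto intro!: tendsto_eq_intros)
  then have "\<forall>\<^sub>F t in at s. norm ((t - s) *\<^sub>R z) < r" using order_tendstoD(2) r by blast
  then have ev: "\<forall>\<^sub>F t in at s. D ((t - s) *\<^sub>R z) z = vector_derivative (\<psi> \<circ> c) (at t)"
    by (rule eventually_mono) (use eq in simp)
  have "((\<lambda>t. D ((t - s) *\<^sub>R z) z) \<longlongrightarrow> D 0 z) (at s)"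
    using Dc[OF z] LIM_offset_zero_iff[of s "\<lambda>t. D ((t - s) *\<^sub>R z) z"] by simp
  moreover have "vector_derivative (\<psi> \<circ> c) (at s) = D 0 z" using eq[of s] r by simp
  ultimately show "isCont (\<lambda>t. vector_derivative (\<psi> \<circ> c) (at t)) s"
    unfolding isCont_def using Lim_transform_eventually[OF _ ev] by metis
qed

lemma exp_curve_velocity: "velocity N c s = orbit_differential act N (c s) z"
proof
  fix ch :: "'x set \<times> ('x \<Rightarrow> 'e)"
  have "vector_derivative (snd ch \<circ> c) (at s) = vector_derivative (snd ch \<circ> (\<lambda>h. act (op_exp (h *\<^sub>R z)) (c s))) (at 0)"
  proof -
    have "snd ch \<circ> c = (\<lambda>x. (snd ch \<circ> (\<lambda>h. act (op_exp (h *\<^sub>R z)) (c s))) (x - s))"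
      by (intro ext, unfold o_apply, rule arg_cong[where f = "snd ch", OF exp_curve_shift])
    then show ?thesis unfolding vector_derivative_def
      using has_vector_derivative_shift_iff[of "snd ch \<circ> (\<lambda>h. act (op_exp (h *\<^sub>R z)) (c s))" s _ s] by simp
  qed
  then show "velocity N c s ch = orbit_differential act N (c s) z ch"
    unfolding velocity_def orbit_differential_def using act_id[OF exp_curve_in] by simp
qed

lemma exp_curve_C1:
  assumes "a < b"
  shows "C1_curve_on N c a b"
    "\<And>W \<psi> t. (W, \<psi>) \<in> atlas N \<Longrightarrow> t \<in> {a..b} \<Longrightarrow> c t \<in> W \<Longrightarrow>
      vector_derivative (\<psi> \<circ> c) (at t within {a..b}) = vector_derivative (\<psi> \<circ> c) (at t)"
proof -
  show eq: "vector_derivative (\<psi> \<circ> c) (at t within {a..b}) = vector_derivative (\<psi> \<circ> c) (at t)"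
    if "(W, \<psi>) \<in> atlas N" "t \<in> {a..b}" "c t \<in> W" for W \<psi> t
    using vector_derivative_at_within_ivl[OF exp_curve_derivative(1)[OF that(1,3)]] that(2) assms by simp
  have "continuous_on {t \<in> {a..b}. c t \<in> W} (\<lambda>t. vector_derivative (\<psi> \<circ> c) (at t within {a..b}))"
    if ch: "(W, \<psi>) \<in> atlas N" for W \<psi>
  proof -
    have "continuous_on {t \<in> {a..b}. c t \<in> W} (\<lambda>t. vector_derivative (\<psi> \<circ> c) (at t))"
      using exp_curve_derivative(2)[OF ch] by (intro continuous_at_imp_continuous_on) auto
    then show ?thesis by (rule continuous_on_eq) (use eq[OF ch] in auto)
  qed
  moreover have "(\<psi> \<circ> c) differentiable (at t within {a..b})" if "(W, \<psi>) \<in> atlas N" "c t \<in> W" for W \<psi> t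
    using exp_curve_derivative(1)[OF that] has_vector_derivative_at_within differentiableI_vector by blast
  ultimately show "C1_curve_on N c a b"
    unfolding C1_curve_on_def using exp_curve_continuous by auto
qed

text \<open>Vanishing of the velocity at \<open>s\<close>, expressed through the group instead of charts, so that unitaries
transport it along the curve.\<close>

definition stationary :: "real \<Rightarrow> bool" where
  "stationary s \<longleftrightarrow> (\<forall>e>0. \<forall>\<^sub>F t in at s. \<exists>k\<in>E. act (op_exp k) (c s) = c t \<and> norm k \<le> e * \<bar>t - s\<bar>)"

lemma zero_derivative_imp_stationary:
  assumes ch: "(W, \<psi>) \<in> atlas N" "c s \<in> W" and zero: "vector_derivative (\<psi> \<circ> c) (at s) = 0"
  shows "stationary s"
  unfolding stationary_def
proof (intro allI impI)
  fix e :: real assume e: "0 < e"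
  have "\<forall>\<^sub>F t in at s. c t \<in> W"
    using curve_eventually_in[OF exp_curve_continuous UNIV_I chart(1)[OF ch(1)] ch(2)] .
  moreover have "((\<lambda>t. \<psi> (c t)) has_vector_derivative 0) (at s)"
    using exp_curve_derivative(1)[OF ch] zero by (simp add: o_def)
  ultimately show "\<forall>\<^sub>F t in at s. \<exists>k\<in>E. act (op_exp k) (c s) = c t \<and> norm k \<le> e * \<bar>t - s\<bar>"
    using curve_first_order_exp[where \<gamma> = c and z = 0 and w = 0, OF exp_curve_in ch] E_zero e by simp
qed

text \<open>The unitary \<open>u\<close> that moves \<open>c s\<close> to \<open>c s'\<close> also moves \<open>c (s + h)\<close> to \<open>c (s' + h)\<close>, and it turns the step \<open>k\<close> into
\<open>u k u\<^sup>*\<close>. The size of the step changes by a constant factor at most.\<close>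

lemma stationary_transport:
  assumes st: "stationary s"
  shows "stationary s'"
  unfolding stationary_def
proof (intro allI impI)
  fix e :: real assume e: "0 < e"
  define u where "u = op_exp ((s' - s) *\<^sub>R z)"
  have uU: "u \<in> U" unfolding u_def by (intro exp_U E_scale z)
  then obtain v where v: "v \<in> M" "is_adjoint u v" "v o\<^sub>L u = id_blinfun" "u o\<^sub>L v = id_blinfun" and uM: "u \<in> M"
    unfolding unitary_group_iff[OF M] by blast
  define K where "K = norm u * norm v + 1"
  have K: "K > 0" by (simp add: K_def add_nonneg_pos)
  have "\<forall>\<^sub>F t in at s. \<exists>k\<in>E. act (op_exp k) (c s) = c t \<and> norm k \<le> e / K * \<bar>t - s\<bar>"
    using st divide_pos_pos[OF e K] unfolding stationary_def by blast
  then have "\<forall>\<^sub>F h in at 0. \<exists>k\<in>E. act (op_exp k) (c s) = c (h + s) \<and> norm k \<le> e / K * \<bar>h\<bar>"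
    by (simp add: eventually_at_to_0[of _ s])
  then have "\<forall>\<^sub>F h in at 0. \<exists>k\<in>E. act (op_exp k) (c s') = c (h + s') \<and> norm k \<le> e * \<bar>h\<bar>"
  proof (rule eventually_mono)
    fix h assume "\<exists>k\<in>E. act (op_exp k) (c s) = c (h + s) \<and> norm k \<le> e / K * \<bar>h\<bar>"
    then obtain k where k: "k \<in> E" "act (op_exp k) (c s) = c (h + s)" "norm k \<le> e / K * \<bar>h\<bar>" by blast
    let ?k = "u o\<^sub>L k o\<^sub>L v"
    have kE: "?k \<in> E" by (rule skew_hermitian_conjugate[OF M k(1) uM v(1,2)])
    have cs': "c s' = act u (c s)" using exp_curve_shift[of s' s] by (simp add: u_def)
    have "act (op_exp ?k) (c s') = act (op_exp ?k o\<^sub>L u) (c s)"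
      unfolding cs' using act_compose[OF exp_U[OF kE] uU exp_curve_in] by simp
    also have "op_exp ?k o\<^sub>L u = u o\<^sub>L op_exp k"
      unfolding op_exp_conjugate[OF v(3,4)] by (simp add: blinfun_compose_assoc v(3))
    also have "act (u o\<^sub>L op_exp k) (c s) = act u (c (h + s))"
      using act_compose[OF uU exp_U[OF k(1)] exp_curve_in] k(2) by simp
    also have "\<dots> = c (h + s')" using exp_curve_shift[of "h + s'" "h + s"] by (simp add: u_def)
    finally have "act (op_exp ?k) (c s') = c (h + s')" .
    moreover have "norm ?k \<le> e * \<bar>h\<bar>"
    proof -
      have "norm ?k \<le> norm u * norm k * norm v"
        by (meson norm_blinfun_compose mult_right_mono norm_ge_zero order_trans)
      also have "\<dots> = (norm u * norm v) * norm k" by simp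
      also have "\<dots> \<le> K * (e / K * \<bar>h\<bar>)"
        using k(3) K by (intro mult_mono) (auto simp: K_def)
      also have "\<dots> = e * \<bar>h\<bar>" using K by simp
      finally show ?thesis .
    qed
    ultimately show "\<exists>k\<in>E. act (op_exp k) (c s') = c (h + s') \<and> norm k \<le> e * \<bar>h\<bar>" using kE by blast
  qed
  then show "\<forall>\<^sub>F t in at s'. \<exists>k\<in>E. act (op_exp k) (c s') = c t \<and> norm k \<le> e * \<bar>t - s'\<bar>"
    by (simp add: eventually_at_to_0[of _ s'])
qed

lemma stationary_imp_zero_derivative:
  assumes st: "stationary s" and ch: "(W, \<psi>) \<in> atlas N" "c s \<in> W"
  shows "((\<lambda>t. \<psi> (c t)) has_vector_derivative 0) (at s)"
  unfolding has_vector_derivative_at_eventually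
proof (intro allI impI)
  fix e :: real assume e: "0 < e"
  obtain r :: real and D :: "('h \<Rightarrow>\<^sub>L 'h) \<Rightarrow> ('h \<Rightarrow>\<^sub>L 'h) \<Rightarrow> 'e" where Ds: "strict_derivative_at_0 E (\<lambda>k. \<psi> (act (op_exp k) (c s))) (D 0)"
    and onto: "bounded_linear_onto E (model N) (D 0)"
    using orbit_chart[OF exp_curve_in ch] by blast
  obtain K where K: "\<And>v. v \<in> E \<Longrightarrow> norm (D 0 v) \<le> K * norm v"
    using onto unfolding bounded_linear_onto_def by blast
  obtain d where d: "d > 0" "\<And>k. k \<in> E \<Longrightarrow> norm k < d \<Longrightarrow>
      norm (\<psi> (act (op_exp k) (c s)) - \<psi> (c s) - D 0 k) \<le> norm k"
    using Ds[unfolded strict_derivative_at_0_def, rule_format, OF zero_less_one] E_zero act_id[OF exp_curve_in] by fastforce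
  define e' where "e' = e / (\<bar>K\<bar> + 1)"
  have e': "e' > 0" "(\<bar>K\<bar> + 1) * e' = e" using e by (auto simp: e'_def add_nonneg_pos add_nonneg_eq_0_iff)
  have "((\<lambda>t. e' * \<bar>t - s\<bar>) \<longlongrightarrow> 0) (at s)" by (auto intro!: tendsto_eq_intros)
  then have "\<forall>\<^sub>F t in at s. e' * \<bar>t - s\<bar> < d" using order_tendstoD(2) d(1) by blast
  moreover have "\<forall>\<^sub>F t in at s. \<exists>k\<in>E. act (op_exp k) (c s) = c t \<and> norm k \<le> e' * \<bar>t - s\<bar>"
    using st e'(1) unfolding stationary_def by blast
  ultimately show "\<forall>\<^sub>F t in at s. norm (\<psi> (c t) - \<psi> (c s) - (t - s) *\<^sub>R 0) \<le> e * \<bar>t - s\<bar>"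
  proof eventually_elim
    case (elim t)
    then obtain k where k: "k \<in> E" "act (op_exp k) (c s) = c t" "norm k \<le> e' * \<bar>t - s\<bar>" by blast
    have "norm (\<psi> (c t) - \<psi> (c s)) \<le> norm (D 0 k) + norm (\<psi> (c t) - \<psi> (c s) - D 0 k)"
      by (rule norm_triangle_sub)
    also have "\<dots> \<le> K * norm k + norm k"
      using K[OF k(1)] d(2)[OF k(1)] k(2,3) elim(1) by (intro add_mono) auto
    also have "\<dots> \<le> \<bar>K\<bar> * norm k + norm k" by (intro add_right_mono mult_right_mono) auto
    also have "\<dots> = (\<bar>K\<bar> + 1) * norm k" by (simp add: algebra_simps)
    also have "\<dots> \<le> (\<bar>K\<bar> + 1) * (e' * \<bar>t - s\<bar>)" by (intro mult_left_mono k(3)) auto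
    also have "\<dots> = e * \<bar>t - s\<bar>" using e'(2) by (metis mult.assoc)
    finally show ?case by simp
  qed
qed

lemma stationary_imp_constant:
  assumes st: "\<And>s. stationary s" and "a \<le> b"
  shows "c a = c b"
  using \<open>a \<le> b\<close>
proof (induction rule: Bolzano)
  case (trans a b c) then show ?case by simp
next
  case (local t)
  obtain W \<psi> where ch: "(W, \<psi>) \<in> atlas N" "c t \<in> W" using chart_exists[OF exp_curve_in] by blast
  have "\<forall>\<^sub>F s in at t. c s \<in> W"
    using curve_eventually_in[OF exp_curve_continuous UNIV_I chart(1)[OF ch(1)] ch(2)] .
  then have "\<exists>d>0. \<forall>s. \<bar>s - t\<bar> < d \<longrightarrow> c s \<in> W"
    using ch(2) unfolding eventually_at dist_real_def by (metis UNIV_I)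
  then obtain d where d: "d > 0" "\<And>s. \<bar>s - t\<bar> < d \<Longrightarrow> c s \<in> W" by blast
  have "c a = c b" if ab: "a \<le> t" "t \<le> b" "b - a < d" for a b
  proof -
    have inW: "c s \<in> W" if "s \<in> {a..b}" for s using that ab by (intro d(2)) auto
    have "((\<lambda>t. \<psi> (c t)) has_vector_derivative 0) (at s within {a..b})" if "s \<in> {a..b}" for s
      using stationary_imp_zero_derivative[OF st ch(1) inW[OF that]] has_vector_derivative_at_within by blast
    then obtain l where "\<And>s. s \<in> {a..b} \<Longrightarrow> \<psi> (c s) = l"
      using has_vector_derivative_zero_constant[of "{a..b}" "\<lambda>t. \<psi> (c t)"] by auto
    then show ?thesis using inj_onD[OF chart(4)[OF ch(1)]] inW ab by auto
  qed
  then show ?case using d(1) by blast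
qed

text \<open>By transport the velocity of an exponential curve vanishes nowhere or everywhere, and in the latter
case the curve is constant; in both cases it is an admissible smooth curve.\<close>

lemma exp_curve_smooth:
  assumes ab: "a < b"
  shows "smooth_curve_on N c a b"
proof (cases "\<exists>s. stationary s")
  case True
  then have "\<And>s. stationary s" using stationary_transport by blast
  then have "c s = c t" for s t using stationary_imp_constant[of s t] stationary_imp_constant[of t s] by (metis linear)
  then show ?thesis unfolding smooth_curve_on_def using exp_curve_C1(1)[OF ab] by blast
next
  case False
  then have "vector_derivative (\<psi> \<circ> c) (at t within {a..b}) \<noteq> 0" if "(W, \<psi>) \<in> atlas N" "t \<in> {a..b}" "c t \<in> W" for W \<psi> t
    using zero_derivative_imp_stationary[OF that(1,3)] exp_curve_C1(2)[OF ab that] by auto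
  then show ?thesis unfolding smooth_curve_on_def using exp_curve_C1(1)[OF ab] by blast
qed

end

end

section \<open>Piecewise curves\<close>

lemma tendsto_difference_quotient:
  fixes f :: "real \<Rightarrow> 'a::real_normed_vector"
  assumes f: "(f has_vector_derivative v) (at t)"
  shows "((\<lambda>s. (1 / (s - t)) *\<^sub>R (f s - f t)) \<longlongrightarrow> v) (at t)"
proof (rule tendstoI)
  fix e :: real assume e: "0 < e"
  have "\<forall>\<^sub>F s in at t. norm (f s - f t - (s - t) *\<^sub>R v) \<le> e / 2 * \<bar>s - t\<bar>"
    using f half_gt_zero[OF e] unfolding has_vector_derivative_at_eventually by blast
  moreover have "\<forall>\<^sub>F s in at t. s \<noteq> t" by (rule eventually_neq_at_within)
  ultimately show "\<forall>\<^sub>F s in at t. dist ((1 / (s - t)) *\<^sub>R (f s - f t)) v < e"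
  proof eventually_elim
    case (elim s)
    have "f s - f t - (s - t) *\<^sub>R v = (s - t) *\<^sub>R ((1 / (s - t)) *\<^sub>R (f s - f t) - v)"
      using elim(2) by (simp add: scaleR_diff_right)
    then have "\<bar>s - t\<bar> * norm ((1 / (s - t)) *\<^sub>R (f s - f t) - v) \<le> e / 2 * \<bar>s - t\<bar>"
      using elim(1) by simp
    then have "norm ((1 / (s - t)) *\<^sub>R (f s - f t) - v) \<le> e / 2"
      using elim(2) by (simp add: mult.commute)
    then show ?case using e by (simp add: dist_norm)
  qed
qed

lemma smooth_curve_on_cong:
  assumes sm: "smooth_curve_on N \<gamma> a b" and eq: "\<And>t. t \<in> {a..b} \<Longrightarrow> \<gamma>' t = \<gamma> t"
  shows "smooth_curve_on N \<gamma>' a b"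
proof -
  have hvd: "(\<psi> \<circ> \<gamma>' has_vector_derivative v) (at t within {a..b}) \<longleftrightarrow> (\<psi> \<circ> \<gamma> has_vector_derivative v) (at t within {a..b})"
    if "t \<in> {a..b}" for \<psi> :: "'a \<Rightarrow> 'b" and v t
    using that has_vector_derivative_transform[of t "{a..b}" "\<psi> \<circ> \<gamma>'" "\<psi> \<circ> \<gamma>"]
      has_vector_derivative_transform[of t "{a..b}" "\<psi> \<circ> \<gamma>" "\<psi> \<circ> \<gamma>'"] eq by auto
  have vd: "vector_derivative (\<psi> \<circ> \<gamma>') (at t within {a..b}) = vector_derivative (\<psi> \<circ> \<gamma>) (at t within {a..b})"
    if "t \<in> {a..b}" for \<psi> :: "'a \<Rightarrow> 'b" and t
    unfolding vector_derivative_def hvd[OF that] ..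
  have dif: "(\<psi> \<circ> \<gamma>') differentiable (at t within {a..b}) \<longleftrightarrow> (\<psi> \<circ> \<gamma>) differentiable (at t within {a..b})"
    if "t \<in> {a..b}" for \<psi> :: "'a \<Rightarrow> 'b" and t
    using hvd[OF that] by (metis differentiableI_vector vector_derivative_works)
  have sets: "{t \<in> {a..b}. \<gamma>' t \<in> V} = {t \<in> {a..b}. \<gamma> t \<in> V}" for V using eq by auto
  have cont: "continuous_on {t \<in> {a..b}. \<gamma>' t \<in> V} (\<lambda>t. vector_derivative (\<psi> \<circ> \<gamma>') (at t within {a..b})) \<longleftrightarrow>
      continuous_on {t \<in> {a..b}. \<gamma> t \<in> V} (\<lambda>t. vector_derivative (\<psi> \<circ> \<gamma>) (at t within {a..b}))"
    for V and \<psi> :: "'a \<Rightarrow> 'b"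
    unfolding sets by (rule continuous_on_cong) (auto simp: vd)
  have C1: "C1_curve_on N \<gamma> a b" using sm unfolding smooth_curve_on_def by blast
  have "continuous_map (top_of_set {a..b}) (mtop N) \<gamma>'"
    using C1 eq unfolding C1_curve_on_def
    by (auto intro: continuous_map_eq[of "top_of_set {a..b}" "mtop N" \<gamma>])
  moreover have "(\<forall>t\<in>{a..b}. \<gamma>' t \<in> V \<longrightarrow> (\<psi> \<circ> \<gamma>') differentiable (at t within {a..b})) \<and>
      continuous_on {t \<in> {a..b}. \<gamma>' t \<in> V} (\<lambda>t. vector_derivative (\<psi> \<circ> \<gamma>') (at t within {a..b}))"
    if "(V, \<psi>) \<in> atlas N" for V \<psi>
    using C1 that eq dif unfolding C1_curve_on_def cont by fastforce
  ultimately have C1': "C1_curve_on N \<gamma>' a b" unfolding C1_curve_on_def by blast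
  have "(\<forall>(V, \<psi>)\<in>atlas N. \<forall>t\<in>{a..b}. \<gamma> t \<in> V \<longrightarrow> vector_derivative (\<psi> \<circ> \<gamma>) (at t within {a..b}) \<noteq> 0) \<or>
      (\<forall>s\<in>{a..b}. \<forall>t\<in>{a..b}. \<gamma> s = \<gamma> t)" using sm unfolding smooth_curve_on_def by blast
  then have "(\<forall>(V, \<psi>)\<in>atlas N. \<forall>t\<in>{a..b}. \<gamma>' t \<in> V \<longrightarrow> vector_derivative (\<psi> \<circ> \<gamma>') (at t within {a..b}) \<noteq> 0) \<or>
      (\<forall>s\<in>{a..b}. \<forall>t\<in>{a..b}. \<gamma>' s = \<gamma>' t)"
  proof (elim disjE)
    assume *: "\<forall>(V, \<psi>)\<in>atlas N. \<forall>t\<in>{a..b}. \<gamma> t \<in> V \<longrightarrow> vector_derivative (\<psi> \<circ> \<gamma>) (at t within {a..b}) \<noteq> 0"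
    have "vector_derivative (\<psi> \<circ> \<gamma>') (at t within {a..b}) \<noteq> 0"
      if "(V, \<psi>) \<in> atlas N" "t \<in> {a..b}" "\<gamma>' t \<in> V" for V \<psi> t
      using * that eq[OF that(2)] vd[OF that(2)] by fastforce
    then show ?thesis by blast
  next
    assume "\<forall>s\<in>{a..b}. \<forall>t\<in>{a..b}. \<gamma> s = \<gamma> t"
    then show ?thesis using eq by metis
  qed
  then show ?thesis using C1' unfolding smooth_curve_on_def by blast
qed

lemma velocity_cong:
  fixes N :: "('x, 'e::banach) bmanifold" and \<gamma> \<gamma>' :: "real \<Rightarrow> 'x"
  assumes t: "t \<in> {a<..<b}" and eq: "\<And>s. s \<in> {a<..<b} \<Longrightarrow> \<gamma>' s = \<gamma> s"
  shows "velocity N \<gamma>' t = velocity N \<gamma> t"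
proof -
  have "vector_derivative (f \<circ> \<gamma>') (at t) = vector_derivative (f \<circ> \<gamma>) (at t)" for f :: "'x \<Rightarrow> 'e"
  proof -
    have "\<forall>\<^sub>F s in nhds t. s \<in> {a<..<b}" using t by (intro eventually_nhds_in_open) auto
    then have "\<forall>\<^sub>F s in nhds t. (f \<circ> \<gamma>') s = (f \<circ> \<gamma>) s" by (rule eventually_mono) (use eq in simp)
    then show ?thesis by (intro vector_derivative_cong_eq) auto
  qed
  then show ?thesis unfolding velocity_def using eq[OF t] by (intro ext) simp
qed

lemma unit_partition_mono:
  assumes "unit_partition n t" "i \<le> j" "j \<le> n"
  shows "t i \<le> t j"
  using assms(2,3)
proof (induction j rule: dec_induct)
  case (step k)
  then have "t k < t (Suc k)" using assms(1) unfolding unit_partition_def by auto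
  then show ?case using step by simp
qed simp

lemma unit_partition_bounds:
  assumes "unit_partition n t" "i \<le> n" shows "0 \<le> t i" "t i \<le> 1"
  using unit_partition_mono[OF assms(1), of 0 i] unit_partition_mono[OF assms(1), of i n] assms
  unfolding unit_partition_def by auto

lemma unit_partition_locate:
  assumes P: "unit_partition n t" and s: "0 \<le> s" "s \<le> 1"
  shows "\<exists>i<n. t i \<le> s \<and> s \<le> t (Suc i)"
proof -
  have t: "t 0 = 0" "t n = 1" using P unfolding unit_partition_def by auto
  define j where "j = (LEAST j. s \<le> t j)"
  have j: "s \<le> t j" "j \<le> n" unfolding j_def using t(2) s(2) by (auto intro: LeastI[of _ n] Least_le)
  show ?thesis
  proof (cases j)
    case 0
    then have "s = 0" using j t(1) s(1) by simp
    moreover have "0 < n" using t by (cases n) auto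
    ultimately show ?thesis using t(1) unit_partition_bounds[OF P, of 1] by (intro exI[of _ 0]) auto
  next
    case (Suc i)
    have "\<not> s \<le> t i" using not_less_Least[of i "\<lambda>j. s \<le> t j"] Suc unfolding j_def by simp
    then show ?thesis using j Suc by (intro exI[of _ i]) auto
  qed
qed

context homogeneous_space
begin

abbreviation "qnorm \<equiv> quotient_norm M \<tau> p act N"
abbreviation "qdist \<equiv> quotient_dist M \<tau> p act N"
abbreviation "pn \<equiv> pnorm \<tau> p"

lemma pn_scale: "z \<in> E \<Longrightarrow> 0 < c \<Longrightarrow> pn (c *\<^sub>R z) = c * pn z"
  and pn_nonneg: "0 \<le> pn z"
  and pn_less: "w \<in> E \<Longrightarrow> pn w < c \<Longrightarrow> \<exists>d>0. \<forall>z\<in>E. norm (z - w) < d \<longrightarrow> pn z < c"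
  using pnorm_scaleR[OF M \<tau> p] pnorm_nonneg[OF M \<tau> p] pnorm_less_nearby[OF M \<tau> p] by auto

lemma pn_zero: "pn 0 = 0"
  using pnorm_zero[OF M \<tau> p] .

lemma pn_small: "0 < e \<Longrightarrow> \<exists>d>0. \<forall>z\<in>E. norm z < d \<longrightarrow> pn z < e"
  using pn_less[OF E_zero, of e] pn_zero by simp

lemma act_exp_inverse:
  assumes "k \<in> E" "y \<in> X" shows "act (op_exp (- k)) (act (op_exp k) y) = y"
  using act_compose[OF exp_U[OF E_neg[OF assms(1)]] exp_U[OF assms(1)] assms(2)] op_exp_minus(1)[of k] act_id[OF assms(2)]
  by simp

section \<open>Chains of exponential steps\<close>

text \<open>The number attached to a chain adds up the bounds \<open>\<parallel>z\<parallel>\<^sub>p\<close> for the lengths of the exponential curves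
that join consecutive points.\<close>

inductive exp_chain :: "'x \<Rightarrow> 'x \<Rightarrow> real \<Rightarrow> bool" for x where
  refl: "exp_chain x x 0"
| step: "exp_chain x y r \<Longrightarrow> z \<in> E \<Longrightarrow> exp_chain x (act (op_exp z) y) (r + pn z)"

lemma exp_chain_single:
  assumes "z \<in> E" shows "exp_chain y (act (op_exp z) y) (pn z)"
  using exp_chain.step[OF exp_chain.refl assms] by simp

lemma exp_chain_trans:
  assumes "exp_chain x y r" "exp_chain y w s" shows "exp_chain x w (r + s)"
  using assms(2)
proof induction
  case refl then show ?case using assms(1) by simp
next
  case (step w s z)
  then show ?case using exp_chain.step[of x w "r + s" z] by (simp add: add.assoc)
qed

lemma exp_chain_nonneg: "exp_chain x y r \<Longrightarrow> 0 \<le> r"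
  by (induction rule: exp_chain.induct) (auto simp: pn_nonneg add_nonneg_nonneg)

lemma exp_chain_sequence:
  assumes x: "x \<in> X" and "exp_chain x y r"
  shows "\<exists>n>0. \<exists>zs ys. ys 0 = x \<and> ys n = y \<and> r = (\<Sum>i<n. pn (zs i)) \<and> (\<forall>i\<le>n. ys i \<in> X) \<and>
    (\<forall>i<n. zs i \<in> E \<and> ys (Suc i) = act (op_exp (zs i)) (ys i))"
  using assms(2)
proof induction
  case refl
  show ?case
    by (intro exI[of _ 1] conjI exI[of _ "\<lambda>_. 0"] exI[of _ "\<lambda>_. x"])
      (use x E_zero act_id pn_zero in auto)
next
  case (step y r z)
  then obtain n zs ys where IH: "n > 0" "ys 0 = x" "ys n = y" "r = (\<Sum>i<n. pn (zs i))" "\<forall>i\<le>n. ys i \<in> X"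
    "\<forall>i<n. zs i \<in> E \<and> ys (Suc i) = act (op_exp (zs i)) (ys i)" by blast
  have "act (op_exp z) y \<in> X" using act_in[OF exp_U[OF step.hyps(2)]] IH(3,5) by blast
  then show ?case using IH step.hyps(2)
    by (intro exI[of _ "Suc n"] conjI exI[of _ "zs(n := z)"] exI[of _ "ys(Suc n := act (op_exp z) y)"])
      (auto simp: le_Suc_eq less_Suc_eq)
qed

text \<open>The \<open>n\<close> exponential curves of a chain, run at speed \<open>n\<close> on consecutive intervals of length \<open>1 / n\<close>, form a
piecewise smooth curve. On each interval its velocity is that of \<open>n z\<^sub>i\<close>, so the length is bounded by
the integral of a step function.\<close>

lemma qdist_le_exp_sequence:
  assumes n: "0 < n" and ysX: "\<And>i. i \<le> n \<Longrightarrow> ys i \<in> X" and zsE: "\<And>i. i < n \<Longrightarrow> zs i \<in> E"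
    and ys: "\<And>i. i < n \<Longrightarrow> ys (Suc i) = act (op_exp (zs i)) (ys i)"
  shows "qdist (ys 0) (ys n) \<le> ennreal (\<Sum>i<n. pn (zs i))"
proof -
  define T where "T i = real i / real n" for i
  define w where "w i = real n *\<^sub>R zs i" for i
  define seg where "seg i t = act (op_exp ((t - T i) *\<^sub>R w i)) (ys i)" for i t
  \<comment> \<open>at the break points both adjacent formulas agree; only \<open>t = 1\<close> falls outside the segments\<close>
  define c where "c t = (if 1 \<le> t then ys n else seg (nat \<lfloor>real n * t\<rfloor>) t)" for t
  have T: "T 0 = 0" "T n = 1" "\<And>i. T i < T (Suc i)" using n by (auto simp: T_def divide_strict_right_mono)
  have part: "unit_partition n T" unfolding unit_partition_def using T by blast
  have wE: "w i \<in> E" if "i < n" for i unfolding w_def by (intro E_scale zsE that)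
  have seg_start: "seg i (T i) = ys i" if "i \<le> n" for i
    unfolding seg_def using act_id[OF ysX[OF that]] by simp
  have seg_end: "seg i (T (Suc i)) = ys (Suc i)" if "i < n" for i
  proof -
    have "(T (Suc i) - T i) *\<^sub>R w i = zs i" using n by (simp add: T_def w_def diff_divide_distrib[symmetric])
    then show ?thesis unfolding seg_def using ys[OF that] by simp
  qed
  have c_seg: "c t = seg i t" if i: "i < n" and t: "t \<in> {T i..T (Suc i)}" for i t
  proof (cases "t = T (Suc i)")
    case True
    show ?thesis
    proof (cases "Suc i = n")
      case True
      then show ?thesis using \<open>t = T (Suc i)\<close> seg_end[OF i] T(2) by (simp add: c_def)
    next
      case False
      then have "t < 1" "nat \<lfloor>real n * t\<rfloor> = Suc i" using i n by (auto simp: True T_def)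
      then show ?thesis using True seg_end[OF i] seg_start[of "Suc i"] i by (simp add: c_def)
    qed
  next
    case False
    then have lt: "real i \<le> real n * t" "real n * t < real (Suc i)"
      using t n by (auto simp: T_def field_simps)
    then have "\<lfloor>real n * t\<rfloor> = int i" by (simp add: floor_eq_iff)
    moreover have "t < 1" using t False i T unit_partition_bounds[OF part, of "Suc i"] by auto
    ultimately show ?thesis by (simp add: c_def)
  qed
  have "smooth_curve_on N c (T i) (T (Suc i))" if i: "i < n" for i
  proof (rule smooth_curve_on_cong[where \<gamma> = "seg i"])
    show "smooth_curve_on N (seg i) (T i) (T (Suc i))"
      by (rule exp_curve_smooth[where z = "w i" and y = "ys i" and ?\<tau>0.0 = "T i", OF wE[OF i] ysX _ T(3)])
        (use i in \<open>auto simp: seg_def\<close>)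
  qed (use c_seg[OF i] in simp)
  then have smooth: "piecewise_smooth N c" unfolding piecewise_smooth_def using part by blast
  have ends: "c 0 = ys 0" "c 1 = ys n" using c_seg[of 0 0] seg_start[of 0] T n by (auto simp: c_def)
  have bound: "qnorm (c t) (velocity N c t) \<le> ennreal (real n * pn (zs i))"
    if i: "i < n" and t: "t \<in> {T i<..<T (Suc i)}" for i t
  proof -
    have "velocity N c t = velocity N (seg i) t"
      by (rule velocity_cong[OF t]) (use c_seg[OF i] in simp)
    also have "\<dots> = orbit_differential act N (seg i t) (w i)"
      by (rule exp_curve_velocity[where z = "w i" and y = "ys i" and ?\<tau>0.0 = "T i", OF wE[OF i] ysX])
        (use i in \<open>auto simp: seg_def\<close>)
    finally have "velocity N c t = orbit_differential act N (c t) (w i)" using c_seg[OF i] t by simp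
    then have "qnorm (c t) (velocity N c t) \<le> ennreal (pn (w i))"
      unfolding quotient_norm_def using wE[OF i] by (intro INF_lower) simp
    then show ?thesis using pn_scale[OF zsE[OF i], of "real n"] n by (simp add: w_def)
  qed
  let ?G = "\<lambda>t. \<Sum>i<n. ennreal (real n * pn (zs i)) * indicator {T i..T (Suc i)} t"
  have "curve_length M \<tau> p act N c \<le> (\<integral>\<^sup>+t. ?G t \<partial>lborel)"
    unfolding curve_length_def
  proof (rule nn_integral_mono_AE)
    have "AE t in lborel. \<forall>i\<in>{..n}. t \<noteq> T i"
      by (rule AE_finite_allI) (auto intro: AE_lborel_singleton)
    then show "AE t in lborel. qnorm (c t) (velocity N c t) * indicator {0..1} t \<le> ?G t"
    proof (rule eventually_mono)
      fix t assume ne: "\<forall>i\<in>{..n}. t \<noteq> T i"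
      show "qnorm (c t) (velocity N c t) * indicator {0..1} t \<le> ?G t"
      proof (cases "t \<in> {0..1}")
        case True
        then obtain i where i: "i < n" "T i \<le> t" "t \<le> T (Suc i)" using unit_partition_locate[OF part] by auto
        then have "t \<in> {T i<..<T (Suc i)}" using ne by (auto simp: less_le)
        from bound[OF i(1) this] have "qnorm (c t) (velocity N c t) * indicator {0..1} t
            \<le> ennreal (real n * pn (zs i)) * indicator {T i..T (Suc i)} t"
          using True i by simp
        also have "\<dots> \<le> ?G t" using i(1) by (intro member_le_sum) auto
        finally show ?thesis .
      qed simp
    qed
  qed
  also have "\<dots> = (\<Sum>i<n. ennreal (real n * pn (zs i)) * ennreal (T (Suc i) - T i))"
    by (subst nn_integral_sum) (auto simp: nn_integral_cmult_indicator less_imp_le[OF T(3)] intro!: sum.cong)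
  also have "\<dots> = (\<Sum>i<n. ennreal (pn (zs i)))"
  proof (rule sum.cong[OF HOL.refl])
    fix i
    have "T (Suc i) - T i = 1 / real n" by (simp add: T_def diff_divide_distrib[symmetric])
    then show "ennreal (real n * pn (zs i)) * ennreal (T (Suc i) - T i) = ennreal (pn (zs i))"
      using n pn_nonneg by (simp add: ennreal_mult[symmetric])
  qed
  also have "\<dots> = ennreal (\<Sum>i<n. pn (zs i))" using pn_nonneg by (simp add: sum_ennreal)
  finally have "curve_length M \<tau> p act N c \<le> ennreal (\<Sum>i<n. pn (zs i))" .
  moreover have "qdist (ys 0) (ys n) \<le> curve_length M \<tau> p act N c"
    unfolding quotient_dist_def using smooth ends by (intro INF_lower) simp
  ultimately show ?thesis by (rule order_trans[rotated])
qed

lemma qdist_le_exp_chain: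
  assumes "x \<in> X" "exp_chain x y r" shows "qdist x y \<le> ennreal r"
proof -
  obtain n zs ys where *: "n > 0" "ys 0 = x" "ys n = y" "r = (\<Sum>i<n. pn (zs i))" "\<forall>i\<le>n. ys i \<in> X"
    "\<forall>i<n. zs i \<in> E \<and> ys (Suc i) = act (op_exp (zs i)) (ys i)" using exp_chain_sequence[OF assms] by blast
  show ?thesis using qdist_le_exp_sequence[of n ys zs] * by simp
qed

definition chain_cost :: "'x \<Rightarrow> 'x \<Rightarrow> ennreal" where
  "chain_cost x y = (INF r\<in>{r. exp_chain x y r}. ennreal r)"

lemma qdist_le_chain_cost: "x \<in> X \<Longrightarrow> qdist x y \<le> chain_cost x y"
  unfolding chain_cost_def using qdist_le_exp_chain by (intro INF_greatest) simp

lemma chain_cost_triangle: "chain_cost x w \<le> chain_cost x y + chain_cost y w"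
proof (rule ennreal_le_epsilon)
  fix e :: real assume fin: "chain_cost x y + chain_cost y w < top" and e: "0 < e"
  have "chain_cost x y < chain_cost x y + ennreal (e / 2)" "chain_cost y w < chain_cost y w + ennreal (e / 2)"
    using fin e by (simp_all add: ennreal_add_left_cancel_less[of _ 0, simplified] ennreal_less_zero_iff less_top)
  then obtain r s where r: "exp_chain x y r" "ennreal r < chain_cost x y + ennreal (e / 2)"
    and s: "exp_chain y w s" "ennreal s < chain_cost y w + ennreal (e / 2)"
    unfolding chain_cost_def INF_less_iff by blast
  have "chain_cost x w \<le> ennreal (r + s)"
    unfolding chain_cost_def by (rule INF_lower) (use exp_chain_trans r s in auto)
  also have "\<dots> = ennreal r + ennreal s" using exp_chain_nonneg r s by simp
  also have "\<dots> \<le> (chain_cost x y + ennreal (e / 2)) + (chain_cost y w + ennreal (e / 2))"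
    using r s by (intro add_mono) auto
  also have "\<dots> = chain_cost x y + chain_cost y w + (ennreal (e / 2) + ennreal (e / 2))" by (simp add: ac_simps)
  also have "ennreal (e / 2) + ennreal (e / 2) = ennreal e" using e by (simp flip: ennreal_plus)
  finally show "chain_cost x w \<le> chain_cost x y + chain_cost y w + ennreal e" .
qed

text \<open>On an interval on which \<open>\<gamma>\<close> is differentiable, let \<open>g s\<close> be the least cost of a chain from \<open>\<gamma> a\<close> to \<open>\<gamma> s\<close>. It
is finite by compactness, continuous because nearby points are joined by short steps, and its upper
derivate at \<open>t\<close> is bounded by the p-norm of every lift of \<open>\<gamma>' t\<close>, hence by the quotient norm.\<close>

lemma chain_cost_le_integral:
  assumes ab: "a \<le> b" and cont: "continuous_map (top_of_set {a..b}) (mtop N) \<gamma>"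
    and dif: "\<And>W \<psi> t. (W, \<psi>) \<in> atlas N \<Longrightarrow> a < t \<Longrightarrow> t < b \<Longrightarrow> \<gamma> t \<in> W \<Longrightarrow> (\<psi> \<circ> \<gamma>) differentiable (at t)"
  shows "chain_cost (\<gamma> a) (\<gamma> b) \<le> (\<integral>\<^sup>+t\<in>{a..b}. qnorm (\<gamma> t) (velocity N \<gamma> t) \<partial>lborel)"
proof -
  have inX: "\<gamma> t \<in> X" if "t \<in> {a..b}" for t using cont that unfolding continuous_map_def by auto
  have near: "\<exists>d>0. \<forall>s\<in>{a..b}. \<bar>s - t\<bar> < d \<longrightarrow> (\<exists>k\<in>E. act (op_exp k) (\<gamma> t) = \<gamma> s \<and> norm k < e)"
    if t: "t \<in> {a..b}" and e: "0 < e" for t e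
  proof -
    obtain d where d: "d > 0" "\<forall>s\<in>{a..b}. s \<noteq> t \<and> \<bar>s - t\<bar> < d \<longrightarrow> (\<exists>k\<in>E. act (op_exp k) (\<gamma> t) = \<gamma> s \<and> norm k < e)"
      using curve_near_exp[OF cont t e] unfolding eventually_at dist_real_def by blast
    moreover have "\<exists>k\<in>E. act (op_exp k) (\<gamma> t) = \<gamma> t \<and> norm k < e"
      using E_zero act_id[OF inX[OF t]] e by (intro bexI[of _ 0]) auto
    ultimately show ?thesis by metis
  qed
  have undo: "act (op_exp (- k)) (\<gamma> s) = \<gamma> t" if "k \<in> E" "act (op_exp k) (\<gamma> t) = \<gamma> s" "t \<in> {a..b}" for k s t
    using act_exp_inverse[OF that(1) inX[OF that(3)]] that(2) by simp
  have reach': "a \<le> u \<and> v \<le> b \<longrightarrow> (\<exists>r. exp_chain (\<gamma> u) (\<gamma> v) r)" if "u \<le> v" for u v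
    using that
  proof (induction rule: Bolzano)
    case (trans u v w) then show ?case using exp_chain_trans by fastforce
  next
    case (local t)
    show ?case
    proof (cases "t \<in> {a..b}")
      case True
      obtain d where d: "d > 0" "\<forall>s\<in>{a..b}. \<bar>s - t\<bar> < d \<longrightarrow> (\<exists>k\<in>E. act (op_exp k) (\<gamma> t) = \<gamma> s \<and> norm k < 1)"
        using near[OF True zero_less_one] by blast
      have "\<exists>r. exp_chain (\<gamma> u) (\<gamma> v) r" if uv: "u \<le> t" "t \<le> v" "v - u < d" "a \<le> u" "v \<le> b" for u v
      proof -
        have "u \<in> {a..b}" "v \<in> {a..b}" "\<bar>u - t\<bar> < d" "\<bar>v - t\<bar> < d" using uv True by auto
        then obtain k l where k: "k \<in> E" "act (op_exp k) (\<gamma> t) = \<gamma> u" and l: "l \<in> E" "act (op_exp l) (\<gamma> t) = \<gamma> v"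
          using d(2) by meson
        have "exp_chain (\<gamma> u) (\<gamma> t) (pn (- k))"
          using exp_chain_single[OF E_neg[OF k(1)], of "\<gamma> u"] undo[OF k True] by simp
        moreover have "exp_chain (\<gamma> t) (\<gamma> v) (pn l)" using exp_chain_single[OF l(1), of "\<gamma> t"] l(2) by simp
        ultimately show ?thesis using exp_chain_trans by blast
      qed
      then show ?thesis using d(1) by blast
    qed (intro exI[of _ 1], auto)
  qed
  define R where "R s = {r. exp_chain (\<gamma> a) (\<gamma> s) r}" for s
  define g where "g s = Inf (R s)" for s
  have R_ne: "R s \<noteq> {}" if "s \<in> {a..b}" for s using reach'[of a s] that unfolding R_def by auto
  have R_bdd: "bdd_below (R s)" for s using exp_chain_nonneg unfolding R_def by (intro bdd_belowI[of _ 0]) auto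
  have g_nonneg: "0 \<le> g s" if "s \<in> {a..b}" for s
    unfolding g_def using R_ne[OF that] exp_chain_nonneg by (intro cInf_greatest) (auto simp: R_def)
  have g_step: "g s' \<le> g s + pn k" if "s \<in> {a..b}" "k \<in> E" "act (op_exp k) (\<gamma> s) = \<gamma> s'" for s s' k
  proof -
    have "g s' - pn k \<le> r" if "r \<in> R s" for r
    proof -
      have "r + pn k \<in> R s'" using exp_chain.step[of "\<gamma> a" "\<gamma> s" r k] that \<open>k \<in> E\<close> \<open>act (op_exp k) (\<gamma> s) = \<gamma> s'\<close>
        unfolding R_def by simp
      then have "g s' \<le> r + pn k" unfolding g_def using R_bdd by (intro cInf_lower)
      then show ?thesis by simp
    qed
    then have "g s' - pn k \<le> g s" unfolding g_def[of s] using R_ne[OF that(1)] by (intro cInf_greatest)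
    then show ?thesis by simp
  qed
  have g_cont: "continuous_on {a..b} g"
    unfolding continuous_on_iff
  proof (intro ballI allI impI)
    fix t e :: real assume t: "t \<in> {a..b}" and e: "0 < e"
    obtain d where d: "d > 0" "\<And>z. z \<in> E \<Longrightarrow> norm z < d \<Longrightarrow> pn z < e" using pn_small[OF e] by blast
    obtain d' where d': "d' > 0" "\<forall>s\<in>{a..b}. \<bar>s - t\<bar> < d' \<longrightarrow> (\<exists>k\<in>E. act (op_exp k) (\<gamma> t) = \<gamma> s \<and> norm k < d)"
      using near[OF t d(1)] by blast
    have "dist (g s) (g t) < e" if s: "s \<in> {a..b}" "dist s t < d'" for s
    proof -
      obtain k where k: "k \<in> E" "act (op_exp k) (\<gamma> t) = \<gamma> s" "norm k < d" using d'(2) s by (auto simp: dist_real_def)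
      have "g s \<le> g t + pn k" by (rule g_step[OF t k(1,2)])
      moreover have "g t \<le> g s + pn (- k)" by (rule g_step[OF s(1) E_neg[OF k(1)] undo[OF k(1,2) t]])
      moreover have "pn k < e" "pn (- k) < e" using d(2) k E_neg by auto
      ultimately show ?thesis by (simp add: dist_real_def)
    qed
    then show "\<exists>d>0. \<forall>x'\<in>{a..b}. dist x' t < d \<longrightarrow> dist (g x') (g t) < e" using d'(1) by blast
  qed
  have g_derivate: "upper_derivate_le g t r"
    if t: "a < t" "t < b" and c: "(W, \<psi>) \<in> atlas N" "\<gamma> t \<in> W" and z: "z \<in> E" "pn z < r"
      and vd: "vector_derivative (\<psi> \<circ> (\<lambda>s. act (op_exp (s *\<^sub>R z)) (\<gamma> t))) (at 0) = vector_derivative (\<psi> \<circ> \<gamma>) (at t)"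
    for t r W \<psi> z
  proof -
    have tab: "t \<in> {a..b}" using t by simp
    have at: "at t within {a..b} = at t" using t by (intro at_within_interior) simp
    have evW: "\<forall>\<^sub>F s in at t. \<gamma> s \<in> W"
      using curve_eventually_in[OF cont tab chart(1)[OF c(1)] c(2)] unfolding at .
    have d\<gamma>: "((\<lambda>s. \<psi> (\<gamma> s)) has_vector_derivative vector_derivative (\<psi> \<circ> \<gamma>) (at t)) (at t)"
      using dif[OF c(1) t c(2)] unfolding vector_derivative_works by (simp add: o_def)
    have "(\<psi> \<circ> (\<lambda>s. act (op_exp ((s - 0) *\<^sub>R z)) (\<gamma> t)) has_vector_derivative
        vector_derivative (\<psi> \<circ> (\<lambda>s. act (op_exp ((s - 0) *\<^sub>R z)) (\<gamma> t))) (at 0)) (at 0)"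
      using exp_curve_derivative(1)[OF z(1) inX[OF tab] HOL.refl c(1), of 0 0] c(2) act_id[OF inX[OF tab]] by simp
    then have dz: "((\<lambda>s. \<psi> (act (op_exp (s *\<^sub>R z)) (\<gamma> t))) has_vector_derivative vector_derivative (\<psi> \<circ> \<gamma>) (at t)) (at 0)"
      using vd by (simp add: o_def)
    obtain d where d: "d > 0" "\<And>k. k \<in> E \<Longrightarrow> norm (k - z) < d \<Longrightarrow> pn k < r" using pn_less[OF z] by blast
    have "\<forall>\<^sub>F s in at t. s \<in> {a<..<b} \<and> s \<noteq> t"
      using t by (intro eventually_conj eventually_at_in_open' eventually_neq_at_within) auto
    moreover have "\<forall>\<^sub>F s in at t. \<exists>k\<in>E. act (op_exp k) (\<gamma> t) = \<gamma> s \<and> norm (k - (s - t) *\<^sub>R z) \<le> d / 2 * \<bar>s - t\<bar>"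
      using curve_first_order_exp[OF inX[OF tab] c evW z(1) d\<gamma> dz, of "d / 2"] d(1) by simp
    ultimately have "\<forall>\<^sub>F s in at t. (g s - g t) / (s - t) \<le> r"
    proof eventually_elim
      case (elim s)
      then obtain k where k: "k \<in> E" "act (op_exp k) (\<gamma> t) = \<gamma> s" "norm (k - (s - t) *\<^sub>R z) \<le> d / 2 * \<bar>s - t\<bar>" by blast
      have sab: "s \<in> {a..b}" using elim by auto
      \<comment> \<open>dividing by the signed increment makes \<open>k'\<close> close to \<open>z\<close> on both sides of \<open>t\<close>\<close>
      define k' where "k' = (1 / (s - t)) *\<^sub>R k"
      have k'E: "k' \<in> E" unfolding k'_def by (rule E_scale[OF k(1)])
      have kk': "k = (s - t) *\<^sub>R k'" using elim by (simp add: k'_def)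
      have "\<bar>s - t\<bar> * norm (k' - z) = norm (k - (s - t) *\<^sub>R z)"
        unfolding kk' by (simp flip: scaleR_diff_right)
      then have "\<bar>s - t\<bar> * norm (k' - z) \<le> \<bar>s - t\<bar> * (d / 2)" using k(3) by (simp add: mult.commute)
      then have "norm (k' - z) \<le> d / 2" by (rule mult_left_le_imp_le) (use elim in simp)
      then have pk': "pn k' < r" using d k'E by simp
      show ?case
      proof (cases "t < s")
        case True
        have "g s \<le> g t + pn k" by (rule g_step[OF tab k(1,2)])
        also have "pn k = (s - t) * pn k'" using pn_scale[OF k'E, of "s - t"] True kk' by simp
        also have "\<dots> \<le> (s - t) * r" using True pk' by (intro mult_left_mono) auto
        finally show ?thesis using True by (simp add: field_simps)
      next
        case False
        then have st: "s < t" using elim by auto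
        have mk: "- k = (t - s) *\<^sub>R k'" unfolding kk' by (simp flip: scaleR_minus_left)
        have "g t \<le> g s + pn (- k)" by (rule g_step[OF sab E_neg[OF k(1)] undo[OF k(1,2) tab]])
        also have "pn (- k) = (t - s) * pn k'" unfolding mk using pn_scale[OF k'E, of "t - s"] st by simp
        also have "\<dots> \<le> (t - s) * r" using st pk' by (intro mult_left_mono) auto
        finally show ?thesis using st by (simp add: field_simps)
      qed
    qed
    then show ?thesis unfolding upper_derivate_le_def by (auto elim!: eventually_mono)
  qed
  have "ennreal (g b - g a) \<le> (\<integral>\<^sup>+t\<in>{a..b}. qnorm (\<gamma> t) (velocity N \<gamma> t) \<partial>lborel)"
  proof (rule increment_le_nn_integral[OF ab g_cont])
    fix t assume t: "a < t" "t < b"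
    then have tX: "\<gamma> t \<in> X" using inX by simp
    obtain W \<psi> where c: "(W, \<psi>) \<in> atlas N" "\<gamma> t \<in> W" using chart_exists[OF tX] by blast
    \<comment> \<open>surjectivity of the derivative of the orbit map provides a lift of the velocity\<close>
    show "\<exists>r\<ge>0. upper_derivate_le g t r"
    proof -
      obtain r and D :: "('h \<Rightarrow>\<^sub>L 'h) \<Rightarrow> ('h \<Rightarrow>\<^sub>L 'h) \<Rightarrow> 'e" where rD: "0 < r"
        "\<And>v s. v \<in> E \<Longrightarrow> norm (s *\<^sub>R v) < r \<Longrightarrow>
          ((\<lambda>h. \<psi> (act (op_exp (h *\<^sub>R v)) (\<gamma> t))) has_vector_derivative D (s *\<^sub>R v) v) (at s)"
        "bounded_linear_onto E (model N) (D 0)"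
        using orbit_chart[OF tX c] by blast
      have tab: "t \<in> {a..b}" using t by simp
      have at: "at t within {a..b} = at t" using t by (intro at_within_interior) simp
      have evW: "\<forall>\<^sub>F s in at t. \<gamma> s \<in> W"
        using curve_eventually_in[OF cont tab chart(1)[OF c(1)] c(2)] unfolding at .
      let ?v = "vector_derivative (\<psi> \<circ> \<gamma>) (at t)"
      have "(\<psi> \<circ> \<gamma> has_vector_derivative ?v) (at t)"
        using dif[OF c(1) t c(2)] unfolding vector_derivative_works .
      then have lim: "((\<lambda>s. (1 / (s - t)) *\<^sub>R (\<psi> (\<gamma> s) - \<psi> (\<gamma> t))) \<longlongrightarrow> ?v) (at t)"
        using tendsto_difference_quotient by fastforce
      have "?v \<in> model N"
      proof (rule Lim_in_closed_set[OF model_closed _ _ lim])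
        show "\<forall>\<^sub>F s in at t. (1 / (s - t)) *\<^sub>R (\<psi> (\<gamma> s) - \<psi> (\<gamma> t)) \<in> model N"
          using evW by (rule eventually_mono)
            (use chart(3)[OF c(1)] c(2) model_subspace in \<open>auto intro!: subspace_scale subspace_diff\<close>)
      qed simp
      then have "?v \<in> D 0 ` E" using rD(3) unfolding bounded_linear_onto_def by simp
      then obtain z where z: "z \<in> E" "D 0 z = ?v" by auto
      have "((\<lambda>h. \<psi> (act (op_exp (h *\<^sub>R z)) (\<gamma> t))) has_vector_derivative ?v) (at 0)"
        using rD(2)[OF z(1), of 0] rD(1) z(2) by simp
      then have "vector_derivative (\<psi> \<circ> (\<lambda>s. act (op_exp (s *\<^sub>R z)) (\<gamma> t))) (at 0) = ?v"
        using vector_derivative_at by (fastforce simp: o_def)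
      then have "upper_derivate_le g t (pn z + 1)" using g_derivate[OF t c z(1)] by simp
      then show ?thesis using pn_nonneg[of z] by (intro exI[of _ "pn z + 1"]) auto
    qed
    show "upper_derivate_le g t r" if r: "0 \<le> r" "qnorm (\<gamma> t) (velocity N \<gamma> t) < ennreal r" for r
    proof -
      obtain z where z: "z \<in> E" "orbit_differential act N (\<gamma> t) z = velocity N \<gamma> t" "ennreal (pn z) < ennreal r"
        using r(2) unfolding quotient_norm_def INF_less_iff by blast
      have "pn z < r" using z(3) r(1) by (simp add: ennreal_less_iff pn_nonneg)
      moreover have "vector_derivative (\<psi> \<circ> (\<lambda>s. act (op_exp (s *\<^sub>R z)) (\<gamma> t))) (at 0) = vector_derivative (\<psi> \<circ> \<gamma>) (at t)"
        using fun_cong[OF z(2), of "(W, \<psi>)"] c act_id[OF tX] unfolding orbit_differential_def velocity_def by simp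
      ultimately show ?thesis using g_derivate[OF t c z(1)] by blast
    qed
  qed
  moreover have "g a = 0"
  proof -
    have "0 \<in> R a" unfolding R_def using exp_chain.refl by simp
    then have "g a \<le> 0" unfolding g_def using R_bdd by (intro cInf_lower)
    then show ?thesis using g_nonneg[of a] ab by simp
  qed
  moreover have "chain_cost (\<gamma> a) (\<gamma> b) \<le> ennreal (g b)"
  proof (rule ennreal_le_epsilon)
    fix e :: real assume e: "0 < e"
    have bab: "b \<in> {a..b}" using ab by simp
    obtain r where r: "r \<in> R b" "r < g b + e"
      using cInf_lessD[OF R_ne[OF bab], of "g b + e"] e unfolding g_def by auto
    have "chain_cost (\<gamma> a) (\<gamma> b) \<le> ennreal r"
      unfolding chain_cost_def by (rule INF_lower) (use r in \<open>simp add: R_def\<close>)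
    also have "\<dots> \<le> ennreal (g b) + ennreal e"
      using r(2) g_nonneg[OF bab] e by (simp flip: ennreal_plus add: ennreal_leI)
    finally show "chain_cost (\<gamma> a) (\<gamma> b) \<le> ennreal (g b) + ennreal e" .
  qed
  ultimately show ?thesis by simp
qed

section \<open>Lengths of piecewise differentiable curves\<close>

lemma piecewise_C1_continuous:
  assumes "piecewise_C1 N \<gamma>"
  shows "continuous_map (top_of_set {0..1}) (mtop N) \<gamma>"
proof -
  obtain n t where P: "unit_partition n t" and C: "\<And>i. i < n \<Longrightarrow> C1_curve_on N \<gamma> (t i) (t (Suc i))"
    using assms unfolding piecewise_C1_def by blast
  have cont: "continuous_map (top_of_set {t i..t (Suc i)}) (mtop N) \<gamma>" if "i < n" for i
    using C[OF that] unfolding C1_curve_on_def by blast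
  have loc: "\<exists>i<n. s \<in> {t i..t (Suc i)}" if "s \<in> {0..1}" for s
    using unit_partition_locate[OF P, of s] that by auto
  have sub: "{t i..t (Suc i)} \<subseteq> {0..1}" if "i < n" for i
    using unit_partition_bounds[OF P, of i] unit_partition_bounds[OF P, of "Suc i"] that by auto
  show ?thesis
    unfolding continuous_map_closedin
  proof (intro conjI allI impI)
    show "\<gamma> \<in> topspace (top_of_set {0..1}) \<rightarrow> topspace (mtop N)"
    proof
      fix s assume "s \<in> topspace (top_of_set {0..1 :: real})"
      then obtain i where i: "i < n" "s \<in> {t i..t (Suc i)}" using loc by auto
      then show "\<gamma> s \<in> topspace (mtop N)" using cont[OF i(1)] unfolding continuous_map_def by auto
    qed
    fix A assume A: "closedin (mtop N) A"
    have cl: "closed {s \<in> {t i..t (Suc i)}. \<gamma> s \<in> A}" if "i < n" for i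
      using closedin_closed_trans[OF closedin_continuous_map_preimage[OF cont[OF that] A]] by simp
    have "{s \<in> topspace (top_of_set {0..1}). \<gamma> s \<in> A} = (\<Union>i<n. {s \<in> {t i..t (Suc i)}. \<gamma> s \<in> A})"
    proof (intro set_eqI iffI)
      fix s assume "s \<in> {s \<in> topspace (top_of_set {0..1}). \<gamma> s \<in> A}"
      then show "s \<in> (\<Union>i<n. {s \<in> {t i..t (Suc i)}. \<gamma> s \<in> A})" using loc[of s] by auto
    next
      fix s assume "s \<in> (\<Union>i<n. {s \<in> {t i..t (Suc i)}. \<gamma> s \<in> A})"
      then obtain i where "i < n" "s \<in> {t i..t (Suc i)}" "\<gamma> s \<in> A" by blast
      then show "s \<in> {s \<in> topspace (top_of_set {0..1}). \<gamma> s \<in> A}" using sub[of i] by auto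
    qed
    moreover have "closed (\<Union>i<n. {s \<in> {t i..t (Suc i)}. \<gamma> s \<in> A})" using cl by blast
    ultimately have "closed {s \<in> topspace (top_of_set {0..1}). \<gamma> s \<in> A}" by (simp only:)
    then show "closedin (top_of_set {0..1}) {s \<in> topspace (top_of_set {0..1}). \<gamma> s \<in> A}"
      by (rule closed_subset[rotated]) auto
  qed
qed

text \<open>Both sides behave well under subdivision, the cost by the triangle inequality and the lower integral
by superadditivity; so it is enough to consider intervals without break points in their interior.\<close>

lemma piecewise_C1_chain_cost_le:
  assumes pw: "piecewise_C1 N \<gamma>" and uv: "0 \<le> u" "u \<le> v" "v \<le> 1"
  shows "chain_cost (\<gamma> u) (\<gamma> v) \<le> (\<integral>\<^sup>+t\<in>{u..v}. qnorm (\<gamma> t) (velocity N \<gamma> t) \<partial>lborel)"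
proof -
  let ?I = "\<lambda>u v. \<integral>\<^sup>+t\<in>{u..v}. qnorm (\<gamma> t) (velocity N \<gamma> t) \<partial>lborel"
  obtain n t where P: "unit_partition n t" and C: "\<And>i. i < n \<Longrightarrow> C1_curve_on N \<gamma> (t i) (t (Suc i))"
    using pw unfolding piecewise_C1_def by blast
  define S where "S = t ` {..n}"
  have piece: "chain_cost (\<gamma> a) (\<gamma> b) \<le> ?I a b"
    if ab: "0 \<le> a" "a \<le> b" "b \<le> 1" and free: "{a<..<b} \<inter> S = {}" for a b
  proof (rule chain_cost_le_integral[OF ab(2)])
    show "continuous_map (top_of_set {a..b}) (mtop N) \<gamma>"
      by (rule continuous_map_from_subtopology_mono[OF piecewise_C1_continuous[OF pw]]) (use ab in auto)
    fix W \<psi> s assume c: "(W, \<psi>) \<in> atlas N" and s: "a < s" "s < b" "\<gamma> s \<in> W"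
    obtain i where i: "i < n" "t i \<le> s" "s \<le> t (Suc i)" using unit_partition_locate[OF P, of s] s ab by auto
    have "t i \<in> S" "t (Suc i) \<in> S" using i(1) unfolding S_def by auto
    then have "t i \<noteq> s" "t (Suc i) \<noteq> s" using free s by auto
    then have "s \<in> {t i<..<t (Suc i)}" using i by auto
    then have "at s within {t i..t (Suc i)} = at s" by (intro at_within_interior) simp
    moreover have "(\<psi> \<circ> \<gamma>) differentiable (at s within {t i..t (Suc i)})"
      using C[OF i(1)] c s(3) i unfolding C1_curve_on_def by fastforce
    ultimately show "(\<psi> \<circ> \<gamma>) differentiable (at s)" by simp
  qed
  have "0 \<le> u \<and> v \<le> 1 \<longrightarrow> chain_cost (\<gamma> u) (\<gamma> v) \<le> ?I u v"
    using uv(2)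
  proof (induction rule: Bolzano)
    case (trans a b c)
    show ?case
    proof
      assume ac: "0 \<le> a \<and> c \<le> 1"
      have "chain_cost (\<gamma> a) (\<gamma> c) \<le> chain_cost (\<gamma> a) (\<gamma> b) + chain_cost (\<gamma> b) (\<gamma> c)"
        by (rule chain_cost_triangle)
      also have "\<dots> \<le> ?I a b + ?I b c" by (rule add_mono) (use trans ac in auto)
      also have "\<dots> \<le> ?I a c" by (rule nn_integral_adjacent_intervals_le) (use trans in auto)
      finally show "chain_cost (\<gamma> a) (\<gamma> c) \<le> ?I a c" .
    qed
  next
    case (local x)
    have "finite S" unfolding S_def by simp
    then obtain d where d: "d > 0" "\<And>s. s \<in> S \<Longrightarrow> s \<noteq> x \<Longrightarrow> d \<le> dist x s"
      using finite_set_avoid[of S x] by blast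
    have "chain_cost (\<gamma> a) (\<gamma> b) \<le> ?I a b" if ab: "a \<le> x" "x \<le> b" "b - a < d" "0 \<le> a" "b \<le> 1" for a b
    proof -
      have "{a<..<x} \<inter> S = {}" "{x<..<b} \<inter> S = {}" using d(2) ab by (force simp: dist_real_def)+
      then have "chain_cost (\<gamma> a) (\<gamma> x) \<le> ?I a x" "chain_cost (\<gamma> x) (\<gamma> b) \<le> ?I x b"
        using piece ab by auto
      then have "chain_cost (\<gamma> a) (\<gamma> x) + chain_cost (\<gamma> x) (\<gamma> b) \<le> ?I a x + ?I x b" by (rule add_mono)
      with chain_cost_triangle have "chain_cost (\<gamma> a) (\<gamma> b) \<le> ?I a x + ?I x b" by (rule order_trans)
      also have "\<dots> \<le> ?I a b" by (rule nn_integral_adjacent_intervals_le[OF ab(1,2)])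
      finally show ?thesis .
    qed
    then show ?case using d(1) by blast
  qed
  then show ?thesis using uv by blast
qed

lemma rectifiable_length_le_curve_length:
  assumes pw: "piecewise_C1 N \<gamma>"
  shows "rectifiable_length M \<tau> p act N \<gamma> \<le> curve_length M \<tau> p act N \<gamma>"
  unfolding rectifiable_length_def
proof (rule SUP_least, clarify)
  fix n t assume P: "unit_partition n t"
  let ?I = "\<lambda>u v. \<integral>\<^sup>+t\<in>{u..v}. qnorm (\<gamma> t) (velocity N \<gamma> t) \<partial>lborel"
  have inX: "\<gamma> s \<in> X" if "s \<in> {0..1}" for s
    using piecewise_C1_continuous[OF pw] that unfolding continuous_map_def by auto
  have step: "qdist (\<gamma> (t i)) (\<gamma> (t (Suc i))) \<le> ?I (t i) (t (Suc i))" if "i < n" for i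
  proof -
    have b: "0 \<le> t i" "t i \<le> t (Suc i)" "t (Suc i) \<le> 1"
      using unit_partition_bounds[OF P] unit_partition_mono[OF P, of i "Suc i"] that by auto
    have "qdist (\<gamma> (t i)) (\<gamma> (t (Suc i))) \<le> chain_cost (\<gamma> (t i)) (\<gamma> (t (Suc i)))"
      by (rule qdist_le_chain_cost[OF inX]) (use b in auto)
    also have "\<dots> \<le> ?I (t i) (t (Suc i))" by (rule piecewise_C1_chain_cost_le[OF pw b])
    finally show ?thesis .
  qed
  have "(\<Sum>i<m. qdist (\<gamma> (t i)) (\<gamma> (t (Suc i)))) \<le> ?I (t 0) (t m)" if "m \<le> n" for m
    using that
  proof (induction m)
    case (Suc m)
    then have "(\<Sum>i<Suc m. qdist (\<gamma> (t i)) (\<gamma> (t (Suc i)))) \<le> ?I (t 0) (t m) + ?I (t m) (t (Suc m))"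
      using step[of m] by (auto intro: add_mono)
    also have "\<dots> \<le> ?I (t 0) (t (Suc m))"
      by (rule nn_integral_adjacent_intervals_le) (use unit_partition_mono[OF P] Suc in auto)
    finally show ?case .
  qed simp
  from this[of n] show "(\<Sum>i<n. qdist (\<gamma> (t i)) (\<gamma> (t (Suc i)))) \<le> curve_length M \<tau> p act N \<gamma>"
    using P unfolding unit_partition_def curve_length_def by simp
qed

lemma piecewise_C1_quotient_path:
  assumes pw: "piecewise_C1 N \<gamma>"
  shows "quotient_path M \<tau> p act N \<gamma>"
  unfolding quotient_path_def
proof (intro conjI ballI)
  note cont = piecewise_C1_continuous[OF pw]
  show "\<gamma> ` {0..1} \<subseteq> X" using cont unfolding continuous_map_def by auto
  then have inX: "\<gamma> s \<in> X" if "s \<in> {0..1}" for s using that by blast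
  fix t :: real assume t: "t \<in> {0..1}"
  show "((\<lambda>s. qdist (\<gamma> s) (\<gamma> t)) \<longlongrightarrow> 0) (at t within {0..1})"
  proof (rule order_tendstoI)
    fix a :: ennreal assume "0 < a"
    then obtain e where e: "0 < e" "ennreal e \<le> a"
      by (cases a) (auto intro: that[of 1] simp: ennreal_less_zero_iff)
    obtain d where d: "d > 0" "\<And>z. z \<in> E \<Longrightarrow> norm z < d \<Longrightarrow> pn z < e" using pn_small[OF e(1)] by blast
    have "\<forall>\<^sub>F s in at t within {0..1}. s \<in> {0..1}" by (simp add: eventually_at_filter)
    with curve_near_exp[OF cont t d(1)] show "\<forall>\<^sub>F s in at t within {0..1}. qdist (\<gamma> s) (\<gamma> t) < a"
    proof eventually_elim
      case (elim s)
      then obtain k where k: "k \<in> E" "act (op_exp k) (\<gamma> t) = \<gamma> s" "norm k < d" by blast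
      have "exp_chain (\<gamma> s) (\<gamma> t) (pn (- k))"
        using exp_chain_single[OF E_neg[OF k(1)], of "\<gamma> s"] act_exp_inverse[OF k(1) inX[OF t]] k(2) by simp
      then have "qdist (\<gamma> s) (\<gamma> t) \<le> ennreal (pn (- k))" using qdist_le_exp_chain inX elim(2) by blast
      also have "\<dots> < ennreal e" using d(2)[OF E_neg[OF k(1)]] k(3) e(1) by (simp add: ennreal_lessI)
      finally show ?case using e(2) by (rule less_le_trans)
    qed
  qed simp
qed

lemma piecewise_smooth_imp_C1: "piecewise_smooth N \<gamma> \<Longrightarrow> piecewise_C1 N \<gamma>"
  unfolding piecewise_smooth_def piecewise_C1_def smooth_curve_on_def by blast

lemma qdist_le_rectifiable_length: "qdist (\<gamma> 0) (\<gamma> 1) \<le> rectifiable_length M \<tau> p act N \<gamma>"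
proof -
  have "(1, real) \<in> {(n, t). unit_partition n t}" by (simp add: unit_partition_def)
  from SUP_upper[OF this, of "\<lambda>(n, t). \<Sum>i<n. qdist (\<gamma> (t i)) (\<gamma> (t (Suc i)))"]
  show ?thesis unfolding rectifiable_length_def by simp
qed

lemma rectifiable_dist_eq_qdist: "rectifiable_dist M \<tau> p act N x y = qdist x y"
proof (rule antisym)
  show "qdist x y \<le> rectifiable_dist M \<tau> p act N x y"
    unfolding rectifiable_dist_def using qdist_le_rectifiable_length by (intro INF_greatest) auto
  show "rectifiable_dist M \<tau> p act N x y \<le> qdist x y"
    unfolding quotient_dist_def
  proof (rule INF_greatest)
    fix \<gamma> assume "\<gamma> \<in> {\<gamma>. piecewise_smooth N \<gamma> \<and> \<gamma> 0 = x \<and> \<gamma> 1 = y}"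
    then have \<gamma>: "piecewise_C1 N \<gamma>" "\<gamma> 0 = x" "\<gamma> 1 = y" using piecewise_smooth_imp_C1 by auto
    show "rectifiable_dist M \<tau> p act N x y \<le> curve_length M \<tau> p act N \<gamma>"
    proof (cases "curve_length M \<tau> p act N \<gamma> = \<infinity>")
      case False
      note le = rectifiable_length_le_curve_length[OF \<gamma>(1)]
      have "rectifiable_dist M \<tau> p act N x y \<le> rectifiable_length M \<tau> p act N \<gamma>"
        unfolding rectifiable_dist_def
        by (rule INF_lower) (use \<gamma> le False piecewise_C1_quotient_path in \<open>auto simp: less_top top_unique\<close>)
      then show ?thesis using le by (rule order_trans)
    qed simp
  qed
qed

end

theorem proposition4p12:
  fixes M :: "('h::complex_hilbert \<Rightarrow>\<^sub>L 'h) set"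
    and \<tau> :: "('h \<Rightarrow>\<^sub>L 'h) \<Rightarrow> complex"
    and act :: "('h \<Rightarrow>\<^sub>L 'h) \<Rightarrow> 'x \<Rightarrow> 'x"
    and N :: "('x, 'e::banach) bmanifold"
    and p :: real
  assumes "von_neumann_algebra M"
    and "faithful_normal_tracial_state M \<tau>"
    and "smooth_homogeneous_space M act N"
    and "1 \<le> p"
  shows "(\<forall>\<gamma>. piecewise_C1 N \<gamma> \<longrightarrow>
            curve_length M \<tau> p act N \<gamma> \<ge> rectifiable_length M \<tau> p act N \<gamma>) \<and>
         (\<forall>x\<in>topspace (mtop N). \<forall>u\<in>unitary_group M.
            rectifiable_dist M \<tau> p act N x (act u x) = quotient_dist M \<tau> p act N x (act u x))"
proof -
  interpret homogeneous_space M \<tau> act N p using assms by unfold_locales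
  show ?thesis using rectifiable_length_le_curve_length rectifiable_dist_eq_qdist by blast
qed

end
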